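(* Each ideal $I$ in any of the following classes is left-stable at every real $s>1$; that is, for every $s>1$ there exists $\epsilon>0$ such that $I^{\{t\}}=I^{\{s\}}$ for all $t\geq 1$ with $s-\epsilon<t<s$. (All rings mentioned have characteristic $p>0$.) (1) Monomial ideals in polynomial rings over a field. (2) Monomial ideals in affine semigroup rings over a field. (3) Homogeneous ideals of positive height in graded rings $R=\bigoplus_{g\in G}R_g$ in which each graded piece $R_g$ has length $1$ over the zeroth piece $R_0$. (4) Powers of $R_+$, where $R$ is an $\mathbb{N}$-graded ring generated in degree $1$ over $R_0$, and $R_+$ is the ideal generated by all homogeneous elements of degree $1$. (5) Principal ideals.
   Context: All rings are commutative and noetherian. $R^\circ$ denotes the set of elements of $R$ lying in no minimal prime of $R$. The letter $q$ denotes positive integer powers of $p$, and $q\gg 0$ means all sufficiently large such powers. $I^{[q]}=(f^q\mid f\in I)$ is the $q$th Frobenius power of $I$. For a real number $s\geq 1$, $I^{(s,q)}=I^{\lceil sq\rceil}+I^{[q]}$. The weak $s$-closure $I^{\{s\}}$ is the ideal of all $x\in R$ for which there exists $c\in R^\circ$ such that $cx^q\in I^{(s,q)}$ for all $q\gg 0$. Gradings are by a semigroup $G$ (with an identity element $0$ in item (3), so that the zeroth piece $R_0$ makes sense). An affine semigroup ring over a field $k$ is $k[S]$ for $S$ a finitely generated submonoid of some $\mathbb{Z}^n$; monomial ideals are those generated by monomials. *)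

theory Defs
  imports
    Complex_Main
    "HOL-Library.Poly_Mapping"
    "HOL-Library.Extended_Nat"
    "HOL-Algebra.Algebra"
    "HOL-Algebra.Algebraic_Closure_Type"
begin

section \<open>Weak \<open>s\<close>-closure\<close>

text \<open>Same convention as \<^const>\<open>semiring_char\<close>: the zero ring has characteristic 1.\<close>

definition ring_char :: "('a, 'b) ring_scheme \<Rightarrow> nat" where
  "ring_char R = Gcd {n :: nat. add_pow R n \<one>\<^bsub>R\<^esub> = \<zero>\<^bsub>R\<^esub>}"

definition minimal_primes :: "('a, 'b) ring_scheme \<Rightarrow> 'a set set" where
  "minimal_primes R = {P. primeideal P R \<and> (\<forall>Q. primeideal Q R \<and> Q \<subseteq> P \<longrightarrow> Q = P)}"

text \<open>The set written \<open>R\<^sup>\<circ>\<close>.\<close>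

definition avoiding_minimal_primes :: "('a, 'b) ring_scheme \<Rightarrow> 'a set" where
  "avoiding_minimal_primes R = carrier R - \<Union>(minimal_primes R)"

definition frobenius_power :: "('a, 'b) ring_scheme \<Rightarrow> 'a set \<Rightarrow> nat \<Rightarrow> 'a set" where
  "frobenius_power R I q = Idl\<^bsub>R\<^esub> ((\<lambda>f. f [^]\<^bsub>R\<^esub> q) ` I)"

text \<open>The ideal \<open>I\<^sup>(\<^sup>s\<^sup>,\<^sup>q\<^sup>)\<close>. Ordinary powers of ideals are powers in the monoid of ideals
  \<^const>\<open>ideals_set\<close>, so the zeroth power is the unit ideal.\<close>

definition mixed_power :: "('a, 'b) ring_scheme \<Rightarrow> real \<Rightarrow> nat \<Rightarrow> 'a set \<Rightarrow> 'a set" where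
  "mixed_power R s q I =
     (I [^]\<^bsub>ideals_set R\<^esub> nat \<lceil>s * real q\<rceil>) <+>\<^bsub>R\<^esub> frobenius_power R I q"

text \<open>The condition ``for all \<open>q \<gg> 0\<close>'' becomes ``for all sufficiently large exponents \<open>e\<close>'' with
  \<open>q = p ^ e\<close>.\<close>

definition weak_closure :: "('a, 'b) ring_scheme \<Rightarrow> nat \<Rightarrow> real \<Rightarrow> 'a set \<Rightarrow> 'a set" where
  "weak_closure R p s I = {x \<in> carrier R. \<exists>c \<in> avoiding_minimal_primes R.
     \<forall>\<^sub>F e in sequentially. c \<otimes>\<^bsub>R\<^esub> x [^]\<^bsub>R\<^esub> (p ^ e) \<in> mixed_power R s (p ^ e) I}"

definition left_stable :: "('a, 'b) ring_scheme \<Rightarrow> nat \<Rightarrow> 'a set \<Rightarrow> real \<Rightarrow> bool" where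
  "left_stable R p I s \<longleftrightarrow>
     (\<exists>\<epsilon>>0. \<forall>t\<ge>1. s - \<epsilon> < t \<and> t < s \<longrightarrow> weak_closure R p t I = weak_closure R p s I)"


section \<open>Height and length\<close>

definition prime_height :: "('a, 'b) ring_scheme \<Rightarrow> 'a set \<Rightarrow> enat" where
  "prime_height R P = Sup {enat n | n Q.
     (\<forall>i\<le>n. primeideal (Q i) R) \<and> (\<forall>i<n. Q i \<subset> Q (Suc i)) \<and> Q n = P}"

text \<open>The unit ideal has height \<open>\<infinity>\<close>, the infimum of the empty set.\<close>

definition ideal_height :: "('a, 'b) ring_scheme \<Rightarrow> 'a set \<Rightarrow> enat" where
  "ideal_height R I = Inf {prime_height R P | P. primeideal P R \<and> I \<subseteq> P}"

definition module_length ::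
    "('a, 'b) ring_scheme \<Rightarrow> ('a, 'c, 'd) module_scheme \<Rightarrow> enat" where
  "module_length R M = Sup {enat n | n N.
     (\<forall>i\<le>n. submodule (N i) R M) \<and> (\<forall>i<n. N i \<subset> N (Suc i))}"


section \<open>Graded rings\<close>

text \<open>The grading monoid is a type, written additively but not assumed commutative or cancellative.
  For a cancellative monoid the condition that \<open>\<one>\<close> has degree \<open>0\<close> follows from the others; in
  general it is what makes the piece of degree \<open>0\<close> a subring.\<close>

locale graded_ring = cring R for R (structure) +
  fixes \<A> :: "'g :: monoid_add \<Rightarrow> 'a set"
  assumes piece_subgroup: "additive_subgroup (\<A> g) R"
    and one_piece: "\<one> \<in> \<A> 0"
    and mult_piece: "\<lbrakk>x \<in> \<A> g; y \<in> \<A> h\<rbrakk> \<Longrightarrow> x \<otimes> y \<in> \<A> (g + h)"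
    and direct_sum: "x \<in> carrier R \<Longrightarrow>
      \<exists>!f. (\<forall>g. f g \<in> \<A> g) \<and> finite {g. f g \<noteq> \<zero>} \<and> x = (\<Oplus>g\<in>{g. f g \<noteq> \<zero>}. f g)"

definition homogeneous_ideal :: "('a, 'b) ring_scheme \<Rightarrow> ('g \<Rightarrow> 'a set) \<Rightarrow> 'a set \<Rightarrow> bool" where
  "homogeneous_ideal R \<A> I \<longleftrightarrow> (\<exists>H \<subseteq> (\<Union>g. \<A> g). I = Idl\<^bsub>R\<^esub> H)"

definition zeroth_ring :: "('a, 'b) ring_scheme \<Rightarrow> ('g :: zero \<Rightarrow> 'a set) \<Rightarrow> ('a, 'b) ring_scheme" where
  "zeroth_ring R \<A> = R\<lparr>carrier := \<A> 0\<rparr>"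

text \<open>The piece of degree \<open>g\<close> as a module over the piece of degree \<open>0\<close>. The fields \<open>mult\<close> and
  \<open>one\<close> are there only because the record type \<^typ>\<open>('a, 'a) module\<close> extends rings.\<close>

definition piece_module :: "('a, 'b) ring_scheme \<Rightarrow> ('g \<Rightarrow> 'a set) \<Rightarrow> 'g \<Rightarrow> ('a, 'a) module" where
  "piece_module R \<A> g =
     \<lparr>carrier = \<A> g, monoid.mult = monoid.mult R, one = \<one>\<^bsub>R\<^esub>,
      ring.zero = \<zero>\<^bsub>R\<^esub>, ring.add = ring.add R, module.smult = monoid.mult R\<rparr>"

definition generated_in_degree_one :: "('a, 'b) ring_scheme \<Rightarrow> (nat \<Rightarrow> 'a set) \<Rightarrow> bool" where
  "generated_in_degree_one R \<A> \<longleftrightarrow> generate_ring R (\<A> 0 \<union> \<A> 1) = carrier R"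

definition irrelevant_ideal :: "('a, 'b) ring_scheme \<Rightarrow> (nat \<Rightarrow> 'a set) \<Rightarrow> 'a set" where
  "irrelevant_ideal R \<A> = Idl\<^bsub>R\<^esub> (\<A> 1)"


section \<open>Polynomial rings and affine semigroup rings\<close>

definition add_submonoid :: "'m :: monoid_add set \<Rightarrow> bool" where
  "add_submonoid S \<longleftrightarrow> 0 \<in> S \<and> (\<forall>x\<in>S. \<forall>y\<in>S. x + y \<in> S)"

text \<open>\<open>k[S]\<close> for a submonoid \<open>S\<close> of \<open>'m\<close>, as the subring of \<open>k['m]\<close> (whose multiplication is the
  convolution product of finitely supported functions) of the elements supported in \<open>S\<close>.\<close>

definition monoid_algebra :: "'m :: comm_monoid_add set \<Rightarrow> ('m \<Rightarrow>\<^sub>0 'k :: field) ring" where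
  "monoid_algebra S = ring_of_type_algebra\<lparr>carrier := {f. Poly_Mapping.keys f \<subseteq> S}\<rparr>"

lemma cring_monoid_algebra:
  assumes "add_submonoid S"
  shows "cring (monoid_algebra S :: ('m :: comm_monoid_add \<Rightarrow>\<^sub>0 'k :: field) ring)"
proof -
  let ?K = "ring_of_type_algebra :: ('m \<Rightarrow>\<^sub>0 'k) ring"
  let ?C = "{f :: 'm \<Rightarrow>\<^sub>0 'k. Poly_Mapping.keys f \<subseteq> S}"
  interpret K: cring ?K by (rule cring_from_type_algebra)
  have minus: "\<ominus>\<^bsub>?K\<^esub> f = - f" for f
    by (rule K.minus_equality) (simp_all add: ring_of_type_algebra_def)
  have "subring ?C ?K"
  proof (rule K.subringI)
    show "?C \<subseteq> carrier ?K" by (simp add: ring_of_type_algebra_def)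
    show "\<one>\<^bsub>?K\<^esub> \<in> ?C" using assms by (simp add: ring_of_type_algebra_def add_submonoid_def)
  next
    fix f assume "f \<in> ?C"
    moreover have "Poly_Mapping.keys (- f) = Poly_Mapping.keys f"
      by (simp add: set_eq_iff flip: lookup_not_eq_zero_eq_in_keys)
    ultimately show "\<ominus>\<^bsub>?K\<^esub> f \<in> ?C" by (simp add: minus)
  next
    fix f g assume fg: "f \<in> ?C" "g \<in> ?C"
    have "Poly_Mapping.keys (f + g) \<subseteq> S"
      using fg by (intro order_trans[OF keys_add]) simp
    then show "f \<oplus>\<^bsub>?K\<^esub> g \<in> ?C" by (simp add: ring_of_type_algebra_def)
    have "{a + b | a b. a \<in> Poly_Mapping.keys f \<and> b \<in> Poly_Mapping.keys g} \<subseteq> S"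
      using fg assms unfolding add_submonoid_def by blast
    then have "Poly_Mapping.keys (f * g) \<subseteq> S"
      by (rule order_trans[OF keys_mult])
    then show "f \<otimes>\<^bsub>?K\<^esub> g \<in> ?C" by (simp add: ring_of_type_algebra_def)
  qed
  then have "subcring ?C ?K" by (rule K.subcringI')
  moreover have "?C \<subseteq> carrier ?K" by (simp add: ring_of_type_algebra_def)
  ultimately show ?thesis
    unfolding monoid_algebra_def using K.subcring_iff by blast
qed

definition monomial_ideal :: "'m :: comm_monoid_add set \<Rightarrow> ('m \<Rightarrow>\<^sub>0 'k :: field) set \<Rightarrow> bool" where
  "monomial_ideal S I \<longleftrightarrow>
     (\<exists>A \<subseteq> S. I = Idl\<^bsub>monoid_algebra S\<^esub> ((\<lambda>a. Poly_Mapping.single a 1) ` A))"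

text \<open>The exponents of the monomials in the variables \<open>x\<^sub>i\<close> with \<open>i < n\<close>, so that
  \<open>monoid_algebra (nat_vectors n)\<close> is \<open>k[x\<^sub>0, \<dots>, x\<^bsub>n-1\<^esub>]\<close>.\<close>

definition nat_vectors :: "nat \<Rightarrow> (nat \<Rightarrow>\<^sub>0 nat) set" where
  "nat_vectors n = {v. Poly_Mapping.keys v \<subseteq> {..<n}}"

definition int_vectors :: "nat \<Rightarrow> (nat \<Rightarrow>\<^sub>0 int) set" where
  "int_vectors n = {v. Poly_Mapping.keys v \<subseteq> {..<n}}"

definition affine_semigroup :: "nat \<Rightarrow> (nat \<Rightarrow>\<^sub>0 int) set \<Rightarrow> bool" where
  "affine_semigroup n S \<longleftrightarrow> (\<exists>F \<subseteq> int_vectors n. finite F \<and> S = add_submonoid hull F)"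

end

theory Submission
  imports Defs
begin

text \<open>
  Throughout, \<open>q = p ^ e\<close>. The weak closures shrink as the exponent grows, so left stability at \<open>s\<close>
  means that membership of \<open>x\<close> in the closure at some \<open>t\<close> slightly below \<open>s\<close> can be improved to
  membership at \<open>s\<close>, with a bound on \<open>s - t\<close> that does not depend on \<open>x\<close>.

  For a principal ideal there is nothing to improve: \<open>I\<^sup>n\<close> lies in \<open>I\<^sup>[\<^sup>q\<^sup>]\<close> as soon as \<open>n \<ge> q\<close>, so the mixed
  powers do not depend on the exponent (\<open>mixed_power_principal\<close>). In the other cases the multiplier
  \<open>c\<close> has to be changed. By prime avoidance this can be done at one minimal prime \<open>P\<close> at a time, and it
  is even enough to work modulo \<open>P\<close>, because errors in \<open>P\<close> can be made nilpotent and then removed by a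
  Frobenius power (\<open>weak_closure_modulo_minimal_primes\<close>).

  Let \<open>I = R\<^sub>+\<^sup>n\<close>. Then \<open>I\<^sup>m\<close> consists of the elements without components in degrees below \<open>n m\<close>. Let \<open>D\<close> be the
  least integer with \<open>D \<ge> n s\<close>. The part of \<open>x\<close> in degrees at least \<open>D\<close> always lies in the closure at \<open>s\<close>
  (\<open>irrelevant_pow_subset_weak_closure\<close>). The remaining part \<open>z\<close> has degree at most \<open>D - 1\<close>; if
  \<open>n t > D - 1\<close>, then the degree of \<open>c z\<^sup>q\<close> is below \<open>n t q\<close> for large \<open>q\<close>, so in a relation
  \<open>c z\<^sup>q \<in> I\<^sup>\<lceil>\<^sup>t\<^sup>q\<^sup>\<rceil> + I\<^sup>[\<^sup>q\<^sup>]\<close> only the second summand matters, and the relation holds for every exponent.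

  In the three remaining classes the ring is graded with pieces of length at most one over the piece
  of degree zero. Hence a homogeneous element of a sum of homogeneous ideals lies in one of them, and
  every nonzero component of \<open>c x\<^sup>q\<close> is a multiple by an element of degree zero of one of finitely many
  products \<open>c\<^sub>h x\<^sub>g\<^sup>q\<close> of components, and conversely. It remains to improve relations
  \<open>y x\<^sup>q \<in> I\<^sup>\<lceil>\<^sup>t\<^sup>q\<^sup>\<rceil>\<close> with \<open>x\<close> and \<open>y\<close> homogeneous, modulo a minimal prime \<open>P\<close> (\<open>slope_gap\<close>). Modulo \<open>P\<close> and up to
  units, every homogeneous element outside \<open>P\<close> is a monomial in a finite set of elements, which may be
  taken to include the generators of \<open>I\<close> outside \<open>P\<close>. If the relation holds for infinitely many \<open>q\<close>,
  Dickson's lemma yields two of them whose exponent vectors are comparable; dividing one by the other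
  eliminates \<open>y\<close> and represents a power \<open>x\<^sup>m\<close> as a monomial with \<open>n\<close> factors among the generators of \<open>I\<close>,
  where the slope \<open>n / m\<close> is only slightly below \<open>t\<close> or larger (\<open>recurrence_of_exponents\<close>). By the exchange
  argument of linear programming such a representation may be replaced by one of at least the same
  slope whose exponent vector has independent support, and the slopes of these have a common
  denominator \<open>K\<close> that depends only on the finite set (\<open>bounded_denominator\<close>). So there is a gap below \<open>s\<close>:
  a slope that is close enough to \<open>s\<close> from below is at least \<open>s\<close>. A relation for one power of \<open>x\<close>
  with slope at least \<open>s\<close> gives \<open>C y x\<^sup>q \<in> I\<^sup>\<lceil>\<^sup>s\<^sup>q\<^sup>\<rceil> + P\<close> for all \<open>q\<close> with a fixed \<open>C\<close>
  (\<open>bounded_multiplier\<close>); here \<open>C\<close> is a power of an element of \<open>I\<close> outside \<open>P\<close>, which exists because \<open>I\<close> has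
  positive height.
\<close>

section \<open>Rational optima of integer cones\<close>

text \<open>Intended reading: \<open>J\<close> indexes finitely many elements of a cancellative commutative monoid, and \<open>L\<close>
  consists of the exponent vectors of the relations among them. Vectors are functions on the whole
  index type, so membership in \<open>L\<close> has to depend on the values on \<open>J\<close> only.\<close>

locale relation_lattice =
  fixes J :: "'j set" and L :: "('j \<Rightarrow> int) set"
  assumes finite_J: "finite J"
    and zero_L: "(\<lambda>_. 0) \<in> L"
    and add_L: "r \<in> L \<Longrightarrow> r' \<in> L \<Longrightarrow> (\<lambda>j. r j + r' j) \<in> L"
    and neg_L: "r \<in> L \<Longrightarrow> (\<lambda>j. - r j) \<in> L"
    and cong_L: "r \<in> L \<Longrightarrow> (\<And>j. j \<in> J \<Longrightarrow> r' j = r j) \<Longrightarrow> r' \<in> L"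
begin

definition independent :: "'j set \<Rightarrow> bool" where
  "independent B \<longleftrightarrow> B \<subseteq> J \<and> (\<forall>r\<in>L. (\<forall>j\<in>J - B. r j = 0) \<longrightarrow> (\<forall>j\<in>B. r j = 0))"

lemma independentD:
  assumes "independent B" and "r \<in> L" and "\<forall>j\<in>J - B. r j = 0"
  shows "\<forall>j\<in>B. r j = 0"
  using assms unfolding independent_def by blast

lemma scale_L:
  assumes "r \<in> L" shows "(\<lambda>j. k * r j) \<in> L"
proof (induction k rule: int_induct[where k = 0])
  case base show ?case using zero_L by simp
next
  case (step1 i)
  then show ?case using add_L[OF step1(2) assms] by (simp add: algebra_simps)
next
  case (step2 i)
  then show ?case using add_L[OF step2(2) neg_L[OF assms]] by (simp add: algebra_simps)
qed

lemma sum_L: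
  assumes "\<And>i. i \<in> A \<Longrightarrow> r i \<in> L" shows "(\<lambda>j. \<Sum>i\<in>A. r i j) \<in> L"
  using assms by (induction A rule: infinite_finite_induct) (auto intro: zero_L add_L)

text \<open>Extend \<open>B\<close> to a maximal independent set \<open>B'\<close>. By maximality every unit vector has a positive multiple
  that is congruent modulo \<open>L\<close> to a vector supported on \<open>B'\<close>; let \<open>K\<close> be the product of these multiples,
  and let \<open>K a\<close> be congruent to \<open>V\<close>. If \<open>w - m a\<close> is a relation, then so is \<open>K w - m V\<close>; being supported on
  the independent set \<open>B'\<close>, it vanishes.\<close>

lemma denominator_of_independent:
  assumes "independent B"
  shows "\<exists>K::nat. K \<ge> 1 \<and> (\<forall>a m w. (\<lambda>j. w j - m * a j) \<in> L \<longrightarrow> (\<forall>j\<in>J - B. w j = 0) \<longrightarrow>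
      (\<forall>j\<in>J. m dvd int K * w j))"
proof -
  have "finite {B'. independent B' \<and> B \<subseteq> B'}"
    by (rule finite_subset[OF _ finite_Pow_iff[THEN iffD2, OF finite_J]])
      (auto simp: independent_def)
  moreover have "B \<in> {B'. independent B' \<and> B \<subseteq> B'}" using assms by simp
  ultimately obtain B' where B'in: "B' \<in> {B'. independent B' \<and> B \<subseteq> B'}"
    and B'max: "\<forall>B''\<in>{B'. independent B' \<and> B \<subseteq> B'}. B' \<subseteq> B'' \<longrightarrow> B' = B''"
    using finite_has_maximal2[of "{B'. independent B' \<and> B \<subseteq> B'}" B] by blast
  have B': "independent B'" "B \<subseteq> B'" using B'in by auto
  have max: "B' = B''" if "independent B''" "B \<subseteq> B''" "B' \<subseteq> B''" for B''
    using B'max that by blast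
  have "\<exists>k v. 1 \<le> k \<and> (\<forall>i\<in>J - B'. v i = 0) \<and> (\<lambda>i. (if i = j then int k else 0) - v i) \<in> L"
    if j: "j \<in> J" for j
  proof (cases "j \<in> B'")
    case True
    then show ?thesis
      by (intro exI[of _ "1::nat"] exI[of _ "\<lambda>i. if i = j then 1 else 0"]) (auto intro: cong_L[OF zero_L])
  next
    case False
    then have "\<not> independent (insert j B')"
      using max[of "insert j B'"] B' by blast
    moreover have "insert j B' \<subseteq> J" using j B' by (auto simp: independent_def)
    ultimately obtain r where r: "r \<in> L" "\<forall>i\<in>J - insert j B'. r i = 0"
      and nz: "\<exists>i\<in>insert j B'. r i \<noteq> 0"
      unfolding independent_def by blast
    have rj: "r j \<noteq> 0"
    proof
      assume "r j = 0"
      then have "\<forall>i\<in>J - B'. r i = 0" using r(2) by auto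
      then have "\<forall>i\<in>B'. r i = 0" by (rule independentD[OF B'(1) r(1)])
      then show False using nz \<open>r j = 0\<close> by auto
    qed
    define r' where "r' = (\<lambda>i. sgn (r j) * r i)"
    have r': "r' \<in> L" "\<forall>i\<in>J - insert j B'. r' i = 0" "r' j > 0"
      using scale_L[OF r(1)] r(2) rj by (auto simp: r'_def sgn_if)
    show ?thesis
    proof (intro exI[of _ "nat (r' j)"] exI[of _ "\<lambda>i. if i = j then 0 else - r' i"] conjI)
      show "1 \<le> nat (r' j)" using r'(3) by simp
      show "\<forall>i\<in>J - B'. (if i = j then 0 else - r' i) = 0" using r'(2) by auto
      show "(\<lambda>i. (if i = j then int (nat (r' j)) else 0) - (if i = j then 0 else - r' i)) \<in> L"
        by (rule cong_L[OF r'(1)]) (use r'(3) in auto)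
    qed
  qed
  then obtain k v where kv: "\<And>j. j \<in> J \<Longrightarrow> (1::nat) \<le> k j"
    "\<And>j i. j \<in> J \<Longrightarrow> i \<in> J - B' \<Longrightarrow> v j i = 0"
    "\<And>j. j \<in> J \<Longrightarrow> (\<lambda>i. (if i = j then int (k j) else 0) - v j i) \<in> L"
    by metis
  define K where "K = (\<Prod>j\<in>J. k j)"
  have "1 \<le> K" unfolding K_def using kv(1) by (intro prod_ge_1) auto
  moreover have "m dvd int K * w j"
    if wL: "(\<lambda>j. w j - m * a j) \<in> L" and w0: "\<And>j. j \<in> J - B \<Longrightarrow> w j = 0" and j: "j \<in> J" for a m w j
  proof -
    have div: "k j dvd K" if "j \<in> J" for j
      unfolding K_def using finite_J that by (rule dvd_prodI)
    define V where "V = (\<lambda>i. \<Sum>j\<in>J. int (K div k j) * a j * v j i)"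
    have "(\<lambda>i. \<Sum>j\<in>J. (int (K div k j) * a j) * ((if i = j then int (k j) else 0) - v j i)) \<in> L"
      by (intro sum_L scale_L kv(3))
    then have KV: "(\<lambda>i. int K * a i - V i) \<in> L"
    proof (rule cong_L)
      fix i assume i: "i \<in> J"
      have "(\<Sum>j\<in>J. (int (K div k j) * a j) * ((if i = j then int (k j) else 0) - v j i))
          = (\<Sum>j\<in>J. (if i = j then int (K div k j) * a j * int (k j) else 0) -
               int (K div k j) * a j * v j i)"
        by (rule sum.cong) (auto simp: right_diff_distrib)
      also have "\<dots> = (\<Sum>j\<in>J. (if i = j then int (K div k j) * a j * int (k j) else 0)) - V i"
        unfolding V_def by (rule sum_subtractf)
      also have "(\<Sum>j\<in>J. (if i = j then int (K div k j) * a j * int (k j) else 0))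
          = int (K div k i) * a i * int (k i)"
        using i finite_J by simp
      also have "\<dots> = int (K div k i * k i) * a i" by (simp only: of_nat_mult mult_ac)
      also have "K div k i * k i = K" using div[OF i] by simp
      finally show "int K * a i - V i =
         (\<Sum>j\<in>J. (int (K div k j) * a j) * ((if i = j then int (k j) else 0) - v j i))" by simp
    qed
    have "(\<lambda>i. int K * (w i - m * a i) + m * (int K * a i - V i)) \<in> L"
      by (intro add_L scale_L wL KV)
    then have comb: "(\<lambda>i. int K * w i - m * V i) \<in> L"
      by (rule cong_L) (simp add: algebra_simps)
    have "\<forall>i\<in>J - B'. int K * w i - m * V i = 0"
    proof
      fix i assume i: "i \<in> J - B'"
      then have "V i = 0" unfolding V_def by (intro sum.neutral) (simp add: kv(2))
      moreover have "w i = 0" using i B'(2) by (intro w0) auto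
      ultimately show "int K * w i - m * V i = 0" by simp
    qed
    then have "\<forall>i\<in>B'. int K * w i - m * V i = 0"
      using independentD[OF B'(1) comb] by simp
    then show ?thesis
    proof (cases "j \<in> B'")
      case True
      with \<open>\<forall>i\<in>B'. int K * w i - m * V i = 0\<close> have "int K * w j = m * V j" by simp
      then show ?thesis by (rule dvdI)
    next
      case False
      then have "j \<in> J - B" using j B'(2) by blast
      then have "w j = 0" by (rule w0)
      then show ?thesis by simp
    qed
  qed
  ultimately show ?thesis by (intro exI[of _ K]) simp
qed

text \<open>The exchange step of linear programming. If the support of \<open>w\<close> is dependent, it carries a nonzero
  relation; signed such that the weight on \<open>F\<close> does not decrease, it has a negative coordinate, because
  a nonnegative relation has weight zero on \<open>F\<close> and could be negated. Moving \<open>w\<close> along this relation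
  until the first coordinate vanishes makes the support smaller.\<close>

lemma reduce_to_independent_support:
  fixes w :: "'j \<Rightarrow> nat" and m :: nat
  assumes FJ: "F \<subseteq> J"
    and pos: "\<And>r. \<lbrakk>r \<in> L; \<And>j. j \<in> J \<Longrightarrow> r j \<ge> 0\<rbrakk> \<Longrightarrow> (\<Sum>j\<in>F. r j) = 0"
    and "m \<ge> 1" and "(\<lambda>j. int (w j) - int m * a j) \<in> L"
  shows "\<exists>m' w'. m' \<ge> 1 \<and> (\<lambda>j. int (w' j) - int m' * a j) \<in> L \<and>
     (\<Sum>j\<in>F. w j) * m' \<le> (\<Sum>j\<in>F. w' j) * m \<and> independent {j \<in> J. w' j \<noteq> 0}"
  using assms(3,4)
proof (induction "card {j \<in> J. w j \<noteq> 0}" arbitrary: m w rule: less_induct)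
  case less
  let ?S = "{j \<in> J. w j \<noteq> 0}"
  show ?case
  proof (cases "independent ?S")
    case True
    then show ?thesis using less.prems by (intro exI[of _ m] exI[of _ w]) auto
  next
    case False
    then obtain r where r: "r \<in> L" "\<forall>j\<in>J - ?S. r j = 0" "\<exists>j\<in>?S. r j \<noteq> 0"
      unfolding independent_def by auto
    have "\<exists>r'\<in>L. (\<forall>j\<in>J - ?S. r' j = 0) \<and> (\<Sum>j\<in>F. r' j) \<ge> 0 \<and> (\<exists>j\<in>J. r' j < 0)"
    proof -
      let ?r = "\<lambda>j. - r j"
      have n: "?r \<in> L" "(\<Sum>j\<in>F. ?r j) = - (\<Sum>j\<in>F. r j)"
        using r(1) neg_L by (auto simp: sum_negf)
      consider "(\<Sum>j\<in>F. r j) > 0" | "(\<Sum>j\<in>F. r j) < 0" | "(\<Sum>j\<in>F. r j) = 0" by linarith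
      then show ?thesis
      proof cases
        case 1
        then have "\<exists>j\<in>J. r j < 0" using pos[OF r(1)] by (metis not_less order_less_irrefl)
        then show ?thesis using 1 r by (intro bexI[of _ r]) auto
      next
        case 2
        then have "\<exists>j\<in>J. ?r j < 0" using pos[OF n(1)] n(2)
          by (metis not_less neg_0_less_iff_less order_less_irrefl)
        then show ?thesis using 2 r n by (intro bexI[of _ ?r]) auto
      next
        case 3
        from r(3) obtain j where "j \<in> J" "r j < 0 \<or> ?r j < 0" by fastforce
        then show ?thesis
        proof (elim disjE)
          assume "j \<in> J" "r j < 0"
          then show ?thesis using 3 r by (intro bexI[of _ r]) auto
        next
          assume "j \<in> J" "?r j < 0"
          then show ?thesis using 3 r n by (intro bexI[of _ ?r]) auto
        qed
      qed
    qed
    then obtain r' where r': "r' \<in> L" "\<forall>j\<in>J - ?S. r' j = 0" "(\<Sum>j\<in>F. r' j) \<ge> 0"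
      and neg: "\<exists>j\<in>J. r' j < 0" by blast
    define N where "N = {j \<in> J. r' j < 0}"
    have "finite N" "N \<noteq> {}" using neg finite_J by (auto simp: N_def)
    then obtain j0 where j0: "j0 \<in> N"
      and min: "\<And>j. j \<in> N \<Longrightarrow> real (w j0) / real_of_int (- r' j0) \<le> real (w j) / real_of_int (- r' j)"
      using arg_min_if_finite[of N "\<lambda>j. real (w j) / real_of_int (- r' j)"]
      by (simp add: not_less[symmetric])
    \<comment> \<open>The step length \<open>w j0 / (- r' j0)\<close> is the largest one that keeps all coordinates nonnegative. As it
    is only rational, the whole representation is multiplied by its denominator \<open>d\<close>.\<close>
    define d where "d = nat (- r' j0)"
    define k where "k = w j0"
    have d: "d \<ge> 1" "int d = - r' j0" using j0 by (auto simp: d_def N_def)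
    have ge: "int d * int (w j) + int k * r' j \<ge> 0" if j: "j \<in> J" for j
    proof (cases "r' j < 0")
      case True
      then have "real (w j0) / real_of_int (- r' j0) \<le> real (w j) / real_of_int (- r' j)"
        using j by (intro min) (auto simp: N_def)
      then have "real k * real_of_int (- r' j) \<le> real (w j) * real_of_int (- r' j0)"
        using True j0 by (simp add: N_def k_def field_simps)
      then have "real_of_int (int k * (- r' j)) \<le> real_of_int (int (w j) * (- r' j0))" by simp
      then have "int k * (- r' j) \<le> int (w j) * (- r' j0)" by (simp only: of_int_le_iff)
      then show ?thesis using d(2) by (simp add: algebra_simps)
    qed simp
    define w' where "w' j = nat (int d * int (w j) + int k * r' j)" for j
    have w'eq: "int (w' j) = int d * int (w j) + int k * r' j" if "j \<in> J" for j
      using ge[OF that] by (simp add: w'_def)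
    have j0S: "j0 \<in> ?S"
    proof (rule ccontr)
      assume "j0 \<notin> ?S"
      then have "r' j0 = 0" using r'(2) j0 by (simp add: N_def)
      then show False using j0 by (simp add: N_def)
    qed
    have "{j \<in> J. w' j \<noteq> 0} \<subseteq> ?S - {j0}"
    proof
      fix j assume "j \<in> {j \<in> J. w' j \<noteq> 0}"
      then have j: "j \<in> J" "w' j \<noteq> 0" by auto
      have "j \<noteq> j0" using j d(2) by (auto simp: w'_def k_def)
      moreover have "j \<in> ?S" using j r'(2) by (auto simp: w'_def)
      ultimately show "j \<in> ?S - {j0}" by blast
    qed
    then have "{j \<in> J. w' j \<noteq> 0} \<subset> ?S" using j0S by blast
    then have smaller: "card {j \<in> J. w' j \<noteq> 0} < card ?S"
      using finite_J by (intro psubset_card_mono) auto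
    have "(\<lambda>j. int d * (int (w j) - int m * a j) + int k * r' j) \<in> L"
      by (intro add_L scale_L less.prems r'(1))
    then have "(\<lambda>j. int (w' j) - int (d * m) * a j) \<in> L"
      by (rule cong_L) (simp add: w'eq algebra_simps)
    moreover have "d * m \<ge> 1" using d less.prems by simp
    ultimately obtain m'' w'' where IH: "m'' \<ge> 1" "(\<lambda>j. int (w'' j) - int m'' * a j) \<in> L"
      "(\<Sum>j\<in>F. w' j) * m'' \<le> (\<Sum>j\<in>F. w'' j) * (d * m)" "independent {j \<in> J. w'' j \<noteq> 0}"
      using less.hyps[OF smaller] by blast
    have "int (\<Sum>j\<in>F. w' j) = (\<Sum>j\<in>F. int d * int (w j) + int k * r' j)"
      unfolding of_nat_sum using FJ w'eq by (intro sum.cong) auto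
    also have "\<dots> = int (d * (\<Sum>j\<in>F. w j)) + int k * (\<Sum>j\<in>F. r' j)"
      by (simp add: sum.distrib sum_distrib_left)
    also have "\<dots> \<ge> int (d * (\<Sum>j\<in>F. w j))" using r'(3) by simp
    finally have "d * (\<Sum>j\<in>F. w j) \<le> (\<Sum>j\<in>F. w' j)" by (simp only: of_nat_le_iff)
    then have "d * (\<Sum>j\<in>F. w j) * m'' \<le> (\<Sum>j\<in>F. w' j) * m''" by simp
    also note IH(3)
    finally have "d * ((\<Sum>j\<in>F. w j) * m'') \<le> d * ((\<Sum>j\<in>F. w'' j) * m)" by (simp add: algebra_simps)
    then have "(\<Sum>j\<in>F. w j) * m'' \<le> (\<Sum>j\<in>F. w'' j) * m" using d by simp
    then show ?thesis using IH by blast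
  qed
qed

text \<open>One \<open>K\<close> serves all vectors \<open>a\<close>, since there are only finitely many independent sets.\<close>

theorem bounded_denominator:
  assumes FJ: "F \<subseteq> J"
    and pos: "\<And>r. \<lbrakk>r \<in> L; \<And>j. j \<in> J \<Longrightarrow> r j \<ge> 0\<rbrakk> \<Longrightarrow> (\<Sum>j\<in>F. r j) = 0"
  obtains K :: nat where "K \<ge> 1"
    and "\<And>a m w. \<lbrakk>m \<ge> 1; (\<lambda>j. int (w j) - int m * a j) \<in> L\<rbrakk> \<Longrightarrow>
      \<exists>m' w'. m' \<ge> 1 \<and> (\<lambda>j. int (w' j) - int m' * a j) \<in> L \<and>
        (\<Sum>j\<in>F. w j) * m' \<le> (\<Sum>j\<in>F. w' j) * m \<and> m' dvd K * (\<Sum>j\<in>F. w' j)"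
proof -
  define good where "good B K \<longleftrightarrow> K \<ge> 1 \<and> (\<forall>a m w. (\<lambda>j. w j - m * a j) \<in> L \<longrightarrow>
      (\<forall>j\<in>J - B. w j = 0) \<longrightarrow> (\<forall>j\<in>J. m dvd int K * w j))" for B and K :: nat
  have "\<forall>B\<in>{B. independent B}. \<exists>K. good B K"
    using denominator_of_independent unfolding good_def by simp
  then obtain k where "\<forall>B\<in>{B. independent B}. good B (k B)" by (rule bchoice[THEN exE])
  then have k: "\<And>B. independent B \<Longrightarrow> (1::nat) \<le> k B"
    "\<And>B a m w j. \<lbrakk>independent B; (\<lambda>j. w j - m * a j) \<in> L; \<forall>j\<in>J - B. w j = 0; j \<in> J\<rbrakk>
       \<Longrightarrow> m dvd int (k B) * w j"
    unfolding good_def by auto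
  have fin: "finite {B. independent B}"
    by (rule finite_subset[OF _ finite_Pow_iff[THEN iffD2, OF finite_J]])
      (auto simp: independent_def)
  define K where "K = (\<Prod>B | independent B. k B)"
  have "1 \<le> K" unfolding K_def using k(1) by (intro prod_ge_1) auto
  moreover have "\<exists>m' w'. m' \<ge> 1 \<and> (\<lambda>j. int (w' j) - int m' * a j) \<in> L \<and>
        (\<Sum>j\<in>F. w j) * m' \<le> (\<Sum>j\<in>F. w' j) * m \<and> m' dvd K * (\<Sum>j\<in>F. w' j)"
    if mw: "m \<ge> 1" "(\<lambda>j. int (w j) - int m * a j) \<in> L" for a m w
  proof -
    obtain m' w' where *: "m' \<ge> 1" "(\<lambda>j. int (w' j) - int m' * a j) \<in> L"
      "(\<Sum>j\<in>F. w j) * m' \<le> (\<Sum>j\<in>F. w' j) * m" "independent {j \<in> J. w' j \<noteq> 0}"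
      using reduce_to_independent_support[OF FJ pos mw] by blast
    let ?B = "{j \<in> J. w' j \<noteq> 0}"
    have "m' dvd K * w' j" if "j \<in> F" for j
    proof -
      have "int m' dvd int (k ?B) * int (w' j)"
        using *(4,2) by (rule k(2)) (use that FJ in auto)
      then have "m' dvd k ?B * w' j" by (simp only: of_nat_mult[symmetric] of_nat_dvd_iff)
      moreover have "k ?B dvd K" unfolding K_def using fin *(4) by (intro dvd_prodI) auto
      ultimately show ?thesis by (meson dvd_trans mult_dvd_mono dvd_refl)
    qed
    then have "m' dvd K * (\<Sum>j\<in>F. w' j)"
      unfolding sum_distrib_left by (intro dvd_sum) auto
    then show ?thesis using * by blast
  qed
  ultimately show thesis by (rule that)
qed

end

lemma monotone_subsequence_nat:
  fixes f :: "nat \<Rightarrow> nat"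
  obtains g :: "nat \<Rightarrow> nat" where "strict_mono g" and "mono (f \<circ> g)"
proof -
  obtain g where g: "strict_mono g" "monoseq (\<lambda>n. f (g n))"
    using seq_monosub[of f] by blast
  show thesis
  proof (cases "mono (f \<circ> g)")
    case True
    with g show ?thesis using that by blast
  next
    case False
    then have dec: "antimono (f \<circ> g)"
      using g(2) unfolding monoseq_iff by (auto simp: comp_def)
    obtain N where N: "\<And>n. f (g N) \<le> f (g n)"
      using ex_has_least_nat[of "\<lambda>_. True" _ "\<lambda>n. f (g n)"] by auto
    have eq: "f (g n) = f (g N)" if "n \<ge> N" for n
      using N antimonoD[OF dec that] by (simp add: le_antisym)
    have "strict_mono (\<lambda>n. g (n + N))" using g(1) by (simp add: strict_mono_def)
    moreover have "mono (f \<circ> (\<lambda>n. g (n + N)))" by (simp add: mono_def eq[of "x + N" for x])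
    ultimately show ?thesis by (rule that)
  qed
qed

lemma dickson_subsequence:
  fixes w :: "nat \<Rightarrow> 'j \<Rightarrow> nat"
  assumes "finite J"
  shows "\<exists>g::nat \<Rightarrow> nat. strict_mono g \<and> (\<forall>j\<in>J. mono (\<lambda>n. w (g n) j))"
  using assms
proof (induction J)
  case empty
  then show ?case by (auto intro!: exI[of _ "\<lambda>n::nat. n"] simp: strict_mono_def)
next
  case (insert i J)
  then obtain g :: "nat \<Rightarrow> nat" where g: "strict_mono g" "\<forall>j\<in>J. mono (\<lambda>n. w (g n) j)" by blast
  obtain h :: "nat \<Rightarrow> nat" where h: "strict_mono h" "mono ((\<lambda>n. w (g n) i) \<circ> h)"
    using monotone_subsequence_nat .
  have mh: "mono h" using h(1) by (rule strict_mono_mono)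
  have "\<forall>j\<in>insert i J. mono (\<lambda>n. w ((g \<circ> h) n) j)"
    using g(2) h(2) mh by (auto simp: mono_def)
  moreover have "strict_mono (g \<circ> h)" using g(1) h(1) by (rule strict_mono_o)
  ultimately show ?case by blast
qed

section \<open>Ideals and their powers in a commutative ring\<close>

context cring
begin

abbreviation ideal_pow :: "'a set \<Rightarrow> nat \<Rightarrow> 'a set" where
  "ideal_pow I n \<equiv> I [^]\<^bsub>ideals_set R\<^esub> n"

lemma ideal_by_closure:
  assumes "I \<subseteq> carrier R" and "\<zero> \<in> I" and "\<And>x y. \<lbrakk>x \<in> I; y \<in> I\<rbrakk> \<Longrightarrow> x \<oplus> y \<in> I"
    and mult: "\<And>r x. \<lbrakk>r \<in> carrier R; x \<in> I\<rbrakk> \<Longrightarrow> r \<otimes> x \<in> I"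
  shows "ideal I R"
proof (rule idealI)
  show "ring R" by (rule ring_axioms)
  show "subgroup I (add_monoid R)"
  proof (rule add.subgroupI)
    show "I \<subseteq> carrier R" by fact
    show "I \<noteq> {}" using assms(2) by blast
    fix a assume a: "a \<in> I"
    then have "(\<ominus> \<one>) \<otimes> a \<in> I" by (intro mult) auto
    then show "\<ominus> a \<in> I" using a assms(1) by (auto simp: l_minus)
  qed (rule assms(3))
  show "x \<otimes> a \<in> I" if "a \<in> I" "x \<in> carrier R" for a x using that by (rule_tac mult)
  show "a \<otimes> x \<in> I" if "a \<in> I" "x \<in> carrier R" for a x
    using mult[OF that(2,1)] that assms(1) by (metis m_comm subsetD)
qed

lemma
  assumes "ideal I R"
  shows ideal_carr: "x \<in> I \<Longrightarrow> x \<in> carrier R"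
    and ideal_zero: "\<zero> \<in> I"
    and ideal_add: "\<lbrakk>x \<in> I; y \<in> I\<rbrakk> \<Longrightarrow> x \<oplus> y \<in> I"
    and ideal_neg: "x \<in> I \<Longrightarrow> \<ominus> x \<in> I"
    and ideal_minus: "\<lbrakk>x \<in> I; y \<in> I\<rbrakk> \<Longrightarrow> x \<ominus> y \<in> I"
    and ideal_lmult: "\<lbrakk>r \<in> carrier R; x \<in> I\<rbrakk> \<Longrightarrow> r \<otimes> x \<in> I"
    and ideal_rmult: "\<lbrakk>r \<in> carrier R; x \<in> I\<rbrakk> \<Longrightarrow> x \<otimes> r \<in> I"
proof -
  interpret I: ideal I R by fact
  show "x \<in> I \<Longrightarrow> x \<in> carrier R" by (rule I.Icarr)
  show "\<zero> \<in> I" "\<lbrakk>x \<in> I; y \<in> I\<rbrakk> \<Longrightarrow> x \<oplus> y \<in> I" "x \<in> I \<Longrightarrow> \<ominus> x \<in> I" by auto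
  then show "\<lbrakk>x \<in> I; y \<in> I\<rbrakk> \<Longrightarrow> x \<ominus> y \<in> I" by (simp add: minus_eq)
  show "\<lbrakk>r \<in> carrier R; x \<in> I\<rbrakk> \<Longrightarrow> r \<otimes> x \<in> I" by (rule I.I_l_closed)
  show "\<lbrakk>r \<in> carrier R; x \<in> I\<rbrakk> \<Longrightarrow> x \<otimes> r \<in> I" by (rule I.I_r_closed)
qed

lemma ideal_finsum:
  assumes "ideal I R" and "\<And>i. i \<in> A \<Longrightarrow> f i \<in> I"
  shows "(\<Oplus>i\<in>A. f i) \<in> I"
  using assms(2)
proof (induction A rule: infinite_finite_induct)
  case (insert i A)
  then have "f \<in> A \<rightarrow> carrier R" "f i \<in> carrier R" using assms(1) ideal_carr by auto
  then show ?case using insert ideal_add[OF assms(1)] by simp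
qed (use ideal_zero[OF assms(1)] in simp_all)

lemma genideal_mem: "\<lbrakk>ideal K R; H \<subseteq> K; x \<in> Idl H\<rbrakk> \<Longrightarrow> x \<in> K"
  using genideal_minimal by blast

lemma genideal_mem_self: "\<lbrakk>H \<subseteq> carrier R; x \<in> H\<rbrakk> \<Longrightarrow> x \<in> Idl H"
  using genideal_self by blast

lemma mem_set_add_iff: "x \<in> A <+> B \<longleftrightarrow> (\<exists>a\<in>A. \<exists>b\<in>B. x = a \<oplus> b)"
  by (auto simp: set_add_def')

lemma mem_set_addI:
  assumes "ideal I R" "ideal J R"
  shows "x \<in> I \<Longrightarrow> x \<in> I <+> J" and "x \<in> J \<Longrightarrow> x \<in> I <+> J"
  unfolding mem_set_add_iff
  using ideal_zero[OF assms(1)] ideal_zero[OF assms(2)] ideal_carr[OF assms(1)] ideal_carr[OF assms(2)]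
  by (metis r_zero, metis l_zero)

lemma colon_ideal:
  assumes "ideal K R" "b \<in> carrier R"
  shows "ideal {x \<in> carrier R. x \<otimes> b \<in> K} R"
proof (rule ideal_by_closure)
  show "\<zero> \<in> {x \<in> carrier R. x \<otimes> b \<in> K}" using assms ideal_zero by simp
next
  fix x y assume "x \<in> {x \<in> carrier R. x \<otimes> b \<in> K}" "y \<in> {x \<in> carrier R. x \<otimes> b \<in> K}"
  then show "x \<oplus> y \<in> {x \<in> carrier R. x \<otimes> b \<in> K}"
    using assms(2) ideal_add[OF assms(1)] by (simp add: l_distr)
next
  fix r x assume "r \<in> carrier R" "x \<in> {x \<in> carrier R. x \<otimes> b \<in> K}"
  then show "r \<otimes> x \<in> {x \<in> carrier R. x \<otimes> b \<in> K}"
    using assms(2) ideal_lmult[OF assms(1)] by (simp add: m_assoc)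
qed auto

lemma genideal_mult_mem:
  assumes K: "ideal K R" and A: "A \<subseteq> carrier R" and B: "B \<subseteq> carrier R"
    and AB: "\<And>a b. \<lbrakk>a \<in> A; b \<in> B\<rbrakk> \<Longrightarrow> a \<otimes> b \<in> K"
    and x: "x \<in> Idl A" and y: "y \<in> Idl B"
  shows "x \<otimes> y \<in> K"
proof -
  have xc: "x \<in> carrier R" using ideal_carr[OF genideal_ideal[OF A] x] .
  have *: "x \<otimes> b \<in> K" if b: "b \<in> B" for b
  proof -
    have "x \<in> {x \<in> carrier R. x \<otimes> b \<in> K}"
      using x by (rule genideal_mem[OF colon_ideal[OF K], rotated 2]) (use A B AB b in auto)
    then show ?thesis by simp
  qed
  have "y \<in> {y \<in> carrier R. y \<otimes> x \<in> K}"
    using y by (rule genideal_mem[OF colon_ideal[OF K xc], rotated])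
      (use * B xc in \<open>auto simp: m_comm subset_iff\<close>)
  then show ?thesis using xc m_comm[of x y] by auto
qed

lemma ideal_prod_subset:
  assumes "ideal K R" and "\<And>i j. \<lbrakk>i \<in> I; j \<in> J\<rbrakk> \<Longrightarrow> i \<otimes> j \<in> K"
  shows "ideal_prod R I J \<subseteq> K"
proof
  fix s assume "s \<in> ideal_prod R I J"
  then show "s \<in> K" by induction (auto intro: assms(2) ideal_add[OF assms(1)])
qed

lemma one_ideals_set: "\<one>\<^bsub>ideals_set R\<^esub> = carrier R"
  and mult_ideals_set: "A \<otimes>\<^bsub>ideals_set R\<^esub> B = ideal_prod R A B"
  by (simp_all add: ideals_set_def)

lemma ideal_pow_0: "ideal_pow I 0 = carrier R"
  by (simp add: ideals_set_def nat_pow_def)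

lemma ideal_pow_Suc: "ideal_pow I (Suc n) = ideal_prod R (ideal_pow I n) I"
  by (simp add: ideals_set_def nat_pow_def)

lemma ideal_pow_ideal:
  assumes "ideal I R" shows "ideal (ideal_pow I n) R"
  by (induction n) (auto simp: one_ideals_set mult_ideals_set oneideal assms ideal_prod_is_ideal)

lemma ideal_pow_mult:
  assumes "ideal I R" "x \<in> ideal_pow I m" "y \<in> ideal_pow I n"
  shows "x \<otimes> y \<in> ideal_pow I (m + n)"
proof -
  interpret S: comm_monoid "ideals_set R" by (rule ideals_set_is_comm_monoid)
  have "ideal_pow I (m + n) = ideal_prod R (ideal_pow I m) (ideal_pow I n)"
    using S.nat_pow_mult[of I m n] assms(1) by (simp add: ideals_set_def)
  then show ?thesis using assms(2,3) by (simp add: ideal_prod.prod)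
qed

lemma ideal_pow_pow:
  assumes "ideal I R" shows "ideal_pow (ideal_pow I m) n = ideal_pow I (m * n)"
proof -
  interpret S: comm_monoid "ideals_set R" by (rule ideals_set_is_comm_monoid)
  show ?thesis using S.nat_pow_pow[of I m n] assms by (simp add: ideals_set_def)
qed

lemma ideal_pow_1:
  assumes "ideal I R" shows "ideal_pow I 1 = I"
proof -
  interpret S: comm_monoid "ideals_set R" by (rule ideals_set_is_comm_monoid)
  have "\<one>\<^bsub>ideals_set R\<^esub> \<otimes>\<^bsub>ideals_set R\<^esub> I = I"
    using assms by (intro S.l_one) (simp add: ideals_set_def)
  then show ?thesis by (simp add: nat_pow_def)
qed

lemma ideal_pow_antimono:
  assumes "ideal I R" "m \<le> n" shows "ideal_pow I n \<subseteq> ideal_pow I m"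
  using assms(2)
proof (induction n rule: dec_induct)
  case (step n)
  have "ideal_pow I (Suc n) \<subseteq> ideal_pow I n"
    unfolding ideal_pow_Suc
    using ideal_prod_inter[OF ideal_pow_ideal[OF assms(1)] assms(1)] by blast
  with step show ?case by blast
qed simp

lemma power_mem_ideal_pow:
  assumes "ideal I R" "x \<in> ideal_pow I m" shows "x [^] n \<in> ideal_pow I (m * n)"
proof (induction n)
  case 0 then show ?case by (simp add: one_ideals_set)
next
  case (Suc n)
  then show ?case
    using ideal_pow_mult[OF assms(1) Suc assms(2)] by (simp add: add.commute)
qed

fun product_set :: "'a set \<Rightarrow> nat \<Rightarrow> 'a set" where
  "product_set H 0 = {\<one>}"
| "product_set H (Suc n) = {a \<otimes> h | a h. a \<in> product_set H n \<and> h \<in> H}"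

lemma product_set_carrier: "H \<subseteq> carrier R \<Longrightarrow> product_set H n \<subseteq> carrier R"
  by (induction n) auto

lemma ideal_pow_genideal:
  assumes H: "H \<subseteq> carrier R"
  shows "ideal_pow (Idl H) n = Idl (product_set H n)"
proof
  show "ideal_pow (Idl H) n \<subseteq> Idl (product_set H n)"
  proof (induction n)
    case 0 then show ?case by (simp add: one_ideals_set genideal_one)
  next
    case (Suc n)
    note P = product_set_carrier[OF H]
    show ?case unfolding ideal_pow_Suc
    proof (rule ideal_prod_subset[OF genideal_ideal[OF P]])
      fix i j assume "i \<in> ideal_pow (Idl H) n" "j \<in> Idl H"
      then have "i \<in> Idl (product_set H n)" using Suc by blast
      then show "i \<otimes> j \<in> Idl (product_set H (Suc n))" using \<open>j \<in> Idl H\<close>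
        by (rule genideal_mult_mem[OF genideal_ideal[OF P] P H, rotated])
          (rule genideal_mem_self[OF P], auto)
    qed
  qed
next
  have "product_set H n \<subseteq> ideal_pow (Idl H) n"
  proof (induction n)
    case 0 then show ?case by (simp add: one_ideals_set)
  next
    case (Suc n)
    then show ?case unfolding ideal_pow_Suc
      using genideal_self[OF H] by (auto intro!: ideal_prod.prod)
  qed
  then show "Idl (product_set H n) \<subseteq> ideal_pow (Idl H) n"
    by (rule genideal_minimal[OF ideal_pow_ideal[OF genideal_ideal[OF H]]])
qed

lemma principal_genideal:
  assumes "f \<in> carrier R" shows "x \<in> Idl {f} \<longleftrightarrow> (\<exists>r\<in>carrier R. x = r \<otimes> f)"
  using assms by (auto simp: cgenideal_eq_genideal[symmetric] cgenideal_def)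

section \<open>The mixed powers\<close>

lemma frobenius_power_ideal:
  assumes "I \<subseteq> carrier R" shows "ideal (frobenius_power R I q) R"
  unfolding frobenius_power_def using assms by (intro genideal_ideal) auto

lemma mixed_power_ideal:
  assumes "ideal I R" shows "ideal (mixed_power R s q I) R"
  unfolding mixed_power_def
  using assms by (intro add_ideals ideal_pow_ideal frobenius_power_ideal) (auto intro: ideal_carr)

lemma mem_mixed_powerI:
  assumes "ideal I R"
  shows "x \<in> ideal_pow I (nat \<lceil>s * real q\<rceil>) \<Longrightarrow> x \<in> mixed_power R s q I"
    and "x \<in> frobenius_power R I q \<Longrightarrow> x \<in> mixed_power R s q I"
  unfolding mixed_power_def
  using mem_set_addI[OF ideal_pow_ideal[OF assms] frobenius_power_ideal] ideal_carr[OF assms] by blast+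

lemma mixed_power_antimono:
  assumes "ideal I R" "t \<le> s" shows "mixed_power R s q I \<subseteq> mixed_power R t q I"
proof -
  have "nat \<lceil>t * real q\<rceil> \<le> nat \<lceil>s * real q\<rceil>"
    using assms(2) by (intro nat_mono ceiling_mono mult_right_mono) auto
  then have "ideal_pow I (nat \<lceil>s * real q\<rceil>) \<subseteq> ideal_pow I (nat \<lceil>t * real q\<rceil>)"
    by (rule ideal_pow_antimono[OF assms(1)])
  then show ?thesis unfolding mixed_power_def set_add_def' by blast
qed

lemma weak_closure_antimono:
  assumes "ideal I R" "t \<le> s" shows "weak_closure R p s I \<subseteq> weak_closure R p t I"
proof
  fix x assume "x \<in> weak_closure R p s I"
  then obtain c where x: "x \<in> carrier R" and c: "c \<in> avoiding_minimal_primes R"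
    and ev: "\<forall>\<^sub>F e in sequentially. c \<otimes> x [^] (p ^ e) \<in> mixed_power R s (p ^ e) I"
    unfolding weak_closure_def by blast
  from ev have "\<forall>\<^sub>F e in sequentially. c \<otimes> x [^] (p ^ e) \<in> mixed_power R t (p ^ e) I"
    by (rule eventually_mono) (rule subsetD[OF mixed_power_antimono[OF assms]])
  with x c show "x \<in> weak_closure R p t I" unfolding weak_closure_def by blast
qed

lemma left_stableI:
  assumes "ideal I R" and "\<epsilon> > 0"
    and "\<And>t. \<lbrakk>1 \<le> t; s - \<epsilon> < t; t < s\<rbrakk> \<Longrightarrow> weak_closure R p t I \<subseteq> weak_closure R p s I"
  shows "left_stable R p I s"
  unfolding left_stable_def
proof (intro exI[of _ \<epsilon>] conjI allI impI subset_antisym)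
  show "\<epsilon> > 0" by fact
  fix t :: real assume t: "1 \<le> t" "s - \<epsilon> < t \<and> t < s"
  then show "weak_closure R p t I \<subseteq> weak_closure R p s I" using assms(3) by blast
  show "weak_closure R p s I \<subseteq> weak_closure R p t I"
    using t by (intro weak_closure_antimono[OF assms(1)]) simp
qed

end

section \<open>Commutative rings of prime characteristic\<close>

lemma (in cring) binomial_expansion:
  fixes n :: nat
  assumes "a \<in> carrier R" "b \<in> carrier R"
  shows "(a \<oplus> b) [^] n = (\<Oplus>k\<in>{..n}. add_pow R (n choose k) (a [^] k \<otimes> b [^] (n - k)))"
proof (induction n)
  case 0 then show ?case by simp
next
  case (Suc n)
  define t where "t n k = add_pow R (n choose k) (a [^] k \<otimes> b [^] (n - k))" for n k :: nat
  have tc: "t n k \<in> carrier R" for n k using assms by (simp add: t_def)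
  have step: "t (Suc n) (Suc k) = a \<otimes> t n k \<oplus> b \<otimes> t n (Suc k)" if k: "k \<le> n" for k
  proof -
    have 1: "a \<otimes> t n k = add_pow R (n choose k) (a [^] Suc k \<otimes> b [^] (n - k))"
    proof -
      have "a \<otimes> (a [^] k \<otimes> b [^] (n - k)) = a [^] Suc k \<otimes> b [^] (n - k)"
        using assms by (simp add: m_assoc[symmetric] m_comm[of a "a [^] k"])
      then show ?thesis using assms by (simp add: t_def add_pow_rdistr)
    qed
    have 2: "b \<otimes> t n (Suc k) = add_pow R (n choose Suc k) (a [^] Suc k \<otimes> b [^] (n - k))"
    proof (cases "k = n")
      case True
      then show ?thesis using assms by (simp add: t_def binomial_eq_0)
    next
      case False
      then have "n - k = Suc (n - Suc k)" using k by simp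
      then have bk: "b [^] (n - k) = b [^] (n - Suc k) \<otimes> b" by simp
      have "b \<otimes> (x \<otimes> y) = x \<otimes> (y \<otimes> b)" if "x \<in> carrier R" "y \<in> carrier R" for x y
        using that assms by (simp add: m_comm[of b] m_assoc)
      then have "b \<otimes> (a [^] Suc k \<otimes> b [^] (n - Suc k)) = a [^] Suc k \<otimes> b [^] (n - k)"
        unfolding bk using assms by blast
      then show ?thesis using assms by (simp add: t_def add_pow_rdistr)
    qed
    show ?thesis unfolding 1 2 using assms by (simp add: t_def add.nat_pow_mult)
  qed
  have "(\<Oplus>k\<in>{..Suc n}. t (Suc n) k) = (\<Oplus>k\<in>{..n}. t (Suc n) (Suc k)) \<oplus> t (Suc n) 0"
    using tc by (intro finsum_Suc2) auto
  also have "(\<Oplus>k\<in>{..n}. t (Suc n) (Suc k)) = (\<Oplus>k\<in>{..n}. a \<otimes> t n k \<oplus> b \<otimes> t n (Suc k))"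
    using tc assms step by (intro finsum_cong') auto
  also have "\<dots> = (\<Oplus>k\<in>{..n}. a \<otimes> t n k) \<oplus> (\<Oplus>k\<in>{..n}. b \<otimes> t n (Suc k))"
    using tc assms by (intro finsum_addf) auto
  also have "(\<Oplus>k\<in>{..n}. a \<otimes> t n k) = a \<otimes> (\<Oplus>k\<in>{..n}. t n k)"
    using tc assms by (intro finsum_rdistr[symmetric]) auto
  also have "(\<Oplus>k\<in>{..n}. b \<otimes> t n (Suc k)) = b \<otimes> (\<Oplus>k\<in>{..n}. t n (Suc k))"
    using tc assms by (intro finsum_rdistr[symmetric]) auto
  also have "t (Suc n) 0 = b \<otimes> t n 0"
    using assms by (simp add: t_def m_comm)
  also have "a \<otimes> (\<Oplus>k\<in>{..n}. t n k) \<oplus> b \<otimes> (\<Oplus>k\<in>{..n}. t n (Suc k)) \<oplus> b \<otimes> t n 0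
      = a \<otimes> (\<Oplus>k\<in>{..n}. t n k) \<oplus> b \<otimes> ((\<Oplus>k\<in>{..n}. t n (Suc k)) \<oplus> t n 0)"
    using tc assms by (simp add: r_distr a_assoc finsum_closed)
  also have "(\<Oplus>k\<in>{..n}. t n (Suc k)) \<oplus> t n 0 = (\<Oplus>k\<in>{..Suc n}. t n k)"
    using tc by (intro finsum_Suc2[symmetric]) auto
  also have "\<dots> = (\<Oplus>k\<in>{..n}. t n k)"
  proof -
    have "t n (Suc n) = \<zero>" by (simp add: t_def binomial_eq_0)
    then show ?thesis using tc finsum_Suc[of "t n" n] by (simp add: Pi_def)
  qed
  also have "a \<otimes> (\<Oplus>k\<in>{..n}. t n k) \<oplus> b \<otimes> (\<Oplus>k\<in>{..n}. t n k) = (a \<oplus> b) \<otimes> (\<Oplus>k\<in>{..n}. t n k)"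
    using tc assms by (simp add: l_distr finsum_closed)
  also have "(\<Oplus>k\<in>{..n}. t n k) = (a \<oplus> b) [^] n" unfolding Suc t_def ..
  also have "(a \<oplus> b) \<otimes> (a \<oplus> b) [^] n = (a \<oplus> b) [^] Suc n"
    using assms by (simp add: m_comm)
  finally show ?case unfolding t_def ..
qed

lemma (in cring) add_pow_eq_mult:
  "x \<in> carrier R \<Longrightarrow> add_pow R (n::nat) x = add_pow R n \<one> \<otimes> x"
  using add_pow_ldistr[of \<one> x n] by simp

text \<open>The natural numbers that annihilate \<open>\<one>\<close> are the multiples of the least positive one, so the greatest
  common divisor in the definition of the characteristic is itself one of them.\<close>

lemma (in cring) add_pow_ring_char:
  assumes "ring_char R \<noteq> 0" shows "add_pow R (ring_char R) \<one> = \<zero>"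
proof -
  define S where "S = {n :: nat. add_pow R n \<one> = \<zero>}"
  have G: "ring_char R = Gcd S" by (simp add: ring_char_def S_def)
  have "\<exists>n\<in>S. n \<noteq> 0"
  proof (rule ccontr)
    assume "\<not> (\<exists>n\<in>S. n \<noteq> 0)"
    then have "S \<subseteq> {0}" by blast
    then show False using assms by (simp add: G Gcd_0_iff)
  qed
  then obtain n0 where n0: "n0 \<in> S \<and> n0 \<noteq> 0" by blast
  define d where "d = (LEAST n. n \<in> S \<and> n \<noteq> 0)"
  have d: "d \<in> S" "d \<noteq> 0" unfolding d_def using LeastI[of "\<lambda>n. n \<in> S \<and> n \<noteq> 0", OF n0] by auto
  have "d dvd n" if n: "n \<in> S" for n
  proof -
    have "add_pow R (d * (n div d)) \<one> = \<zero>"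
      using d add.nat_pow_pow[of \<one> "n div d" d] by (simp add: S_def)
    moreover have "add_pow R (d * (n div d)) \<one> \<oplus> add_pow R (n mod d) \<one> = add_pow R n \<one>"
      by (simp add: add.nat_pow_mult)
    ultimately have "n mod d \<in> S" using n by (simp add: S_def)
    moreover have "n mod d < d" using d by simp
    ultimately have "n mod d = 0" using not_less_Least[of "n mod d" "\<lambda>n. n \<in> S \<and> n \<noteq> 0"]
      unfolding d_def[symmetric] by blast
    then show ?thesis by blast
  qed
  then have "Gcd S = d" using d(1)
    by (intro dvd_antisym Gcd_dvd Gcd_greatest) auto
  then show ?thesis using d(1) by (simp add: G S_def)
qed

locale prime_char_ring = cring R for R (structure) +
  fixes p :: nat
  assumes prime_p: "normalization_semidom_class.prime p" and char_p: "ring_char R = p"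
begin

lemma p_gt_1: "p > 1" using prime_p by (rule prime_gt_1_nat)

lemma add_pow_multiple:
  assumes "p dvd n" "x \<in> carrier R" shows "add_pow R n x = \<zero>"
proof -
  obtain k where n: "n = p * k" using assms(1) by blast
  have "add_pow R p \<one> = \<zero>" using add_pow_ring_char char_p p_gt_1 by simp
  then have "add_pow R n \<one> = \<zero>" using add.nat_pow_pow[of \<one> k p] by (simp add: n)
  then show ?thesis using assms(2) by (subst add_pow_eq_mult) auto
qed

lemma frobenius_add_p:
  assumes "a \<in> carrier R" "b \<in> carrier R" shows "(a \<oplus> b) [^] p = a [^] p \<oplus> b [^] p"
proof -
  define t where "t k = add_pow R (p choose k) (a [^] k \<otimes> b [^] (p - k))" for k :: nat
  have tc: "t \<in> A \<rightarrow> carrier R" for A using assms by (auto simp: t_def)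
  have z: "t k = \<zero>" if "k \<noteq> 0" "k \<noteq> p" "k \<le> p" for k
  proof -
    have "p dvd (p choose k)" using that prime_p by (intro dvd_choose_prime) auto
    then show ?thesis unfolding t_def using assms by (intro add_pow_multiple) auto
  qed
  have "(a \<oplus> b) [^] p = (\<Oplus>k\<in>{..p}. t k)" unfolding t_def using assms by (rule binomial_expansion)
  also have "\<dots> = (\<Oplus>k\<in>{0, p}. t k)"
    using tc z p_gt_1 by (intro add.finprod_mono_neutral_cong_right) auto
  also have "\<dots> = t 0 \<oplus> t p" using p_gt_1 assms by (simp add: t_def)
  also have "\<dots> = a [^] p \<oplus> b [^] p" using assms by (simp add: t_def a_comm)
  finally show ?thesis .
qed

lemma frobenius_add:
  assumes "a \<in> carrier R" "b \<in> carrier R"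
  shows "(a \<oplus> b) [^] (p ^ e) = a [^] (p ^ e) \<oplus> b [^] (p ^ e)"
proof (induction e)
  case (Suc e)
  have "x [^] (p ^ Suc e) = (x [^] (p ^ e)) [^] p" if "x \<in> carrier R" for x
    using that by (simp add: nat_pow_pow mult.commute)
  then show ?case using assms by (simp add: Suc frobenius_add_p)
qed (use assms in simp)

lemma frobenius_zero: "\<zero> [^] (p ^ e) = \<zero>"
  using p_gt_1 by (intro nat_pow_zero) simp

lemma frobenius_finsum:
  assumes "f \<in> A \<rightarrow> carrier R"
  shows "(\<Oplus>i\<in>A. f i) [^] (p ^ e) = (\<Oplus>i\<in>A. f i [^] (p ^ e))"
  using assms
proof (induction A rule: infinite_finite_induct)
  case (insert i A)
  then have "f \<in> A \<rightarrow> carrier R" "f i \<in> carrier R" "(\<lambda>i. f i [^] (p ^ e)) \<in> A \<rightarrow> carrier R" by auto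
  then show ?case using insert by (simp add: frobenius_add)
qed (auto simp: frobenius_zero)

text \<open>The elements whose \<open>q\<close>-th power lies in the right-hand side form an ideal, because the \<open>q\<close>-th power map
  is additive. In particular Frobenius powers of homogeneous ideals are homogeneous.\<close>

lemma frobenius_power_genideal:
  assumes H: "H \<subseteq> carrier R"
  shows "frobenius_power R (Idl H) (p ^ e) = Idl ((\<lambda>h. h [^] (p ^ e)) ` H)"
proof -
  let ?q = "p ^ e"
  let ?K = "Idl ((\<lambda>h. h [^] ?q) ` H)"
  have Hq: "(\<lambda>h. h [^] ?q) ` H \<subseteq> carrier R" using H by auto
  note K = genideal_ideal[OF Hq]
  have "ideal {x \<in> carrier R. x [^] ?q \<in> ?K} R"
  proof (rule ideal_by_closure)
    show "\<zero> \<in> {x \<in> carrier R. x [^] ?q \<in> ?K}" using ideal_zero[OF K] frobenius_zero by simp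
  next
    fix x y assume "x \<in> {x \<in> carrier R. x [^] ?q \<in> ?K}" "y \<in> {x \<in> carrier R. x [^] ?q \<in> ?K}"
    then show "x \<oplus> y \<in> {x \<in> carrier R. x [^] ?q \<in> ?K}"
      using ideal_add[OF K] by (simp add: frobenius_add)
  next
    fix r x assume "r \<in> carrier R" "x \<in> {x \<in> carrier R. x [^] ?q \<in> ?K}"
    then show "r \<otimes> x \<in> {x \<in> carrier R. x [^] ?q \<in> ?K}"
      using ideal_lmult[OF K] by (simp add: nat_pow_distrib)
  qed auto
  moreover have "H \<subseteq> {x \<in> carrier R. x [^] ?q \<in> ?K}"
    using H genideal_mem_self[OF Hq] by blast
  ultimately have "Idl H \<subseteq> {x \<in> carrier R. x [^] ?q \<in> ?K}" by (rule genideal_minimal)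
  then have "frobenius_power R (Idl H) ?q \<subseteq> ?K"
    unfolding frobenius_power_def by (intro genideal_minimal K) auto
  moreover have "?K \<subseteq> frobenius_power R (Idl H) ?q"
    unfolding frobenius_power_def
    using genideal_self[OF H] ideal_carr[OF genideal_ideal[OF H]] by (intro subset_Idl_subset) auto
  ultimately show ?thesis by blast
qed

text \<open>The exponent \<open>\<lceil>s q\<rceil>\<close> becomes \<open>Q \<lceil>s q\<rceil>\<close> for \<open>Q = p ^ j\<close>, which is at least \<open>\<lceil>s q Q\<rceil>\<close>.\<close>

lemma frobenius_mixed_power:
  assumes I: "ideal I R" and x: "x \<in> mixed_power R s (p ^ e) I" and s: "s \<ge> 0"
  shows "x [^] (p ^ j) \<in> mixed_power R s (p ^ (e + j)) I"
proof -
  obtain a b where a: "a \<in> ideal_pow I (nat \<lceil>s * real (p ^ e)\<rceil>)"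
    and b: "b \<in> frobenius_power R I (p ^ e)" and xab: "x = a \<oplus> b"
    using x by (auto simp: mixed_power_def mem_set_add_iff)
  have Ic: "I \<subseteq> carrier R" using ideal_carr[OF I] by blast
  note F = frobenius_power_ideal[OF Ic]
  have ac: "a \<in> carrier R" using a ideal_carr[OF ideal_pow_ideal[OF I]] by blast
  have bc: "b \<in> carrier R" using b ideal_carr[OF F] by blast
  have le: "nat \<lceil>s * real (p ^ (e + j))\<rceil> \<le> nat \<lceil>s * real (p ^ e)\<rceil> * p ^ j"
  proof -
    have "s * real (p ^ (e + j)) = (s * real (p ^ e)) * real (p ^ j)" by (simp add: power_add)
    also have "\<dots> \<le> real (nat \<lceil>s * real (p ^ e)\<rceil>) * real (p ^ j)"
      by (intro mult_right_mono) linarith+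
    also have "\<dots> = real (nat \<lceil>s * real (p ^ e)\<rceil> * p ^ j)" by simp
    finally show ?thesis by (simp only: nat_le_iff ceiling_le_iff of_int_of_nat_eq)
  qed
  have "a [^] (p ^ j) \<in> ideal_pow I (nat \<lceil>s * real (p ^ (e + j))\<rceil>)"
    using power_mem_ideal_pow[OF I a] ideal_pow_antimono[OF I le] by blast
  moreover have "b [^] (p ^ j) \<in> frobenius_power R I (p ^ (e + j))"
  proof -
    have Iq: "(\<lambda>f. f [^] (p ^ e)) ` I \<subseteq> carrier R" using Ic by auto
    have "b [^] (p ^ j) \<in> (\<lambda>f. f [^] (p ^ j)) ` (Idl ((\<lambda>f. f [^] (p ^ e)) ` I))"
      using b by (simp add: frobenius_power_def)
    moreover have "\<dots> \<subseteq> frobenius_power R (Idl ((\<lambda>f. f [^] (p ^ e)) ` I)) (p ^ j)"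
      unfolding frobenius_power_def using ideal_carr[OF genideal_ideal[OF Iq]]
      by (intro genideal_self) auto
    moreover have "\<dots> = Idl ((\<lambda>h. h [^] (p ^ j)) ` (\<lambda>f. f [^] (p ^ e)) ` I)"
      using Iq by (rule frobenius_power_genideal)
    moreover have "(\<lambda>h. h [^] (p ^ j)) ` (\<lambda>f. f [^] (p ^ e)) ` I = (\<lambda>f. f [^] (p ^ (e + j))) ` I"
      using Ic by (force simp: nat_pow_pow power_add image_image)
    ultimately show ?thesis by (auto simp: frobenius_power_def)
  qed
  moreover have "x [^] (p ^ j) = a [^] (p ^ j) \<oplus> b [^] (p ^ j)"
    unfolding xab using ac bc by (rule frobenius_add)
  ultimately show ?thesis unfolding mixed_power_def mem_set_add_iff by blast
qed

end

section \<open>Minimal primes of noetherian rings\<close>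

locale noetherian_cring = cring R + noetherian_ring R for R (structure)
begin

lemma maximal_ideal_exists:
  assumes "\<A> \<noteq> {}" and "\<And>I. I \<in> \<A> \<Longrightarrow> ideal I R"
  shows "\<exists>M\<in>\<A>. \<forall>J\<in>\<A>. M \<subseteq> J \<longrightarrow> J = M"
proof (rule subset_Zorn_nonempty[OF assms(1)])
  fix C assume C: "C \<noteq> {}" "subset.chain \<A> C"
  then have sub: "C \<subseteq> \<A>" unfolding pred_on.chain_def by simp
  then have "subset.chain {I. ideal I R} C"
    using assms(2) C(2) unfolding pred_on.chain_def by auto
  then have "\<Union>C \<in> C" by (rule ideal_chain_is_trivial[OF C(1)])
  then show "\<Union>C \<in> \<A>" using sub by (rule rev_subsetD)
qed

lemma noetherian_induct [consumes 1, case_names ideal]: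
  assumes "ideal I R"
    and step: "\<And>I. \<lbrakk>ideal I R; \<And>J. \<lbrakk>ideal J R; I \<subset> J\<rbrakk> \<Longrightarrow> Q J\<rbrakk> \<Longrightarrow> Q I"
  shows "Q I"
proof (rule ccontr)
  assume "\<not> Q I"
  let ?A = "{I. ideal I R \<and> \<not> Q I}"
  have "\<exists>M\<in>?A. \<forall>J\<in>?A. M \<subseteq> J \<longrightarrow> J = M"
    by (rule maximal_ideal_exists) (use \<open>\<not> Q I\<close> assms(1) in auto)
  then obtain M where M: "M \<in> ?A" and max: "\<forall>J\<in>?A. M \<subseteq> J \<longrightarrow> J = M" by (rule bexE)
  have "Q M"
  proof (rule step)
    show "ideal M R" using M by simp
    show "Q J" if "ideal J R" "M \<subset> J" for J using that max by auto
  qed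
  then show False using M by simp
qed

lemma finite_generating_subset:
  assumes H: "H \<subseteq> carrier R"
  obtains H0 where "finite H0" "H0 \<subseteq> H" "Idl H0 = Idl H"
proof -
  let ?A = "{Idl H0 | H0. finite H0 \<and> H0 \<subseteq> H}"
  have "\<exists>M\<in>?A. \<forall>J\<in>?A. M \<subseteq> J \<longrightarrow> J = M"
  proof (rule maximal_ideal_exists)
    show "?A \<noteq> {}" by blast
    show "ideal I R" if IA: "I \<in> ?A" for I
    proof -
      obtain H0 where "I = Idl H0" "H0 \<subseteq> H" using IA by blast
      then show ?thesis using H genideal_ideal[of H0] by auto
    qed
  qed
  then obtain M where M: "M \<in> ?A" and max: "\<forall>J\<in>?A. M \<subseteq> J \<longrightarrow> J = M" by (rule bexE)
  from M obtain H0 where H0: "finite H0" "H0 \<subseteq> H" "M = Idl H0" by blast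
  have "h \<in> Idl H0" if h: "h \<in> H" for h
  proof -
    have c: "insert h H0 \<subseteq> carrier R" using h H H0 by auto
    have "Idl (insert h H0) \<in> ?A" using h H0 by blast
    moreover have "M \<subseteq> Idl (insert h H0)" unfolding H0(3) by (rule subset_Idl_subset[OF c]) blast
    ultimately have "Idl (insert h H0) = M" using max by blast
    then show ?thesis using genideal_mem_self[OF c, of h] H0(3) by simp
  qed
  then have "Idl H \<subseteq> Idl H0" using H H0(2) by (intro genideal_minimal genideal_ideal) auto
  moreover have "Idl H0 \<subseteq> Idl H" using H H0(2) by (rule subset_Idl_subset)
  ultimately show thesis using H0 that by blast
qed

end

context cring
begin

lemma minimal_prime: "P \<in> minimal_primes R \<Longrightarrow> primeideal P R"
  by (simp add: minimal_primes_def)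

lemma minimal_prime_minimal:
  "\<lbrakk>P \<in> minimal_primes R; primeideal Q R; Q \<subseteq> P\<rbrakk> \<Longrightarrow> Q = P"
  by (simp add: minimal_primes_def)

abbreviation list_product :: "'a list \<Rightarrow> 'a" where
  "list_product xs \<equiv> foldr (\<otimes>) xs \<one>"

lemma list_product_closed: "set xs \<subseteq> carrier R \<Longrightarrow> list_product xs \<in> carrier R"
  by (induction xs) auto

lemma list_product_append:
  "set xs \<subseteq> carrier R \<Longrightarrow> set ys \<subseteq> carrier R \<Longrightarrow>
   list_product (xs @ ys) = list_product xs \<otimes> list_product ys"
proof (induction xs)
  case Nil
  then show ?case using list_product_closed[of ys] by simp
next
  case (Cons x xs)
  then have "list_product xs \<in> carrier R" "list_product ys \<in> carrier R" "x \<in> carrier R"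
    using list_product_closed[of ys] list_product_closed[of xs] by auto
  with Cons show ?case by (simp add: m_assoc)
qed

lemma prime_list_product:
  assumes "primeideal P R" "set xs \<subseteq> carrier R - P"
  shows "list_product xs \<in> carrier R - P"
  using assms(2)
proof (induction xs)
  case Nil
  interpret P: primeideal P R by fact
  show ?case using P.one_imp_carrier P.I_notcarr by auto
next
  case (Cons x xs)
  interpret P: primeideal P R by fact
  from Cons have "list_product xs \<in> carrier R - P" "x \<in> carrier R - P" by auto
  then show ?case using P.I_prime[of x "list_product xs"] by auto
qed

lemma primeideal_props:
  assumes "primeideal P R"
  shows prime_ideal: "ideal P R" and prime_one: "\<one> \<notin> P"
    and prime_mult: "\<lbrakk>a \<in> carrier R - P; b \<in> carrier R - P\<rbrakk> \<Longrightarrow> a \<otimes> b \<in> carrier R - P"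
proof -
  interpret P: primeideal P R by fact
  show "ideal P R" by (rule P.is_ideal)
  show "\<one> \<notin> P" using P.one_imp_carrier P.I_notcarr by auto
  show "\<lbrakk>a \<in> carrier R - P; b \<in> carrier R - P\<rbrakk> \<Longrightarrow> a \<otimes> b \<in> carrier R - P"
    using P.I_prime by auto
qed

lemma prime_pow:
  assumes "primeideal P R" "a \<in> carrier R - P" shows "a [^] (n::nat) \<in> carrier R - P"
proof (induction n)
  case 0 then show ?case using prime_one[OF assms(1)] by simp
next
  case (Suc n) then show ?case using prime_mult[OF assms(1) Suc assms(2)] by simp
qed

lemma prime_finprod:
  assumes "primeideal P R" "\<And>i. i \<in> A \<Longrightarrow> f i \<in> carrier R - P"
  shows "finprod R f A \<in> carrier R - P"
  using assms(2)
proof (induction A rule: infinite_finite_induct)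
  case (insert i A)
  then have "f \<in> A \<rightarrow> carrier R" "f i \<in> carrier R" by auto
  then show ?case using insert prime_mult[OF assms(1)] by simp
qed (use prime_one[OF assms(1)] in simp_all)

end

context noetherian_cring
begin

text \<open>Noetherian induction: if \<open>I\<close> is proper and not prime, some product \<open>a b\<close> of elements outside \<open>I\<close> lies in
  \<open>I\<close>, and the lists for the ideals generated by \<open>I\<close> together with \<open>a\<close> and with \<open>b\<close> are concatenated.\<close>

lemma product_of_primes_below:
  assumes "ideal I R"
  shows "\<exists>Ps. (\<forall>P\<in>set Ps. primeideal P R \<and> I \<subseteq> P) \<and>
    (\<forall>xs. list_all2 (\<in>) xs Ps \<longrightarrow> list_product xs \<in> I)"
  using assms
proof (induction rule: noetherian_induct)
  case (ideal I)
  note I = ideal(1)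
  consider "I = carrier R" | "primeideal I R" | "I \<noteq> carrier R" "\<not> primeideal I R" by blast
  then show ?case
  proof cases
    case 1
    then show ?thesis by (intro exI[of _ "[]"]) simp
  next
    case 2
    have "list_product xs \<in> I" if "list_all2 (\<in>) xs [I]" for xs
      using that ideal_carr[OF I] by (auto simp: list_all2_Cons2)
    then show ?thesis using 2 by (intro exI[of _ "[I]"]) auto
  next
    case 3
    then obtain a b where ab: "a \<in> carrier R" "b \<in> carrier R" "a \<otimes> b \<in> I" "a \<notin> I" "b \<notin> I"
      using primeidealI[OF I is_cring] by metis
    have Ic: "I \<subseteq> carrier R" using ideal_carr[OF I] by blast
    have c: "insert a I \<subseteq> carrier R" "insert b I \<subseteq> carrier R" using ab Ic by auto
    have "I \<subset> Idl (insert a I)" "I \<subset> Idl (insert b I)"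
      using genideal_self[OF c(1)] genideal_self[OF c(2)] ab by blast+
    then obtain Ps Qs where
      Ps: "\<forall>P\<in>set Ps. primeideal P R \<and> Idl (insert a I) \<subseteq> P"
        "\<forall>xs. list_all2 (\<in>) xs Ps \<longrightarrow> list_product xs \<in> Idl (insert a I)" and
      Qs: "\<forall>P\<in>set Qs. primeideal P R \<and> Idl (insert b I) \<subseteq> P"
        "\<forall>xs. list_all2 (\<in>) xs Qs \<longrightarrow> list_product xs \<in> Idl (insert b I)"
      using ideal(2)[OF genideal_ideal[OF c(1)]] ideal(2)[OF genideal_ideal[OF c(2)]] by blast
    have carr: "set xs \<subseteq> carrier R" if all2: "list_all2 (\<in>) xs Rs" and "\<forall>P\<in>set Rs. primeideal P R" for xs Rs
    proof
      fix x assume "x \<in> set xs"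
      then obtain P where "P \<in> set Rs" "x \<in> P"
        using all2 by (metis in_set_conv_nth list_all2_conv_all_nth nth_mem)
      then show "x \<in> carrier R" using that(2) prime_ideal ideal_carr by blast
    qed
    have "list_product xs \<in> I" if xs: "list_all2 (\<in>) xs (Ps @ Qs)" for xs
    proof -
      obtain us vs where uv: "xs = us @ vs" "list_all2 (\<in>) us Ps" "list_all2 (\<in>) vs Qs"
        using xs by (auto simp: list_all2_append2)
      have "list_product us \<otimes> list_product vs \<in> I"
      proof (rule genideal_mult_mem[OF I c])
        show "list_product us \<in> Idl (insert a I)" "list_product vs \<in> Idl (insert b I)"
          using Ps(2) Qs(2) uv by auto
        show "x \<otimes> y \<in> I" if "x \<in> insert a I" "y \<in> insert b I" for x y
          using that ab ideal_lmult[OF I] ideal_rmult[OF I] Ic by auto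
      qed
      moreover have "set us \<subseteq> carrier R" "set vs \<subseteq> carrier R"
        by (rule carr[OF uv(2)], use Ps(1) in blast) (rule carr[OF uv(3)], use Qs(1) in blast)
      ultimately show ?thesis by (simp add: uv(1) list_product_append del: foldr_append)
    qed
    moreover have "primeideal P R \<and> I \<subseteq> P" if "P \<in> set (Ps @ Qs)" for P
    proof -
      have "I \<subseteq> Idl (insert a I)" "I \<subseteq> Idl (insert b I)"
        using genideal_self[OF c(1)] genideal_self[OF c(2)] by blast+
      then show ?thesis using that Ps(1) Qs(1) by (metis Un_iff set_append subset_trans)
    qed
    ultimately show ?thesis by (intro exI[of _ "Ps @ Qs"]) blast
  qed
qed

text \<open>Take a list of primes whose product is zero. Every prime contains one of them, so all minimal primes
  occur in the list. An element of all minimal primes lies in each listed prime, since that prime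
  contains a minimal one; so as many such elements as the list is long multiply to zero.\<close>

lemma minimal_primes_noetherian:
  shows finite_minimal_primes: "finite (minimal_primes R)"
    and nilpotent_radical: "\<exists>r. \<forall>xs. length xs = r \<longrightarrow>
      set xs \<subseteq> {x \<in> carrier R. \<forall>P\<in>minimal_primes R. x \<in> P} \<longrightarrow> list_product xs = \<zero>"
proof -
  obtain Ps where Ps: "\<forall>P\<in>set Ps. primeideal P R \<and> {\<zero>} \<subseteq> P"
    and prod: "\<forall>xs. list_all2 (\<in>) xs Ps \<longrightarrow> list_product xs \<in> {\<zero>}"
    using product_of_primes_below[OF zeroideal] by blast
  have below: "\<exists>P\<in>set Ps. P \<subseteq> Q" if Q: "primeideal Q R" for Q
  proof (rule ccontr)
    assume "\<not> (\<exists>P\<in>set Ps. P \<subseteq> Q)"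
    then have "\<forall>P\<in>set Ps. \<exists>x. x \<in> P \<and> x \<notin> Q" by blast
    then obtain f where f: "\<forall>P\<in>set Ps. f P \<in> P \<and> f P \<notin> Q" by metis
    have "set (map f Ps) \<subseteq> carrier R - Q"
      using f Ps prime_ideal ideal_carr by fastforce
    then have "list_product (map f Ps) \<in> carrier R - Q" by (rule prime_list_product[OF Q])
    moreover have "list_all2 (\<in>) (map f Ps) Ps" using f by (auto simp: list_all2_conv_all_nth)
    ultimately show False using prod ideal_zero[OF prime_ideal[OF Q]] by auto
  qed
  have sub: "minimal_primes R \<subseteq> set Ps"
  proof
    fix P assume P: "P \<in> minimal_primes R"
    then obtain P' where "P' \<in> set Ps" "P' \<subseteq> P" using below minimal_prime by blast
    then show "P \<in> set Ps" using minimal_prime_minimal[OF P] Ps by auto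
  qed
  then show "finite (minimal_primes R)" by (rule finite_subset) simp
  have contains_minimal: "\<exists>P\<in>minimal_primes R. P \<subseteq> Q" if Q: "primeideal Q R" for Q
  proof -
    obtain P0 where "P0 \<in> {P \<in> set Ps. P \<subseteq> Q}" using below[OF Q] by blast
    then obtain P where P: "P \<in> {P \<in> set Ps. P \<subseteq> Q}"
      and min: "\<forall>P'\<in>{P \<in> set Ps. P \<subseteq> Q}. P' \<subseteq> P \<longrightarrow> P = P'"
      using finite_has_minimal2[of "{P \<in> set Ps. P \<subseteq> Q}" P0] by auto
    have "Q' = P" if Q': "primeideal Q' R" "Q' \<subseteq> P" for Q'
    proof -
      obtain P' where "P' \<in> set Ps" "P' \<subseteq> Q'" using below[OF Q'(1)] by blast
      then show ?thesis using min P Q'(2) by blast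
    qed
    then have "P \<in> minimal_primes R" using P Ps unfolding minimal_primes_def by simp
    then show ?thesis using P by blast
  qed
  show "\<exists>r. \<forall>xs. length xs = r \<longrightarrow>
      set xs \<subseteq> {x \<in> carrier R. \<forall>P\<in>minimal_primes R. x \<in> P} \<longrightarrow> list_product xs = \<zero>"
  proof (intro exI[of _ "length Ps"] allI impI)
    fix xs assume len: "length xs = length Ps"
      and xs: "set xs \<subseteq> {x \<in> carrier R. \<forall>P\<in>minimal_primes R. x \<in> P}"
    have "xs ! i \<in> Ps ! i" if i: "i < length Ps" for i
    proof -
      obtain P where "P \<in> minimal_primes R" "P \<subseteq> Ps ! i"
        using contains_minimal Ps i by (meson nth_mem)
      moreover have "xs ! i \<in> set xs" using i len by simp
      ultimately show ?thesis using xs by blast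
    qed
    then have "list_all2 (\<in>) xs Ps" using len by (simp add: list_all2_conv_all_nth)
    then show "list_product xs = \<zero>" using prod by blast
  qed
qed

end

section \<open>Membership in the weak closure is detected modulo minimal primes\<close>

text \<open>The two consequences of the noetherian property that the closure calculus needs. Monoid algebras
  that are domains satisfy them without recourse to a basis theorem.\<close>

locale finite_minimal_primes_ring = prime_char_ring R p for R (structure) and p +
  assumes finite_minimal: "finite (minimal_primes R)"
    and nilpotent: "\<exists>r. \<forall>xs. length xs = r \<longrightarrow>
      set xs \<subseteq> {x \<in> carrier R. \<forall>P\<in>minimal_primes R. x \<in> P} \<longrightarrow> list_product xs = \<zero>"
begin

lemma avoid_prime_in_others:
  assumes P: "primeideal P R" and "finite M" and "\<And>Q. Q \<in> M \<Longrightarrow> ideal Q R \<and> \<not> Q \<subseteq> P"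
  shows "\<exists>d\<in>carrier R - P. \<forall>Q\<in>M. d \<in> Q"
  using assms(2,3)
proof (induction M rule: finite_induct)
  case empty
  then show ?case using prime_one[OF P] by auto
next
  case (insert Q M)
  then obtain d where d: "d \<in> carrier R - P" "\<forall>Q\<in>M. d \<in> Q" by auto
  have Q: "ideal Q R" and "\<not> Q \<subseteq> P" using insert.prems by auto
  then obtain a where a: "a \<in> Q" "a \<notin> P" by blast
  then have ac: "a \<in> carrier R - P" using ideal_carr[OF Q] by blast
  have "d \<otimes> a \<in> Q'" if "Q' \<in> insert Q M" for Q'
    using that d a ac ideal_lmult[OF Q] ideal_rmult[of Q' a d] insert.prems by auto
  moreover have "d \<otimes> a \<in> carrier R - P" using prime_mult[OF P d(1) ac] .
  ultimately show ?case by blast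
qed

lemma separating_element:
  assumes "P \<in> minimal_primes R"
  obtains d where "d \<in> carrier R - P" and "\<forall>Q\<in>minimal_primes R. Q \<noteq> P \<longrightarrow> d \<in> Q"
proof -
  have "\<exists>d\<in>carrier R - P. \<forall>Q\<in>minimal_primes R - {P}. d \<in> Q"
  proof (rule avoid_prime_in_others)
    show "primeideal P R" using assms by (rule minimal_prime)
    show "finite (minimal_primes R - {P})" using finite_minimal by simp
    show "ideal Q R \<and> \<not> Q \<subseteq> P" if "Q \<in> minimal_primes R - {P}" for Q
    proof -
      have Q: "primeideal Q R" using that by (intro minimal_prime) simp
      have "\<not> Q \<subseteq> P" using minimal_prime_minimal[OF assms Q] that by auto
      then show ?thesis using prime_ideal[OF Q] by simp
    qed
  qed
  then show thesis using that by blast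
qed

text \<open>Prime avoidance in the form needed here: an element of \<open>K\<close> outside \<open>P\<close>, multiplied by an element that
  lies in all other minimal primes but not in \<open>P\<close>, can be summed over all \<open>P\<close> without cancellation.\<close>

lemma ideal_meets_avoiding_minimal_primes:
  assumes K: "ideal K R" and a: "\<And>P. P \<in> minimal_primes R \<Longrightarrow> \<exists>a\<in>K. a \<notin> P"
  shows "\<exists>c\<in>K. c \<in> avoiding_minimal_primes R"
proof -
  let ?M = "minimal_primes R"
  have "\<forall>P\<in>?M. \<exists>b. b \<in> K \<and> b \<notin> P \<and> (\<forall>Q\<in>?M. Q \<noteq> P \<longrightarrow> b \<in> Q)"
  proof
    fix P assume P: "P \<in> ?M"
    obtain a where a: "a \<in> K" "a \<notin> P" using assms(2)[OF P] by blast
    obtain d where d: "d \<in> carrier R - P" "\<forall>Q\<in>?M. Q \<noteq> P \<longrightarrow> d \<in> Q"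
      using separating_element[OF P] .
    have ac: "a \<in> carrier R - P" using a ideal_carr[OF K] by blast
    have "d \<otimes> a \<in> K" using d a ideal_lmult[OF K] by blast
    moreover have "d \<otimes> a \<notin> P" using prime_mult[OF minimal_prime[OF P] d(1) ac] by blast
    moreover have "d \<otimes> a \<in> Q" if "Q \<in> ?M" "Q \<noteq> P" for Q
      using ideal_rmult[OF prime_ideal[OF minimal_prime]] that d(2) ac by blast
    ultimately show "\<exists>b. b \<in> K \<and> b \<notin> P \<and> (\<forall>Q\<in>?M. Q \<noteq> P \<longrightarrow> b \<in> Q)" by blast
  qed
  then obtain b where "\<forall>P\<in>?M. b P \<in> K \<and> b P \<notin> P \<and> (\<forall>Q\<in>?M. Q \<noteq> P \<longrightarrow> b P \<in> Q)"
    by (rule bchoice[THEN exE])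
  then have b: "\<And>P. P \<in> ?M \<Longrightarrow> b P \<in> K" "\<And>P. P \<in> ?M \<Longrightarrow> b P \<notin> P"
    "\<And>P Q. \<lbrakk>P \<in> ?M; Q \<in> ?M; Q \<noteq> P\<rbrakk> \<Longrightarrow> b P \<in> Q"
    by blast+
  have bc: "b P \<in> carrier R" if "P \<in> ?M" for P using b(1)[OF that] ideal_carr[OF K] by blast
  define c where "c = (\<Oplus>P\<in>?M. b P)"
  have cK: "c \<in> K" unfolding c_def using b(1) by (rule ideal_finsum[OF K])
  have "c \<notin> P" if P: "P \<in> ?M" for P
  proof
    assume cP: "c \<in> P"
    note PI = prime_ideal[OF minimal_prime[OF P]]
    let ?r = "\<Oplus>Q\<in>?M - {P}. b Q"
    have r: "?r \<in> P" using b(3)[OF _ P] by (intro ideal_finsum[OF PI]) auto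
    have "c = (\<Oplus>Q\<in>insert P (?M - {P}). b Q)" unfolding c_def using P by (simp add: insert_absorb)
    also have "\<dots> = b P \<oplus> ?r" using finite_minimal bc P by (intro finsum_insert) auto
    finally have "b P = c \<ominus> ?r"
      using bc[OF P] ideal_carr[OF PI r] by (simp add: minus_eq a_assoc r_neg)
    also have "\<dots> \<in> P" using ideal_minus[OF PI cP r] .
    finally show False using b(2)[OF P] by blast
  qed
  then show ?thesis using cK ideal_carr[OF K] unfolding avoiding_minimal_primes_def by blast
qed

text \<open>Since the multipliers of \<open>x\<close> form an ideal, prime avoidance reduces the search for one of them to the
  individual minimal primes.\<close>

lemma multiplier_ideal:
  assumes I: "ideal I R" and x: "x \<in> carrier R"
  shows "ideal {c \<in> carrier R. \<forall>\<^sub>F e in sequentially. c \<otimes> x [^] (p ^ e) \<in> mixed_power R s (p ^ e) I} R"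
    (is "ideal ?K R")
proof (rule ideal_by_closure)
  note M = mixed_power_ideal[OF I]
  show "\<zero> \<in> ?K" using x ideal_zero[OF M] by simp
next
  note M = mixed_power_ideal[OF I]
  fix a b assume a: "a \<in> ?K" and b: "b \<in> ?K"
  then have "\<forall>\<^sub>F e in sequentially. a \<otimes> x [^] (p ^ e) \<in> mixed_power R s (p ^ e) I"
    "\<forall>\<^sub>F e in sequentially. b \<otimes> x [^] (p ^ e) \<in> mixed_power R s (p ^ e) I" by auto
  then have "\<forall>\<^sub>F e in sequentially. (a \<oplus> b) \<otimes> x [^] (p ^ e) \<in> mixed_power R s (p ^ e) I"
    by eventually_elim (use a b x ideal_add[OF M] in \<open>simp add: l_distr\<close>)
  then show "a \<oplus> b \<in> ?K" using a b by simp
next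
  note M = mixed_power_ideal[OF I]
  fix r a assume r: "r \<in> carrier R" and a: "a \<in> ?K"
  then have "\<forall>\<^sub>F e in sequentially. a \<otimes> x [^] (p ^ e) \<in> mixed_power R s (p ^ e) I" by auto
  then have "\<forall>\<^sub>F e in sequentially. (r \<otimes> a) \<otimes> x [^] (p ^ e) \<in> mixed_power R s (p ^ e) I"
    by eventually_elim (use a r x ideal_lmult[OF M] in \<open>simp add: m_assoc\<close>)
  then show "r \<otimes> a \<in> ?K" using a r by simp
qed auto

lemma weak_closureI:
  assumes I: "ideal I R" and x: "x \<in> carrier R"
    and c: "\<And>P. P \<in> minimal_primes R \<Longrightarrow> \<exists>c\<in>carrier R - P.
       \<forall>\<^sub>F e in sequentially. c \<otimes> x [^] (p ^ e) \<in> mixed_power R s (p ^ e) I"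
  shows "x \<in> weak_closure R p s I"
proof -
  have "\<exists>c\<in>{c \<in> carrier R. \<forall>\<^sub>F e in sequentially. c \<otimes> x [^] (p ^ e) \<in> mixed_power R s (p ^ e) I}.
     c \<in> avoiding_minimal_primes R"
    by (rule ideal_meets_avoiding_minimal_primes[OF multiplier_ideal[OF I x]]) (use c in blast)
  then show ?thesis using x unfolding weak_closure_def by blast
qed

lemma weak_closureD:
  assumes "x \<in> weak_closure R p s I"
  obtains c where "c \<in> carrier R" and "\<forall>P\<in>minimal_primes R. c \<notin> P"
    and "\<forall>\<^sub>F e in sequentially. c \<otimes> x [^] (p ^ e) \<in> mixed_power R s (p ^ e) I"
  using assms unfolding weak_closure_def avoiding_minimal_primes_def by blast

lemma weak_closure_carr: "x \<in> weak_closure R p s I \<Longrightarrow> x \<in> carrier R"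
  by (simp add: weak_closure_def)

lemma weak_closure_add:
  assumes I: "ideal I R" and x: "x \<in> weak_closure R p s I" and y: "y \<in> weak_closure R p s I"
  shows "x \<oplus> y \<in> weak_closure R p s I"
proof -
  obtain c where c: "c \<in> carrier R" "\<forall>P\<in>minimal_primes R. c \<notin> P"
    and ec: "\<forall>\<^sub>F e in sequentially. c \<otimes> x [^] (p ^ e) \<in> mixed_power R s (p ^ e) I"
    using weak_closureD[OF x] .
  obtain d where d: "d \<in> carrier R" "\<forall>P\<in>minimal_primes R. d \<notin> P"
    and ed: "\<forall>\<^sub>F e in sequentially. d \<otimes> y [^] (p ^ e) \<in> mixed_power R s (p ^ e) I"
    using weak_closureD[OF y] .
  note xc = weak_closure_carr[OF x] and yc = weak_closure_carr[OF y]
  note M = mixed_power_ideal[OF I]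
  from ec ed have ev: "\<forall>\<^sub>F e in sequentially.
      (c \<otimes> d) \<otimes> (x \<oplus> y) [^] (p ^ e) \<in> mixed_power R s (p ^ e) I"
  proof eventually_elim
    case (elim e)
    have "(c \<otimes> d) \<otimes> (x \<oplus> y) [^] (p ^ e) = (c \<otimes> d) \<otimes> x [^] (p ^ e) \<oplus> (c \<otimes> d) \<otimes> y [^] (p ^ e)"
      using c d xc yc by (simp add: frobenius_add r_distr)
    also have "(c \<otimes> d) \<otimes> x [^] (p ^ e) = d \<otimes> (c \<otimes> x [^] (p ^ e))"
      using c d xc by (simp add: m_lcomm m_assoc)
    also have "(c \<otimes> d) \<otimes> y [^] (p ^ e) = c \<otimes> (d \<otimes> y [^] (p ^ e))"
      using c d yc by (simp add: m_assoc)
    also have "d \<otimes> (c \<otimes> x [^] (p ^ e)) \<oplus> c \<otimes> (d \<otimes> y [^] (p ^ e)) \<in> mixed_power R s (p ^ e) I"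
      by (rule ideal_add[OF M ideal_lmult[OF M d(1) elim(1)] ideal_lmult[OF M c(1) elim(2)]])
    finally show ?case .
  qed
  show ?thesis
  proof (rule weak_closureI[OF I])
    show "x \<oplus> y \<in> carrier R" using xc yc by simp
    fix P assume P: "P \<in> minimal_primes R"
    have "c \<otimes> d \<in> carrier R - P" using c d P by (intro prime_mult[OF minimal_prime]) auto
    with ev show "\<exists>c\<in>carrier R - P. \<forall>\<^sub>F e in sequentially.
        c \<otimes> (x \<oplus> y) [^] (p ^ e) \<in> mixed_power R s (p ^ e) I" by blast
  qed
qed

lemma weak_closure_neg:
  assumes I: "ideal I R" and x: "x \<in> weak_closure R p s I"
  shows "\<ominus> x \<in> weak_closure R p s I"
proof -
  obtain c where c: "c \<in> carrier R" "\<forall>P\<in>minimal_primes R. c \<notin> P"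
    and ec: "\<forall>\<^sub>F e in sequentially. c \<otimes> x [^] (p ^ e) \<in> mixed_power R s (p ^ e) I"
    using weak_closureD[OF x] .
  note xc = weak_closure_carr[OF x]
  note M = mixed_power_ideal[OF I]
  from ec have "\<forall>\<^sub>F e in sequentially. c \<otimes> (\<ominus> x) [^] (p ^ e) \<in> mixed_power R s (p ^ e) I"
  proof eventually_elim
    case (elim e)
    have "x [^] (p ^ e) \<oplus> (\<ominus> x) [^] (p ^ e) = \<zero>"
      using xc frobenius_add[of x "\<ominus> x" e] by (simp add: r_neg frobenius_zero)
    then have "(\<ominus> x) [^] (p ^ e) = \<ominus> (x [^] (p ^ e))"
      using xc by (metis a_inv_closed minus_equality nat_pow_closed a_comm)
    then have "c \<otimes> (\<ominus> x) [^] (p ^ e) = \<ominus> (c \<otimes> x [^] (p ^ e))"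
      using c xc by (simp add: r_minus)
    then show ?case using elim ideal_neg[OF M] by simp
  qed
  then show ?thesis using c xc by (intro weak_closureI[OF I]) auto
qed

text \<open>Let \<open>c x\<^sup>q = a + b\<close> with \<open>a\<close> in the mixed power and \<open>b \<in> P\<close>, and let \<open>d \<notin> P\<close> lie in all other minimal primes.
  Then \<open>d b\<close> lies in all minimal primes and is nilpotent of an order that does not depend on \<open>q\<close>, so a
  fixed Frobenius power of \<open>d c x\<^sup>q = d a + d b\<close> loses the second term.\<close>

theorem weak_closure_modulo_minimal_primes:
  assumes I: "ideal I R" and x: "x \<in> carrier R" and s: "s \<ge> 0"
    and c: "\<And>P. P \<in> minimal_primes R \<Longrightarrow> \<exists>c\<in>carrier R - P.
       \<forall>\<^sub>F e in sequentially. c \<otimes> x [^] (p ^ e) \<in> mixed_power R s (p ^ e) I <+> P"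
  shows "x \<in> weak_closure R p s I"
proof (rule weak_closureI[OF I x])
  fix P assume P: "P \<in> minimal_primes R"
  note M = mixed_power_ideal[OF I] and PI = prime_ideal[OF minimal_prime[OF P]]
  obtain c where c: "c \<in> carrier R - P"
    and ev: "\<forall>\<^sub>F e in sequentially. c \<otimes> x [^] (p ^ e) \<in> mixed_power R s (p ^ e) I <+> P"
    using assms(4)[OF P] by blast
  obtain d where d: "d \<in> carrier R - P" "\<forall>Q\<in>minimal_primes R. Q \<noteq> P \<longrightarrow> d \<in> Q"
    using separating_element[OF P] .
  obtain r where r: "\<And>xs. \<lbrakk>length xs = r; set xs \<subseteq> {x \<in> carrier R. \<forall>P\<in>minimal_primes R. x \<in> P}\<rbrakk>
      \<Longrightarrow> list_product xs = \<zero>"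
    using nilpotent by blast
  have nil: "z [^] (p ^ r) = \<zero>" if z: "z \<in> carrier R" "\<forall>Q\<in>minimal_primes R. z \<in> Q" for z
  proof -
    have pow: "list_product (replicate n z) = z [^] n" for n
      using z(1) by (induction n) (simp_all add: m_comm)
    have "list_product (replicate r z) = \<zero>" by (rule r) (use z in auto)
    then have "z [^] r = \<zero>" by (simp only: pow)
    moreover have "r \<le> p ^ r" using p_gt_1 by (simp add: less_exp less_imp_le power_gt_expt)
    ultimately show ?thesis using z(1) nat_pow_mult[of z r "p ^ r - r"] by simp
  qed
  define c' where "c' = (d \<otimes> c) [^] (p ^ r)"
  have c': "c' \<in> carrier R - P"
    unfolding c'_def using c d(1) by (intro prime_pow prime_mult minimal_prime P)
  from ev have "\<forall>\<^sub>F e in sequentially. c' \<otimes> x [^] (p ^ (e + r)) \<in> mixed_power R s (p ^ (e + r)) I"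
  proof eventually_elim
    case (elim e)
    then obtain a b where a: "a \<in> mixed_power R s (p ^ e) I" and b: "b \<in> P"
      and ab: "c \<otimes> x [^] (p ^ e) = a \<oplus> b" by (auto simp: mem_set_add_iff)
    have ac: "a \<in> carrier R" and bc: "b \<in> carrier R" using ideal_carr[OF M a] ideal_carr[OF PI b] .
    have "d \<otimes> b \<in> Q" if "Q \<in> minimal_primes R" for Q
      using that d b bc ideal_lmult[OF PI] ideal_rmult[OF prime_ideal[OF minimal_prime[OF that]]]
      by (cases "Q = P") auto
    then have db: "(d \<otimes> b) [^] (p ^ r) = \<zero>" using d bc by (intro nil) auto
    have "c' \<otimes> x [^] (p ^ (e + r)) = (d \<otimes> (c \<otimes> x [^] (p ^ e))) [^] (p ^ r)"
      using c d x by (simp add: c'_def nat_pow_distrib nat_pow_pow power_add m_assoc)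
    also have "\<dots> = (d \<otimes> a) [^] (p ^ r) \<oplus> (d \<otimes> b) [^] (p ^ r)"
      unfolding ab using d ac bc by (simp add: r_distr frobenius_add)
    also have "\<dots> = (d \<otimes> a) [^] (p ^ r)" unfolding db using d ac by simp
    also have "\<dots> \<in> mixed_power R s (p ^ (e + r)) I"
      using d a by (intro frobenius_mixed_power[OF I _ s] ideal_lmult[OF M]) auto
    finally show ?case .
  qed
  then have "\<forall>\<^sub>F e in sequentially. c' \<otimes> x [^] (p ^ e) \<in> mixed_power R s (p ^ e) I"
    by (rule eventually_sequentially_seg[THEN iffD1])
  then show "\<exists>c\<in>carrier R - P. \<forall>\<^sub>F e in sequentially. c \<otimes> x [^] (p ^ e) \<in> mixed_power R s (p ^ e) I"
    using c' by blast
qed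

end

section \<open>Principal ideals\<close>

text \<open>The ordinary power is absorbed: \<open>\<lceil>s q\<rceil> \<ge> q\<close>, and the power \<open>(f)\<^sup>q\<close> is generated by \<open>f\<^sup>q\<close>.\<close>

lemma (in cring) mixed_power_principal:
  assumes f: "f \<in> carrier R" and "s \<ge> 1" "q \<ge> 1"
  shows "mixed_power R s q (Idl {f}) = frobenius_power R (Idl {f}) q"
proof -
  have If: "ideal (Idl {f}) R" using f by (intro genideal_ideal) simp
  have F: "ideal (frobenius_power R (Idl {f}) q) R"
    using ideal_carr[OF If] by (intro frobenius_power_ideal) blast
  have "real q \<le> s * real q" using assms by simp
  then have "int q \<le> \<lceil>s * real q\<rceil>" by linarith
  then have "q \<le> nat \<lceil>s * real q\<rceil>" by linarith
  then have "ideal_pow (Idl {f}) (nat \<lceil>s * real q\<rceil>) \<subseteq> ideal_pow (Idl {f}) q"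
    by (rule ideal_pow_antimono[OF If])
  also have "\<dots> = Idl (product_set {f} q)" using f by (intro ideal_pow_genideal) simp
  also have "product_set {f} q = {f [^] q}" by (induction q) auto
  also have "Idl {f [^] q} \<subseteq> frobenius_power R (Idl {f}) q"
    using genideal_self'[OF f] ideal_carr[OF If] f
    unfolding frobenius_power_def by (intro subset_Idl_subset) auto
  finally have "mixed_power R s q (Idl {f}) \<subseteq> frobenius_power R (Idl {f}) q"
    unfolding mixed_power_def set_add_def' using ideal_add[OF F] by blast
  moreover have "frobenius_power R (Idl {f}) q \<subseteq> mixed_power R s q (Idl {f})"
    using mem_mixed_powerI(2)[OF If] by blast
  ultimately show ?thesis by blast
qed

lemma (in cring) left_stable_principal:
  assumes "principalideal I R" and "s > 1" and "p \<ge> 1"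
  shows "left_stable R p I s"
proof -
  interpret I: principalideal I R by fact
  obtain f where f: "f \<in> carrier R" "I = Idl {f}" using I.generate by blast
  show ?thesis
  proof (rule left_stableI)
    show "ideal I R" by (rule I.is_ideal)
    show "(1::real) > 0" by simp
    fix t :: real assume "1 \<le> t" "t < s"
    then have "mixed_power R t (p ^ e) I = mixed_power R s (p ^ e) I" for e
      using mixed_power_principal[OF f(1)] assms(2,3) by (simp add: f(2))
    then show "weak_closure R p t I \<subseteq> weak_closure R p s I" by (simp add: weak_closure_def)
  qed
qed

section \<open>Homogeneous components\<close>

context graded_ring
begin

lemma piece_carr: "x \<in> \<A> g \<Longrightarrow> x \<in> carrier R"
  using additive_subgroup.a_subset[OF piece_subgroup] by blast

lemma piece_zero: "\<zero> \<in> \<A> g"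
  by (rule additive_subgroup.zero_closed[OF piece_subgroup])

lemma piece_add: "\<lbrakk>x \<in> \<A> g; y \<in> \<A> g\<rbrakk> \<Longrightarrow> x \<oplus> y \<in> \<A> g"
  by (rule additive_subgroup.a_closed[OF piece_subgroup])

lemma piece_neg: "x \<in> \<A> g \<Longrightarrow> \<ominus> x \<in> \<A> g"
  by (rule additive_subgroup.a_inv_closed[OF piece_subgroup])

definition component where
  "component x = (THE f. (\<forall>g. f g \<in> \<A> g) \<and> finite {g. f g \<noteq> \<zero>} \<and>
     x = (\<Oplus>g\<in>{g. f g \<noteq> \<zero>}. f g))"

lemma component_props:
  assumes "x \<in> carrier R"
  shows component_mem: "component x g \<in> \<A> g"
    and finite_support: "finite {g. component x g \<noteq> \<zero>}"
    and component_sum: "(\<Oplus>g\<in>{g. component x g \<noteq> \<zero>}. component x g) = x"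
proof -
  have "(\<forall>g. component x g \<in> \<A> g) \<and> finite {g. component x g \<noteq> \<zero>} \<and>
     x = (\<Oplus>g\<in>{g. component x g \<noteq> \<zero>}. component x g)"
    unfolding component_def by (rule theI'[OF direct_sum[OF assms]])
  then show "component x g \<in> \<A> g" "finite {g. component x g \<noteq> \<zero>}"
    "(\<Oplus>g\<in>{g. component x g \<noteq> \<zero>}. component x g) = x" by auto
qed

lemma component_carr: "x \<in> carrier R \<Longrightarrow> component x g \<in> carrier R"
  using component_mem piece_carr by blast

lemma component_unique:
  assumes f: "\<And>g. f g \<in> \<A> g" and S: "finite S" "\<And>g. g \<notin> S \<Longrightarrow> f g = \<zero>"
    and x: "x = (\<Oplus>g\<in>S. f g)"
  shows "component x = f"
proof -
  have fc: "f g \<in> carrier R" for g using f piece_carr by blast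
  have sub: "{g. f g \<noteq> \<zero>} \<subseteq> S" using S(2) by blast
  have fin: "finite {g. f g \<noteq> \<zero>}" using finite_subset[OF sub S(1)] .
  have eq: "x = (\<Oplus>g\<in>{g. f g \<noteq> \<zero>}. f g)"
    unfolding x by (rule add.finprod_mono_neutral_cong_right[OF S(1) sub]) (auto simp: fc)
  have xc: "x \<in> carrier R" unfolding x using fc by (intro finsum_closed) auto
  from direct_sum[OF xc] have "\<And>f'. (\<forall>g. f' g \<in> \<A> g) \<and> finite {g. f' g \<noteq> \<zero>} \<and>
     x = (\<Oplus>g\<in>{g. f' g \<noteq> \<zero>}. f' g) \<Longrightarrow> f' = f"
    by (rule ex1E) (use f fin eq in metis)
  then show ?thesis
    using component_mem[OF xc] finite_support[OF xc] component_sum[OF xc] by simp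
qed

lemma component_homogeneous:
  assumes "x \<in> \<A> g"
  shows "component x h = (if h = g then x else \<zero>)"
proof -
  have "component x = (\<lambda>h. if h = g then x else \<zero>)"
    by (rule component_unique[of _ "{g}"]) (use assms piece_zero piece_carr in auto)
  then show ?thesis by simp
qed

lemma component_zero: "component \<zero> h = \<zero>"
  using component_homogeneous[OF piece_zero] by (cases "h = undefined") (metis (full_types))+

lemma component_add:
  assumes x: "x \<in> carrier R" and y: "y \<in> carrier R"
  shows "component (x \<oplus> y) g = component x g \<oplus> component y g"
proof -
  let ?S = "{g. component x g \<noteq> \<zero>} \<union> {g. component y g \<noteq> \<zero>}"
  have fin: "finite ?S" using finite_support x y by simp
  have c: "component x g \<in> carrier R" "component y g \<in> carrier R" for g
    using component_carr x y by auto
  have "component (x \<oplus> y) = (\<lambda>g. component x g \<oplus> component y g)"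
  proof (rule component_unique[OF _ fin])
    show "component x g \<oplus> component y g \<in> \<A> g" for g
      using component_mem x y piece_add by blast
    show "component x g \<oplus> component y g = \<zero>" if "g \<notin> ?S" for g using that by simp
    have "(\<Oplus>g\<in>?S. component x g \<oplus> component y g) = (\<Oplus>g\<in>?S. component x g) \<oplus> (\<Oplus>g\<in>?S. component y g)"
      using c by (intro finsum_addf) auto
    also have "(\<Oplus>g\<in>?S. component x g) = (\<Oplus>g\<in>{g. component x g \<noteq> \<zero>}. component x g)"
      by (rule add.finprod_mono_neutral_cong_right[OF fin]) (auto simp: c)
    also have "(\<Oplus>g\<in>?S. component y g) = (\<Oplus>g\<in>{g. component y g \<noteq> \<zero>}. component y g)"
      by (rule add.finprod_mono_neutral_cong_right[OF fin]) (auto simp: c)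
    finally show "x \<oplus> y = (\<Oplus>g\<in>?S. component x g \<oplus> component y g)"
      using component_sum x y by simp
  qed
  then show ?thesis by simp
qed

lemma component_neg:
  assumes x: "x \<in> carrier R" shows "component (\<ominus> x) g = \<ominus> component x g"
proof -
  have "component (\<ominus> x) g \<oplus> component x g = \<zero>"
    using component_add[of "\<ominus> x" x g] x by (simp add: l_neg component_zero)
  then show ?thesis
    using x component_carr by (metis a_inv_closed minus_equality)
qed

lemma finsum_in_closed_set:
  assumes "T \<subseteq> carrier R" "\<zero> \<in> T" "\<And>x y. \<lbrakk>x \<in> T; y \<in> T\<rbrakk> \<Longrightarrow> x \<oplus> y \<in> T"
    and "\<And>i. i \<in> S \<Longrightarrow> f i \<in> T"
  shows "(\<Oplus>i\<in>S. f i) \<in> T"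
  using assms(4)
proof (induction S rule: infinite_finite_induct)
  case (insert i S)
  then have "f \<in> S \<rightarrow> carrier R" "f i \<in> carrier R" using assms(1) by auto
  then show ?case using insert assms(3) by simp
qed (use assms(2) in simp_all)

lemma sum_of_homogeneous_in_closed_set:
  assumes "T \<subseteq> carrier R" "\<zero> \<in> T" "\<And>x y. \<lbrakk>x \<in> T; y \<in> T\<rbrakk> \<Longrightarrow> x \<oplus> y \<in> T"
    and x: "x \<in> carrier R" and "\<And>g. component x g \<in> T"
  shows "x \<in> T"
proof -
  have "(\<Oplus>g\<in>{g. component x g \<noteq> \<zero>}. component x g) \<in> T"
    by (rule finsum_in_closed_set[OF assms(1-3) assms(5)])
  then show ?thesis using component_sum[OF x] by simp
qed

lemma product_in_closed_set:
  assumes T: "T \<subseteq> carrier R" "\<zero> \<in> T" "\<And>x y. \<lbrakk>x \<in> T; y \<in> T\<rbrakk> \<Longrightarrow> x \<oplus> y \<in> T"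
    and x: "x \<in> carrier R" and y: "y \<in> carrier R"
    and comps: "\<And>g h. component x g \<otimes> component y h \<in> T"
  shows "x \<otimes> y \<in> T"
proof -
  have inner: "component x g \<otimes> y \<in> T" for g
  proof -
    have "component x g \<otimes> (\<Oplus>h\<in>{h. component y h \<noteq> \<zero>}. component y h)
       = (\<Oplus>h\<in>{h. component y h \<noteq> \<zero>}. component x g \<otimes> component y h)"
      using finite_support[OF y] component_carr x y by (intro finsum_rdistr) auto
    also have "\<dots> \<in> T" by (rule finsum_in_closed_set[OF T comps])
    finally show ?thesis using component_sum[OF y] by simp
  qed
  have "(\<Oplus>g\<in>{g. component x g \<noteq> \<zero>}. component x g) \<otimes> y
     = (\<Oplus>g\<in>{g. component x g \<noteq> \<zero>}. component x g \<otimes> y)"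
    using finite_support[OF x] component_carr x y by (intro finsum_ldistr) auto
  also have "\<dots> \<in> T" by (rule finsum_in_closed_set[OF T inner])
  finally show ?thesis using component_sum[OF x] by simp
qed

text \<open>An ideal generated by homogeneous elements is contained in an ideal of this form as soon as its
  generators are; this is how statements about components of its elements are proved.\<close>

lemma componentwise_ideal:
  assumes sub: "\<And>g. W g \<subseteq> \<A> g" and zero: "\<And>g. \<zero> \<in> W g"
    and add: "\<And>g x y. \<lbrakk>x \<in> W g; y \<in> W g\<rbrakk> \<Longrightarrow> x \<oplus> y \<in> W g"
    and mult: "\<And>g h a w. \<lbrakk>a \<in> \<A> h; w \<in> W g\<rbrakk> \<Longrightarrow> a \<otimes> w \<in> W (h + g)"
  shows "ideal {x \<in> carrier R. \<forall>g. component x g \<in> W g} R" (is "ideal ?T R")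
proof (rule ideal_by_closure)
  show T1: "?T \<subseteq> carrier R" by blast
  show T2: "\<zero> \<in> ?T" using zero component_zero by simp
  show T3: "x \<oplus> y \<in> ?T" if "x \<in> ?T" "y \<in> ?T" for x y
    using that add by (simp add: component_add)
  show "r \<otimes> x \<in> ?T" if r: "r \<in> carrier R" and x: "x \<in> ?T" for r x
  proof (rule product_in_closed_set[OF T1 T2 T3 r])
    show "x \<in> carrier R" using x by simp
    fix g h
    have w: "component r g \<otimes> component x h \<in> W (g + h)"
      using x component_mem[OF r] by (intro mult) auto
    then have A: "component r g \<otimes> component x h \<in> \<A> (g + h)" using sub by blast
    then show "component r g \<otimes> component x h \<in> ?T"
      using piece_carr[OF A] component_homogeneous[OF A] w zero by simp
  qed
qed

lemma component_genideal:
  assumes H: "H \<subseteq> (\<Union>g. \<A> g)" and x: "x \<in> Idl H"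
  shows "component x g \<in> Idl H"
proof -
  have Hc: "H \<subseteq> carrier R" using H piece_carr by blast
  note I = genideal_ideal[OF Hc]
  let ?W = "\<lambda>g. \<A> g \<inter> Idl H"
  have T: "ideal {x \<in> carrier R. \<forall>g. component x g \<in> ?W g} R"
  proof (rule componentwise_ideal)
    show "\<zero> \<in> ?W g" for g using piece_zero ideal_zero[OF I] by simp
    show "x \<oplus> y \<in> ?W g" if "x \<in> ?W g" "y \<in> ?W g" for g x y
      using that piece_add ideal_add[OF I] by simp
    show "a \<otimes> w \<in> ?W (h + g)" if "a \<in> \<A> h" "w \<in> ?W g" for g h a w
      using that mult_piece ideal_lmult[OF I] piece_carr[OF that(1)] by simp
  qed simp
  have "H \<subseteq> {x \<in> carrier R. \<forall>g. component x g \<in> ?W g}"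
  proof
    fix h assume h: "h \<in> H"
    then obtain g where g: "h \<in> \<A> g" using H by blast
    then have "component h g' \<in> ?W g'" for g'
      using component_homogeneous[OF g, of g'] genideal_mem_self[OF Hc h] ideal_zero[OF I] piece_zero
      by simp
    then show "h \<in> {x \<in> carrier R. \<forall>g. component x g \<in> ?W g}" using piece_carr[OF g] by simp
  qed
  then show ?thesis using genideal_mem[OF T _ x] by blast
qed

lemma homogeneous_pow:
  assumes "x \<in> \<A> g" shows "\<exists>h. x [^] (n::nat) \<in> \<A> h"
proof (induction n)
  case 0 then show ?case using one_piece by auto
next
  case (Suc n) then show ?case using mult_piece[OF _ assms] by auto
qed

lemma homogeneous_product_set:
  assumes "H \<subseteq> (\<Union>g. \<A> g)" shows "product_set H n \<subseteq> (\<Union>g. \<A> g)"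
proof (induction n)
  case 0 then show ?case using one_piece by auto
next
  case (Suc n)
  show ?case
  proof
    fix x assume "x \<in> product_set H (Suc n)"
    then obtain a h where ah: "x = a \<otimes> h" "a \<in> product_set H n" "h \<in> H" by auto
    moreover obtain g where "a \<in> \<A> g" using Suc ah(2) by blast
    moreover obtain g' where "h \<in> \<A> g'" using assms ah(3) by blast
    ultimately show "x \<in> (\<Union>g. \<A> g)" using mult_piece by blast
  qed
qed

end

section \<open>Powers of the irrelevant ideal\<close>

lemma (in prime_char_ring) less_prime_power: "e < p ^ e"
proof -
  have "e < 2 ^ e" by simp
  also have "(2::nat) ^ e \<le> p ^ e" using p_gt_1 by (intro power_mono) auto
  finally show ?thesis .
qed

lemma (in prime_char_ring) eventually_prime_power_gt:
  "\<forall>\<^sub>F e in sequentially. real (p ^ e) > B"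
proof -
  obtain e0 :: nat where "real e0 > B" using reals_Archimedean2 by blast
  then have "real (p ^ e) > B" if "e \<ge> e0" for e
    using that less_prime_power[of e] by (metis less_le_trans less_trans of_nat_le_iff of_nat_less_iff)
  then show ?thesis by (rule eventually_sequentiallyI)
qed

lemma (in cring) product_set_list:
  assumes "H \<subseteq> carrier R" "a \<in> product_set H n"
  shows "\<exists>xs. length xs = n \<and> set xs \<subseteq> H \<and> a = list_product xs"
  using assms(2)
proof (induction n arbitrary: a)
  case 0 then show ?case by simp
next
  case (Suc n)
  then obtain b h where b: "a = b \<otimes> h" "b \<in> product_set H n" "h \<in> H" by auto
  then obtain xs where xs: "length xs = n" "set xs \<subseteq> H" "b = list_product xs" using Suc.IH by blast
  have "list_product (xs @ [h]) = b \<otimes> h"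
    using list_product_append[of xs "[h]"] xs b assms(1) by (auto simp: subset_iff)
  then show ?case using xs b by (intro exI[of _ "xs @ [h]"]) auto
qed

lemma (in cring) list_product_scale:
  assumes "d \<in> carrier R" "set xs \<subseteq> carrier R"
  shows "list_product (map (\<lambda>z. d \<otimes> z) xs) = list_product xs \<otimes> d [^] length xs"
  using assms(2)
proof (induction xs)
  case (Cons x xs)
  then have c: "x \<in> carrier R" "list_product xs \<in> carrier R" using list_product_closed[of xs] by auto
  have "list_product (map (\<lambda>z. d \<otimes> z) (x # xs)) = (d \<otimes> x) \<otimes> (list_product xs \<otimes> d [^] length xs)"
    using Cons by simp
  also have "\<dots> = (x \<otimes> list_product xs) \<otimes> (d [^] length xs \<otimes> d)"
    using c assms(1) by (simp add: m_assoc m_lcomm m_comm[of d])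
  finally show ?case by simp
qed simp

text \<open>The letter \<open>R\<^sub>+\<close> in the comments below stands for the irrelevant ideal.\<close>

locale standard_graded_ring =
  graded_ring R \<A> + finite_minimal_primes_ring R p
  for R (structure) and \<A> :: "nat \<Rightarrow> 'a set" and p +
  assumes degree_one: "generated_in_degree_one R \<A>"
begin

abbreviation irrelevant :: "'a set" where "irrelevant \<equiv> irrelevant_ideal R \<A>"

lemma degree_one_carr: "\<A> 1 \<subseteq> carrier R" using piece_carr by blast

lemma ideal_irrelevant: "ideal irrelevant R"
  unfolding irrelevant_ideal_def by (rule genideal_ideal[OF degree_one_carr])

text \<open>The elements with this property form a subring that contains the pieces of degree \<open>0\<close> and \<open>1\<close>.\<close>

lemma component_mem_irrelevant_pow:
  assumes "x \<in> carrier R" shows "component x d \<in> ideal_pow irrelevant d"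
proof -
  let ?T = "{x \<in> carrier R. \<forall>d. component x d \<in> ideal_pow irrelevant d}"
  note P = ideal_pow_ideal[OF ideal_irrelevant]
  have T1: "?T \<subseteq> carrier R" by blast
  have T2: "\<zero> \<in> ?T" using component_zero ideal_zero[OF P] by simp
  have T3: "x \<oplus> y \<in> ?T" if "x \<in> ?T" "y \<in> ?T" for x y
    using that ideal_add[OF P] by (simp add: component_add)
  have homog: "x \<in> ?T" if "x \<in> \<A> d" "x \<in> ideal_pow irrelevant d" for x d
    using that piece_carr ideal_zero[OF P] by (simp add: component_homogeneous)
  have base: "\<A> 0 \<union> \<A> 1 \<subseteq> ?T"
  proof
    fix x assume "x \<in> \<A> 0 \<union> \<A> 1"
    then show "x \<in> ?T"
    proof
      assume x: "x \<in> \<A> 0"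
      show ?thesis by (rule homog[OF x]) (use piece_carr[OF x] in \<open>simp only: ideal_pow_0\<close>)
    next
      assume x: "x \<in> \<A> 1"
      show ?thesis
      proof (rule homog[OF x])
        have "x \<in> irrelevant"
          unfolding irrelevant_ideal_def by (rule genideal_mem_self[OF degree_one_carr x])
        then show "x \<in> ideal_pow irrelevant 1" by (simp only: ideal_pow_1[OF ideal_irrelevant])
      qed
    qed
  qed
  have "x \<in> ?T" if "x \<in> generate_ring R (\<A> 0 \<union> \<A> 1)" for x
    using that
  proof induction
    case one
    then show ?case using base one_piece by blast
  next
    case (incl h)
    then show ?case using base by blast
  next
    case (a_inv h)
    then show ?case using ideal_neg[OF P] by (simp add: component_neg)
  next
    case (eng_add h1 h2)
    then show ?case by (intro T3)
  next
    case (eng_mult h1 h2)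
    then have c: "h1 \<in> carrier R" "h2 \<in> carrier R" by auto
    show ?case
    proof (rule product_in_closed_set[OF T1 T2 T3 c])
      show "component h1 i \<otimes> component h2 j \<in> ?T" for i j
        by (rule homog[of _ "i + j"])
          (use eng_mult.IH component_mem[OF c(1)] component_mem[OF c(2)] in
            \<open>auto intro: mult_piece ideal_pow_mult[OF ideal_irrelevant]\<close>)
    qed
  qed
  then show ?thesis using degree_one assms unfolding generated_in_degree_one_def by blast
qed

lemma product_set_degree_one: "product_set (\<A> 1) n \<subseteq> \<A> n"
proof (induction n)
  case 0 then show ?case using one_piece by auto
next
  case (Suc n)
  then show ?case using mult_piece[of _ n _ 1] by auto
qed

lemma irrelevant_pow: "ideal_pow irrelevant n = Idl (product_set (\<A> 1) n)"
  unfolding irrelevant_ideal_def by (rule ideal_pow_genideal[OF degree_one_carr])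

lemma irrelevant_pow_iff:
  "x \<in> ideal_pow irrelevant D \<longleftrightarrow> x \<in> carrier R \<and> (\<forall>d<D. component x d = \<zero>)"
proof
  let ?W = "\<lambda>g. if g < D then {\<zero>} else \<A> g"
  let ?T = "{x \<in> carrier R. \<forall>g. component x g \<in> ?W g}"
  assume x: "x \<in> ideal_pow irrelevant D"
  have T: "ideal ?T R"
    by (rule componentwise_ideal)
      (auto simp: piece_zero piece_add r_null[OF piece_carr] split: if_splits intro: mult_piece piece_carr)
  have "product_set (\<A> 1) D \<subseteq> ?T"
  proof
    fix a assume "a \<in> product_set (\<A> 1) D"
    then have a: "a \<in> \<A> D" using product_set_degree_one by blast
    then show "a \<in> ?T" using piece_carr[OF a] component_homogeneous[OF a] piece_zero by simp
  qed
  then have "x \<in> ?T" using genideal_mem[OF T] x irrelevant_pow by blast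
  then show "x \<in> carrier R \<and> (\<forall>d<D. component x d = \<zero>)" by (auto split: if_splits)
next
  assume x: "x \<in> carrier R \<and> (\<forall>d<D. component x d = \<zero>)"
  note P = ideal_pow_ideal[OF ideal_irrelevant, of D]
  show "x \<in> ideal_pow irrelevant D"
  proof (rule sum_of_homogeneous_in_closed_set)
    show "component x d \<in> ideal_pow irrelevant D" for d
    proof (cases "d < D")
      case True then show ?thesis using x ideal_zero[OF P] by simp
    next
      case False
      then have "D \<le> d" by simp
      from ideal_pow_antimono[OF ideal_irrelevant this] show ?thesis
        using x component_mem_irrelevant_pow by blast
    qed
  qed (use x ideal_carr[OF P] ideal_zero[OF P] ideal_add[OF P] in blast)+
qed

definition degree_le :: "'a \<Rightarrow> nat \<Rightarrow> bool" where
  "degree_le x d \<longleftrightarrow> x \<in> carrier R \<and> (\<forall>g>d. component x g = \<zero>)"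

lemma degree_le_mult:
  assumes x: "degree_le x a" and y: "degree_le y b" shows "degree_le (x \<otimes> y) (a + b)"
proof -
  let ?T = "{x. degree_le x (a + b)}"
  have c: "x \<in> carrier R" "y \<in> carrier R" using x y by (auto simp: degree_le_def)
  have "x \<otimes> y \<in> ?T"
  proof (rule product_in_closed_set[OF _ _ _ c])
    show "component x i \<otimes> component y j \<in> ?T" for i j
    proof (cases "i \<le> a \<and> j \<le> b")
      case True
      have A: "component x i \<otimes> component y j \<in> \<A> (i + j)"
        using component_mem c by (intro mult_piece) auto
      show ?thesis using True piece_carr[OF A] component_homogeneous[OF A] by (simp add: degree_le_def)
    next
      case False
      then have "component x i = \<zero> \<or> component y j = \<zero>" using x y by (auto simp: degree_le_def)
      then have "component x i \<otimes> component y j = \<zero>" using component_carr c by auto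
      then show ?thesis by (simp add: degree_le_def component_zero)
    qed
  qed (auto simp: degree_le_def component_zero component_add)
  then show ?thesis by simp
qed

lemma degree_le_pow:
  assumes "degree_le x a" shows "degree_le (x [^] n) (a * n)"
proof (induction n)
  case 0
  show ?case using component_homogeneous[OF one_piece] by (simp add: degree_le_def)
next
  case (Suc n)
  show ?case using degree_le_mult[OF Suc assms] by (simp add: add.commute)
qed

lemma degree_bound_exists:
  assumes "x \<in> carrier R" shows "\<exists>d. degree_le x d"
proof -
  obtain d where "\<forall>g\<in>{g. component x g \<noteq> \<zero>}. g \<le> d"
    using finite_support[OF assms] finite_nat_set_iff_bounded_le by blast
  then show ?thesis using assms by (auto simp: degree_le_def not_le[symmetric])
qed

lemma low_high_decomposition:
  assumes "x \<in> carrier R" and "D \<ge> 1"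
  obtains y z where "x = y \<oplus> z" "y \<in> ideal_pow irrelevant D" "degree_le z (D - 1)"
proof -
  let ?z = "\<Oplus>g\<in>{..<D}. component x g"
  have cz: "component ?z = (\<lambda>g. if g < D then component x g else \<zero>)"
  proof (rule component_unique[of _ "{..<D}"])
    show "(\<Oplus>g\<in>{..<D}. component x g) = (\<Oplus>g\<in>{..<D}. if g < D then component x g else \<zero>)"
      using component_carr[OF assms(1)] by (intro finsum_cong') auto
  qed (use component_mem[OF assms(1)] piece_zero in auto)
  have zc: "?z \<in> carrier R" using component_carr[OF assms(1)] by (intro finsum_closed) auto
  have "component (x \<oplus> \<ominus> ?z) d = \<zero>" if "d < D" for d
    using that assms(1) zc component_carr[OF assms(1)]
    by (simp add: component_add component_neg cz r_neg)
  then have "x \<oplus> \<ominus> ?z \<in> ideal_pow irrelevant D"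
    using assms(1) zc by (simp add: irrelevant_pow_iff)
  moreover have "degree_le ?z (D - 1)" using zc cz by (auto simp: degree_le_def)
  moreover have "x = (x \<oplus> \<ominus> ?z) \<oplus> ?z" using assms(1) zc by (simp add: a_assoc l_neg)
  ultimately show thesis using that by blast
qed

text \<open>Localized at \<open>P\<close>, the ideal \<open>R\<^sub>+\<close> is nilpotent. Concretely, if \<open>d \<notin> P\<close> lies in all other minimal primes, then
  \<open>d z\<close> lies in every minimal prime for \<open>z \<in> R\<^sub>+\<close>, and \<open>r\<close> such elements multiply to zero.\<close>

lemma irrelevant_pow_annihilated:
  assumes P: "P \<in> minimal_primes R" and sub: "irrelevant \<subseteq> P"
  shows "\<exists>c\<in>carrier R - P. \<exists>r. \<forall>w\<in>ideal_pow irrelevant r. c \<otimes> w = \<zero>"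
proof -
  obtain d where d: "d \<in> carrier R - P" "\<forall>Q\<in>minimal_primes R. Q \<noteq> P \<longrightarrow> d \<in> Q"
    using separating_element[OF P] .
  obtain r where r: "\<And>xs. \<lbrakk>length xs = r; set xs \<subseteq> {x \<in> carrier R. \<forall>P\<in>minimal_primes R. x \<in> P}\<rbrakk>
      \<Longrightarrow> list_product xs = \<zero>"
    using nilpotent by blast
  have c: "d [^] r \<in> carrier R - P" using prime_pow[OF minimal_prime[OF P] d(1)] .
  let ?K = "{w \<in> carrier R. w \<otimes> d [^] r \<in> {\<zero>}}"
  have K: "ideal ?K R" using c by (intro colon_ideal zeroideal) auto
  have "product_set (\<A> 1) r \<subseteq> ?K"
  proof
    fix a assume a: "a \<in> product_set (\<A> 1) r"
    then obtain xs where xs: "length xs = r" "set xs \<subseteq> \<A> 1" "a = list_product xs"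
      using product_set_list[OF degree_one_carr] by blast
    have xsc: "set xs \<subseteq> carrier R" using xs(2) degree_one_carr by blast
    have "list_product (map (\<lambda>z. d \<otimes> z) xs) = \<zero>"
    proof (rule r)
      show "set (map (\<lambda>z. d \<otimes> z) xs) \<subseteq> {x \<in> carrier R. \<forall>P\<in>minimal_primes R. x \<in> P}"
      proof
        fix x assume "x \<in> set (map (\<lambda>z. d \<otimes> z) xs)"
        then obtain z where z: "z \<in> set xs" "x = d \<otimes> z" by auto
        have zc: "z \<in> carrier R" using z xsc by blast
        have "z \<in> irrelevant"
          using z xs(2) genideal_mem_self[OF degree_one_carr] unfolding irrelevant_ideal_def by blast
        then have zP: "z \<in> P" using sub by blast
        have "d \<otimes> z \<in> Q" if Q: "Q \<in> minimal_primes R" for Q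
          using ideal_lmult[OF prime_ideal[OF minimal_prime[OF Q]]]
            ideal_rmult[OF prime_ideal[OF minimal_prime[OF Q]]] zP zc d Q by (cases "Q = P") auto
        then show "x \<in> {x \<in> carrier R. \<forall>P\<in>minimal_primes R. x \<in> P}" using z d zc by simp
      qed
    qed (simp add: xs)
    then have "a \<otimes> d [^] r = \<zero>" using list_product_scale[of d xs] d xsc xs by simp
    then show "a \<in> ?K" using product_set_carrier[OF degree_one_carr] a by auto
  qed
  then have "w \<in> ?K" if "w \<in> ideal_pow irrelevant r" for w
    using genideal_mem[OF K] that irrelevant_pow by blast
  then have "\<forall>w\<in>ideal_pow irrelevant r. d [^] r \<otimes> w = \<zero>" using c by (auto simp: m_comm)
  then show ?thesis using c by blast
qed

text \<open>As \<open>y\<^sup>q\<close> lies in \<open>R\<^sub>+\<close> to the power \<open>D q \<ge> n s q\<close>, only the rounding in \<open>n \<lceil>s q\<rceil>\<close> has to be made up for, which is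
  less than \<open>n\<close>. If \<open>R\<^sub>+\<close> is not contained in \<open>P\<close>, the multiplier is taken from \<open>R\<^sub>+\<^sup>n\<close>. If it is, such a
  multiplier would lie in \<open>P\<close>, but then one outside \<open>P\<close> annihilates \<open>y\<^sup>q\<close> for large \<open>q\<close>.\<close>

lemma irrelevant_pow_subset_weak_closure:
  assumes n: "n \<ge> 1" and D: "real n * s \<le> real D" "D \<ge> 1" and y: "y \<in> ideal_pow irrelevant D"
    and s: "s \<ge> 0"
  shows "y \<in> weak_closure R p s (ideal_pow irrelevant n)"
proof (rule weak_closureI)
  let ?I = "ideal_pow irrelevant n"
  show I: "ideal ?I R" by (rule ideal_pow_ideal[OF ideal_irrelevant])
  show yc: "y \<in> carrier R" using y ideal_carr[OF ideal_pow_ideal[OF ideal_irrelevant]] by blast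
  have yq: "y [^] q \<in> ideal_pow irrelevant (D * q)" for q :: nat
    using power_mem_ideal_pow[OF ideal_irrelevant y] .
  fix P assume P: "P \<in> minimal_primes R"
  show "\<exists>c\<in>carrier R - P. \<forall>\<^sub>F e in sequentially. c \<otimes> y [^] (p ^ e) \<in> mixed_power R s (p ^ e) ?I"
  proof (cases "irrelevant \<subseteq> P")
    case True
    then obtain c r where c: "c \<in> carrier R - P" "\<forall>w\<in>ideal_pow irrelevant r. c \<otimes> w = \<zero>"
      using irrelevant_pow_annihilated[OF P] by blast
    have "c \<otimes> y [^] (p ^ e) \<in> mixed_power R s (p ^ e) ?I" if e: "e \<ge> r" for e
    proof -
      have "r \<le> p ^ e"
        using e p_gt_1 less_exp[of e] power_mono[of 2 p e] by linarith
      also have "\<dots> \<le> D * p ^ e" using D(2) by simp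
      finally have "y [^] (p ^ e) \<in> ideal_pow irrelevant r"
        using ideal_pow_antimono[OF ideal_irrelevant] yq by blast
      then have "c \<otimes> y [^] (p ^ e) = \<zero>" using c(2) by blast
      then show ?thesis using ideal_zero[OF mixed_power_ideal[OF I]] by simp
    qed
    then have "\<forall>\<^sub>F e in sequentially. c \<otimes> y [^] (p ^ e) \<in> mixed_power R s (p ^ e) ?I"
      by (rule eventually_sequentiallyI)
    then show ?thesis using c(1) by (rule bexI)
  next
    case False
    then obtain b where b: "b \<in> irrelevant" "b \<notin> P" by blast
    then have bc: "b \<in> carrier R - P" using ideal_carr[OF ideal_irrelevant] by blast
    have bn: "b [^] n \<in> ideal_pow irrelevant n"
    proof -
      have "b \<in> ideal_pow irrelevant 1" using b(1) by (simp only: ideal_pow_1[OF ideal_irrelevant])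
      from power_mem_ideal_pow[OF ideal_irrelevant this, of n] show ?thesis by simp
    qed
    have "b [^] n \<otimes> y [^] q \<in> mixed_power R s q ?I" for q :: nat
    proof -
      have "real (n * nat \<lceil>s * real q\<rceil>) \<le> real n * (s * real q + 1)"
        using s by (simp add: of_nat_ceiling mult_left_mono)
      also have "\<dots> = (real n * s) * real q + real n" by (simp add: algebra_simps)
      also have "\<dots> \<le> real D * real q + real n" using D(1) by (intro add_right_mono mult_right_mono) auto
      finally have "real (n * nat \<lceil>s * real q\<rceil>) \<le> real (n + D * q)" by simp
      then have le: "n * nat \<lceil>s * real q\<rceil> \<le> n + D * q" by (simp only: of_nat_le_iff)
      have "b [^] n \<otimes> y [^] q \<in> ideal_pow irrelevant (n + D * q)"
        using ideal_pow_mult[OF ideal_irrelevant bn yq] .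
      then have "b [^] n \<otimes> y [^] q \<in> ideal_pow ?I (nat \<lceil>s * real q\<rceil>)"
        using ideal_pow_antimono[OF ideal_irrelevant le] ideal_pow_pow[OF ideal_irrelevant] by blast
      then show ?thesis by (rule mem_mixed_powerI(1)[OF I])
    qed
    then show ?thesis using prime_pow[OF minimal_prime[OF P] bc, of n] by (intro bexI) auto
  qed
qed

lemma component_frobenius_power:
  assumes "b \<in> frobenius_power R (ideal_pow irrelevant n) (p ^ e)"
  shows "component b g \<in> frobenius_power R (ideal_pow irrelevant n) (p ^ e)"
proof -
  have F: "frobenius_power R (ideal_pow irrelevant n) (p ^ e) =
      Idl ((\<lambda>h. h [^] (p ^ e)) ` product_set (\<A> 1) n)"
    unfolding irrelevant_pow
    by (rule frobenius_power_genideal[OF product_set_carrier[OF degree_one_carr]])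
  have "(\<lambda>h. h [^] (p ^ e)) ` product_set (\<A> 1) n \<subseteq> (\<Union>g. \<A> g)"
  proof
    fix x assume "x \<in> (\<lambda>h. h [^] (p ^ e)) ` product_set (\<A> 1) n"
    then obtain h where h: "x = h [^] (p ^ e)" "h \<in> \<A> n" using product_set_degree_one by auto
    obtain g where "h [^] (p ^ e) \<in> \<A> g" using homogeneous_pow[OF h(2)] by blast
    then show "x \<in> (\<Union>g. \<A> g)" using h(1) by blast
  qed
  then show ?thesis using assms unfolding F by (rule component_genideal)
qed

text \<open>Degrees are integers, so for positive \<open>n\<close> the only critical exponents are the integer multiples of \<open>1 / n\<close>,
  and \<open>(D - 1) / n\<close> is the last of them below \<open>s\<close>.\<close>

theorem left_stable_irrelevant_pow:
  assumes s: "s > 1"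
  shows "left_stable R p (ideal_pow irrelevant n) s"
proof (cases "n = 0")
  case True
  have "principalideal (carrier R) R"
    using oneideal genideal_one by (intro principalidealI) auto
  then show ?thesis using s p_gt_1 True by (simp only: ideal_pow_0) (intro left_stable_principal, auto)
next
  case False
  let ?I = "ideal_pow irrelevant n"
  define D where "D = nat \<lceil>real n * s\<rceil>"
  have ns: "real n * s > 0" using False s by simp
  have D: "real n * s \<le> real D" "D \<ge> 1" "real (D - 1) < real n * s"
    using ns unfolding D_def by linarith+
  have I: "ideal ?I R" by (rule ideal_pow_ideal[OF ideal_irrelevant])
  show ?thesis
  proof (rule left_stableI[OF I])
    show "s - real (D - 1) / real n > 0" using D(3) False by (simp add: field_simps)
    fix t assume t: "1 \<le> t" "s - (s - real (D - 1) / real n) < t" "t < s"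
    have gap: "real n * t > real (D - 1)" using t(2) False by (simp add: field_simps)
    show "weak_closure R p t ?I \<subseteq> weak_closure R p s ?I"
    proof
      fix x assume x: "x \<in> weak_closure R p t ?I"
      note xc = weak_closure_carr[OF x]
      obtain y z where yz: "x = y \<oplus> z" "y \<in> ideal_pow irrelevant D" "degree_le z (D - 1)"
        using low_high_decomposition[OF xc D(2)] .
      have y: "y \<in> weak_closure R p s ?I"
        using False D yz(2) s by (intro irrelevant_pow_subset_weak_closure) auto
      have yc: "y \<in> carrier R" and zc: "z \<in> carrier R"
        using weak_closure_carr[OF y] yz(3) by (auto simp: degree_le_def)
      have "y \<in> weak_closure R p t ?I" using weak_closure_antimono[OF I less_imp_le[OF t(3)]] y by blast
      then have "x \<oplus> \<ominus> y \<in> weak_closure R p t ?I" by (intro weak_closure_add weak_closure_neg I x)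
      moreover have "x \<oplus> \<ominus> y = z" using yz(1) yc zc by (simp add: a_comm[of y] a_assoc r_neg)
      ultimately have zt: "z \<in> weak_closure R p t ?I" by simp
      obtain c where c: "c \<in> carrier R" "\<forall>P\<in>minimal_primes R. c \<notin> P"
        and ev: "\<forall>\<^sub>F e in sequentially. c \<otimes> z [^] (p ^ e) \<in> mixed_power R t (p ^ e) ?I"
        using weak_closureD[OF zt] .
      obtain C where C: "degree_le c C" using degree_bound_exists[OF c(1)] by blast
      have "\<forall>\<^sub>F e in sequentially. real (p ^ e) > real C / (real n * t - real (D - 1))"
        by (rule eventually_prime_power_gt)
      with ev have "\<forall>\<^sub>F e in sequentially. c \<otimes> z [^] (p ^ e) \<in> mixed_power R s (p ^ e) ?I"
      proof eventually_elim
        case (elim e)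
        let ?q = "p ^ e" and ?w = "c \<otimes> z [^] (p ^ e)"
        \<comment> \<open>Elements of \<open>I\<^sup>\<lceil>\<^sup>t\<^sup>q\<^sup>\<rceil>\<close> have no components in degrees below \<open>N\<close>, while \<open>?w\<close> has none from \<open>N\<close> on.\<close>
        define N where "N = n * nat \<lceil>t * real ?q\<rceil>"
        have "real C < (real n * t - real (D - 1)) * real ?q"
          using elim(2) gap by (simp add: pos_divide_less_eq mult.commute)
        also have "\<dots> = real n * (t * real ?q) - real ((D - 1) * ?q)"
          by (simp only: of_nat_mult left_diff_distrib mult.assoc)
        also have "real n * (t * real ?q) \<le> real N"
          unfolding N_def of_nat_mult by (intro mult_left_mono) (use real_nat_ceiling_ge in auto)
        finally have "real (C + (D - 1) * ?q) < real N" by linarith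
        then have lt: "C + (D - 1) * ?q < N" by (simp only: of_nat_less_iff)
        have w: "degree_le ?w (C + (D - 1) * ?q)"
          by (intro degree_le_mult C degree_le_pow yz(3))
        obtain a b where ab: "?w = a \<oplus> b" and a: "a \<in> ideal_pow ?I (nat \<lceil>t * real ?q\<rceil>)"
          and b: "b \<in> frobenius_power R ?I ?q"
          using elim(1) by (auto simp: mixed_power_def mem_set_add_iff)
        have Ic: "?I \<subseteq> carrier R" using ideal_carr[OF I] by blast
        note F = frobenius_power_ideal[OF Ic, of ?q]
        have aN: "a \<in> ideal_pow irrelevant N"
          using a unfolding N_def by (simp only: ideal_pow_pow[OF ideal_irrelevant])
        then have ac: "a \<in> carrier R" "\<forall>g<N. component a g = \<zero>" by (simp_all add: irrelevant_pow_iff)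
        have bc: "b \<in> carrier R" using ideal_carr[OF F b] .
        have "?w \<in> frobenius_power R ?I ?q"
        proof (rule sum_of_homogeneous_in_closed_set)
          show "component ?w g \<in> frobenius_power R ?I ?q" for g
          proof (cases "g < N")
            case True
            then have "component ?w g = component b g"
              unfolding ab using ac bc component_carr[OF bc] by (simp add: component_add)
            then show ?thesis using component_frobenius_power[OF b] by simp
          next
            case False
            then have "component ?w g = \<zero>" using w lt by (simp add: degree_le_def)
            then show ?thesis using ideal_zero[OF F] by simp
          qed
          show "?w \<in> carrier R" using c zc by simp
        qed (use ideal_carr[OF F] ideal_zero[OF F] ideal_add[OF F] in blast)+
        then show ?case by (rule mem_mixed_powerI(2)[OF I])
      qed
      then have "z \<in> weak_closure R p s ?I" using c zc by (intro weak_closureI[OF I]) auto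
      then show "x \<in> weak_closure R p s ?I" unfolding yz(1) using y by (intro weak_closure_add[OF I])
    qed
  qed
qed

end

section \<open>Divisibility modulo a prime ideal\<close>

context cring
begin

text \<open>Divisibility and association in \<open>R / P\<close>, expressed on representatives so that homogeneous elements of
  \<open>R\<close> can be used directly.\<close>

definition divides_mod :: "'a set \<Rightarrow> 'a \<Rightarrow> 'a \<Rightarrow> bool" where
  "divides_mod P a b \<longleftrightarrow> a \<in> carrier R \<and> b \<in> carrier R \<and>
     (\<exists>u\<in>carrier R. \<exists>\<pi>\<in>P. b = u \<otimes> a \<oplus> \<pi>)"

definition assoc_mod :: "'a set \<Rightarrow> 'a \<Rightarrow> 'a \<Rightarrow> bool" where
  "assoc_mod P a b \<longleftrightarrow> divides_mod P a b \<and> divides_mod P b a"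

lemma divides_mod_carr: "divides_mod P a b \<Longrightarrow> a \<in> carrier R \<and> b \<in> carrier R"
  by (simp add: divides_mod_def)

lemma divides_mod_multiple:
  assumes "ideal P R" "a \<in> carrier R" "u \<in> carrier R" shows "divides_mod P a (u \<otimes> a)"
  unfolding divides_mod_def using assms ideal_zero[OF assms(1)]
  by (intro conjI bexI[of _ u] bexI[of _ \<zero>]) auto

lemma divides_mod_refl: "ideal P R \<Longrightarrow> a \<in> carrier R \<Longrightarrow> divides_mod P a a"
  using divides_mod_multiple[of P a \<one>] by simp

lemma divides_mod_mem:
  assumes "ideal P R" "ideal K R" "divides_mod P a b" "a \<in> K" shows "b \<in> K <+>\<^bsub>R\<^esub> P"
proof -
  obtain u \<pi> where "u \<in> carrier R" "\<pi> \<in> P" "b = u \<otimes> a \<oplus> \<pi>"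
    using assms(3) unfolding divides_mod_def by blast
  then show ?thesis using ideal_lmult[OF assms(2) _ assms(4)] unfolding mem_set_add_iff by blast
qed

lemma divides_mod_trans:
  assumes P: "ideal P R" and ab: "divides_mod P a b" and bc: "divides_mod P b c"
  shows "divides_mod P a c"
proof -
  obtain u \<pi> where u: "u \<in> carrier R" "\<pi> \<in> P" "b = u \<otimes> a \<oplus> \<pi>"
    using ab unfolding divides_mod_def by blast
  obtain v \<rho> where v: "v \<in> carrier R" "\<rho> \<in> P" "c = v \<otimes> b \<oplus> \<rho>"
    using bc unfolding divides_mod_def by blast
  have ac: "a \<in> carrier R" "c \<in> carrier R" using divides_mod_carr ab bc by auto
  have pc: "\<pi> \<in> carrier R" "\<rho> \<in> carrier R" using u v ideal_carr[OF P] by auto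
  have "c = (v \<otimes> u) \<otimes> a \<oplus> (v \<otimes> \<pi> \<oplus> \<rho>)"
    unfolding v(3) u(3) using u v ac pc by (simp add: r_distr m_assoc a_assoc)
  moreover have "v \<otimes> \<pi> \<oplus> \<rho> \<in> P" using u v ideal_add[OF P] ideal_lmult[OF P] by blast
  ultimately show ?thesis unfolding divides_mod_def using ac u v by blast
qed

lemma divides_mod_mult:
  assumes P: "ideal P R" and ab: "divides_mod P a b" and cd: "divides_mod P c d"
  shows "divides_mod P (a \<otimes> c) (b \<otimes> d)"
proof -
  obtain u \<pi> where u: "u \<in> carrier R" "\<pi> \<in> P" "b = u \<otimes> a \<oplus> \<pi>"
    using ab unfolding divides_mod_def by blast
  obtain v \<rho> where v: "v \<in> carrier R" "\<rho> \<in> P" "d = v \<otimes> c \<oplus> \<rho>"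
    using cd unfolding divides_mod_def by blast
  have ac: "a \<in> carrier R" "b \<in> carrier R" "c \<in> carrier R" "d \<in> carrier R"
    using divides_mod_carr ab cd by auto
  have pc: "\<pi> \<in> carrier R" "\<rho> \<in> carrier R" using u v ideal_carr[OF P] by auto
  have "b \<otimes> d = (u \<otimes> a) \<otimes> (v \<otimes> c) \<oplus> ((u \<otimes> a) \<otimes> \<rho> \<oplus> \<pi> \<otimes> d)"
  proof -
    have "b \<otimes> d = (u \<otimes> a) \<otimes> d \<oplus> \<pi> \<otimes> d" unfolding u(3) using u ac pc by (simp add: l_distr)
    also have "(u \<otimes> a) \<otimes> d = (u \<otimes> a) \<otimes> (v \<otimes> c) \<oplus> (u \<otimes> a) \<otimes> \<rho>"
      unfolding v(3) using u v ac pc by (simp add: r_distr)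
    finally show ?thesis using u v ac pc by (simp add: a_assoc)
  qed
  also have "(u \<otimes> a) \<otimes> (v \<otimes> c) = (u \<otimes> v) \<otimes> (a \<otimes> c)"
    using u v ac by (simp add: m_assoc m_lcomm)
  finally have "b \<otimes> d = (u \<otimes> v) \<otimes> (a \<otimes> c) \<oplus> ((u \<otimes> a) \<otimes> \<rho> \<oplus> \<pi> \<otimes> d)" .
  moreover have "(u \<otimes> a) \<otimes> \<rho> \<oplus> \<pi> \<otimes> d \<in> P"
    using u v ac by (intro ideal_add[OF P] ideal_lmult[OF P] ideal_rmult[OF P]) auto
  ultimately show ?thesis unfolding divides_mod_def using ac u v by blast
qed

lemma divides_mod_cancel:
  assumes P: "primeideal P R" and d: "divides_mod P (a \<otimes> c) (b \<otimes> c)"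
    and c: "c \<in> carrier R - P" and a: "a \<in> carrier R" and b: "b \<in> carrier R"
  shows "divides_mod P a b"
proof -
  note PI = prime_ideal[OF P]
  obtain u \<pi> where u: "u \<in> carrier R" "\<pi> \<in> P" "b \<otimes> c = u \<otimes> (a \<otimes> c) \<oplus> \<pi>"
    using d unfolding divides_mod_def by blast
  have pc: "\<pi> \<in> carrier R" using u ideal_carr[OF PI] by auto
  have "(b \<ominus> u \<otimes> a) \<otimes> c = b \<otimes> c \<ominus> u \<otimes> (a \<otimes> c)"
    using a b c u by (simp add: minus_eq l_distr l_minus m_assoc)
  also have "\<dots> = \<pi>" unfolding u(3) using a c u pc
    by (simp add: minus_eq a_comm[of "u \<otimes> (a \<otimes> c)"] a_assoc r_neg)
  finally have eq: "(b \<ominus> u \<otimes> a) \<otimes> c = \<pi>" .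
  have w: "b \<ominus> u \<otimes> a \<in> P"
  proof (rule ccontr)
    assume "b \<ominus> u \<otimes> a \<notin> P"
    then have "(b \<ominus> u \<otimes> a) \<otimes> c \<in> carrier R - P" using a b u c by (intro prime_mult[OF P]) auto
    then show False using eq u(2) by simp
  qed
  have "b = u \<otimes> a \<oplus> (b \<ominus> u \<otimes> a)"
    using a b u by (simp add: minus_eq a_lcomm r_neg)
  then show ?thesis unfolding divides_mod_def using a b u w by blast
qed

lemma divides_mod_pow:
  assumes "ideal P R" "divides_mod P a b" shows "divides_mod P (a [^] (n::nat)) (b [^] n)"
proof (induction n)
  case 0 then show ?case using divides_mod_refl[OF assms(1)] by simp
next
  case (Suc n) then show ?case using divides_mod_mult[OF assms(1) Suc assms(2)] by simp
qed

lemma assoc_mod_sym: "assoc_mod P a b \<Longrightarrow> assoc_mod P b a"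
  by (simp add: assoc_mod_def)

lemma assoc_mod_carr: "assoc_mod P a b \<Longrightarrow> a \<in> carrier R \<and> b \<in> carrier R"
  by (simp add: assoc_mod_def divides_mod_def)

lemma assoc_mod_refl: "ideal P R \<Longrightarrow> a \<in> carrier R \<Longrightarrow> assoc_mod P a a"
  by (simp add: assoc_mod_def divides_mod_refl)

lemma assoc_mod_trans: "ideal P R \<Longrightarrow> assoc_mod P a b \<Longrightarrow> assoc_mod P b c \<Longrightarrow> assoc_mod P a c"
  unfolding assoc_mod_def using divides_mod_trans by blast

lemma assoc_mod_mult:
  "ideal P R \<Longrightarrow> assoc_mod P a b \<Longrightarrow> assoc_mod P c d \<Longrightarrow> assoc_mod P (a \<otimes> c) (b \<otimes> d)"
  unfolding assoc_mod_def using divides_mod_mult by blast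

lemma assoc_mod_pow:
  "ideal P R \<Longrightarrow> assoc_mod P a b \<Longrightarrow> assoc_mod P (a [^] (n::nat)) (b [^] n)"
  unfolding assoc_mod_def using divides_mod_pow by blast

lemma assoc_mod_cancel:
  assumes P: "primeideal P R" and "assoc_mod P (a \<otimes> c) (b \<otimes> d)" and cd: "assoc_mod P c d"
    and c: "c \<in> carrier R - P" and ab: "a \<in> carrier R" "b \<in> carrier R"
  shows "assoc_mod P a b"
proof -
  note PI = prime_ideal[OF P]
  have "assoc_mod P (b \<otimes> d) (b \<otimes> c)"
    by (rule assoc_mod_mult[OF PI assoc_mod_refl[OF PI ab(2)] assoc_mod_sym[OF cd]])
  with assms(2) have "assoc_mod P (a \<otimes> c) (b \<otimes> c)" by (rule assoc_mod_trans[OF PI])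
  then show ?thesis using divides_mod_cancel[OF P _ c] ab unfolding assoc_mod_def by blast
qed

definition monomial :: "'a set \<Rightarrow> ('a \<Rightarrow> nat) \<Rightarrow> 'a" where
  "monomial J w = (\<Otimes>j\<in>J. j [^] w j)"

lemma monomial_closed: "J \<subseteq> carrier R \<Longrightarrow> monomial J w \<in> carrier R"
  unfolding monomial_def by (intro finprod_closed) auto

lemma monomial_cong: "J \<subseteq> carrier R \<Longrightarrow> (\<And>j. j \<in> J \<Longrightarrow> v j = w j) \<Longrightarrow> monomial J v = monomial J w"
  unfolding monomial_def by (intro finprod_cong') auto

lemma monomial_zero: "J \<subseteq> carrier R \<Longrightarrow> monomial J (\<lambda>_. 0) = \<one>"
  unfolding monomial_def by (simp add: finprod_one_eqI)

lemma monomial_add: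
  assumes "J \<subseteq> carrier R"
  shows "monomial J (\<lambda>j. v j + w j) = monomial J v \<otimes> monomial J w"
proof -
  have "monomial J (\<lambda>j. v j + w j) = (\<Otimes>j\<in>J. j [^] v j \<otimes> j [^] w j)"
    unfolding monomial_def using assms by (intro finprod_cong') (auto simp: nat_pow_mult)
  also have "\<dots> = monomial J v \<otimes> monomial J w"
    unfolding monomial_def using assms by (intro finprod_multf) auto
  finally show ?thesis .
qed

lemma monomial_scale:
  assumes "J \<subseteq> carrier R" shows "monomial J (\<lambda>j. m * a j) = monomial J a [^] (m::nat)"
proof (induction m)
  case 0 then show ?case using monomial_zero[OF assms] by simp
next
  case (Suc m)
  have "monomial J (\<lambda>j. Suc m * a j) = monomial J (\<lambda>j. m * a j + a j)"
    by (rule monomial_cong[OF assms]) simp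
  then show ?case using Suc monomial_add[OF assms, of "\<lambda>j. m * a j" a] by simp
qed

lemma monomial_single:
  assumes "finite J" "J \<subseteq> carrier R" "i \<in> J"
  shows "monomial J (\<lambda>j. if j = i then 1 else 0) = i"
proof -
  have "monomial J (\<lambda>j. if j = i then 1 else 0) = (\<Otimes>j\<in>J. if j = i then j else \<one>)"
    unfolding monomial_def using assms by (intro finprod_cong') auto
  also have "\<dots> = i" using assms by (intro finprod_singleton_swap) auto
  finally show ?thesis .
qed

lemma monomial_extend:
  assumes "finite J" "J \<subseteq> carrier R" "E \<subseteq> J"
  shows "monomial J (\<lambda>j. if j \<in> E then w j else 0) = monomial E w"
  unfolding monomial_def using assms by (intro finprod_mono_neutral_cong_right) auto

lemma monomial_notin_prime:
  assumes "primeideal P R" "J \<subseteq> carrier R - P" shows "monomial J w \<in> carrier R - P"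
  unfolding monomial_def using assms prime_pow[OF assms(1)] by (intro prime_finprod) auto

lemma monomial_mem_ideal_pow:
  assumes I: "ideal I R" and J: "finite J" "J \<subseteq> carrier R" and F: "F \<subseteq> J" "F \<subseteq> I"
  shows "monomial J w \<in> ideal_pow I (\<Sum>j\<in>F. w j)"
proof -
  have "monomial J (\<lambda>j. if j \<in> F then w j else 0) \<in> ideal_pow I (\<Sum>j\<in>F. w j)"
  proof -
    have fin: "finite F" using J(1) F(1) finite_subset by blast
    then have "F \<subseteq> J \<Longrightarrow> F \<subseteq> I \<Longrightarrow> monomial F w \<in> ideal_pow I (\<Sum>j\<in>F. w j)"
    proof (induction F)
      case empty then show ?case by (simp add: monomial_def one_ideals_set)
    next
      case (insert f F)
      have f: "f \<in> carrier R" using insert.prems J(2) by blast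
      have "f \<in> ideal_pow I 1" using insert.prems by (simp only: ideal_pow_1[OF I]) simp
      then have "f [^] w f \<in> ideal_pow I (w f)" using power_mem_ideal_pow[OF I, of f 1 "w f"] by simp
      moreover have "monomial F w \<in> ideal_pow I (\<Sum>j\<in>F. w j)" using insert by simp
      ultimately have "f [^] w f \<otimes> monomial F w \<in> ideal_pow I (w f + (\<Sum>j\<in>F. w j))"
        by (rule ideal_pow_mult[OF I])
      moreover have "monomial (insert f F) w = f [^] w f \<otimes> monomial F w"
        unfolding monomial_def using insert.hyps insert.prems J(2) f by (intro finprod_insert) auto
      ultimately show ?case using insert.hyps by simp
    qed
    then show ?thesis using F monomial_extend[OF J F(1)] by simp
  qed
  moreover have "monomial J w = monomial J (\<lambda>j. if j \<in> F then 0 else w j) \<otimes>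
      monomial J (\<lambda>j. if j \<in> F then w j else 0)"
  proof -
    have "monomial J w = monomial J (\<lambda>j. (if j \<in> F then 0 else w j) + (if j \<in> F then w j else 0))"
      by (rule monomial_cong[OF J(2)]) auto
    also have "\<dots> = monomial J (\<lambda>j. if j \<in> F then 0 else w j) \<otimes>
        monomial J (\<lambda>j. if j \<in> F then w j else 0)"
      by (rule monomial_add[OF J(2)])
    finally show ?thesis .
  qed
  ultimately show ?thesis
    using ideal_lmult[OF ideal_pow_ideal[OF I] monomial_closed[OF J(2)]] by simp
qed

lemma monomial_of_product_set:
  assumes J: "finite J" "J \<subseteq> carrier R" and P: "ideal P R" and H: "H \<subseteq> carrier R" and HJ: "H - P \<subseteq> J"
    and g: "g \<in> product_set H n" "g \<notin> P"
  shows "\<exists>w. g = monomial J w \<and> (\<Sum>j\<in>H - P. w j) = n"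
  using g
proof (induction n arbitrary: g)
  case 0
  then show ?case using monomial_zero[OF J(2)] by (intro exI[of _ "\<lambda>_. 0"]) simp
next
  case (Suc n)
  then obtain a h where ah: "g = a \<otimes> h" "a \<in> product_set H n" "h \<in> H" by auto
  have c: "a \<in> carrier R" "h \<in> carrier R" using ah product_set_carrier[OF H] H by auto
  have hP: "h \<in> H - P" using ah Suc.prems(2) ideal_lmult[OF P c(1)] by auto
  have "a \<notin> P" using ah Suc.prems(2) ideal_rmult[OF P c(2)] by auto
  then obtain w where w: "a = monomial J w" "(\<Sum>j\<in>H - P. w j) = n" using Suc.IH ah by blast
  have fin: "finite (H - P)" using HJ J(1) finite_subset by blast
  let ?w = "\<lambda>j. w j + (if j = h then 1 else 0)"
  have "monomial J ?w = g"
    using monomial_add[OF J(2), of w "\<lambda>j. if j = h then 1 else 0"] monomial_single[OF J, of h] hP HJ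
      ah w by auto
  moreover have "(\<Sum>j\<in>H - P. ?w j) = Suc n" using w(2) hP fin by (simp add: sum.distrib)
  ultimately show ?case by blast
qed

text \<open>Since \<open>R / P\<close> is a domain, differences of exponent vectors of associated monomials form a lattice of
  relations. A nonnegative relation exhibits every element occurring in it as a unit modulo \<open>P\<close>, so it
  involves no element of \<open>F\<close>.\<close>

theorem monomial_slopes:
  assumes P: "primeideal P R" and J: "finite J" "J \<subseteq> carrier R - P" and F: "F \<subseteq> J"
    and nonunit: "\<And>f. f \<in> F \<Longrightarrow> \<not> divides_mod P f \<one>"
  obtains K :: nat where "K \<ge> 1"
    and "\<forall>a m w. m \<ge> 1 \<longrightarrow> assoc_mod P (monomial J w) (monomial J a [^] m) \<longrightarrow>
      (\<exists>m' w'. m' \<ge> 1 \<and> assoc_mod P (monomial J w') (monomial J a [^] m') \<and>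
        (\<Sum>j\<in>F. w j) * m' \<le> (\<Sum>j\<in>F. w' j) * m \<and> m' dvd K * (\<Sum>j\<in>F. w' j))"
proof -
  note PI = prime_ideal[OF P]
  have Jc: "J \<subseteq> carrier R" using J(2) by blast
  define L where "L = {r :: 'a \<Rightarrow> int. \<exists>v w. (\<forall>j\<in>J. r j = int (v j) - int (w j)) \<and>
    assoc_mod P (monomial J v) (monomial J w)}"
  have LI: "r \<in> L" if "\<And>j. j \<in> J \<Longrightarrow> r j = int (v j) - int (w j)"
    "assoc_mod P (monomial J v) (monomial J w)" for r v w
    unfolding L_def using that by blast
  have rel: "assoc_mod P (monomial J u) (monomial J u')"
    if r: "r \<in> L" and uu: "\<And>j. j \<in> J \<Longrightarrow> r j = int (u j) - int (u' j)" for r u u'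
  proof -
    obtain v w where vw: "\<forall>j\<in>J. r j = int (v j) - int (w j)"
      "assoc_mod P (monomial J v) (monomial J w)" using r unfolding L_def by blast
    have "u j + w j = v j + u' j" if "j \<in> J" for j using vw(1) uu[OF that] that by fastforce
    then have "monomial J (\<lambda>j. u j + w j) = monomial J (\<lambda>j. u' j + v j)"
      by (intro monomial_cong[OF Jc]) (simp add: add.commute)
    then have eq: "monomial J u \<otimes> monomial J w = monomial J u' \<otimes> monomial J v"
      by (simp add: monomial_add[OF Jc])
    have "assoc_mod P (monomial J u \<otimes> monomial J w) (monomial J u' \<otimes> monomial J v)"
      unfolding eq by (intro assoc_mod_refl PI m_closed monomial_closed Jc)
    then show ?thesis
      by (rule assoc_mod_cancel[OF P _ assoc_mod_sym[OF vw(2)] monomial_notin_prime[OF P J(2)]])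
        (intro monomial_closed Jc)+
  qed
  interpret L: relation_lattice J L
  proof
    show "finite J" by (rule J(1))
    show "(\<lambda>_. 0) \<in> L"
      by (rule LI[of _ "\<lambda>_. 0" "\<lambda>_. 0"])
        (simp, rule assoc_mod_refl[OF PI monomial_closed[OF Jc]])
  next
    fix r r' assume "r \<in> L" "r' \<in> L"
    then obtain v w v' w' where "\<forall>j\<in>J. r j = int (v j) - int (w j)"
      "assoc_mod P (monomial J v) (monomial J w)" "\<forall>j\<in>J. r' j = int (v' j) - int (w' j)"
      "assoc_mod P (monomial J v') (monomial J w')" unfolding L_def by blast
    then show "(\<lambda>j. r j + r' j) \<in> L"
      by (intro LI[of _ "\<lambda>j. v j + v' j" "\<lambda>j. w j + w' j"])
        (auto simp: monomial_add[OF Jc] intro: assoc_mod_mult[OF PI])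
  next
    fix r assume "r \<in> L"
    then obtain v w where "\<forall>j\<in>J. r j = int (v j) - int (w j)"
      "assoc_mod P (monomial J v) (monomial J w)" unfolding L_def by blast
    then show "(\<lambda>j. - r j) \<in> L"
      by (intro LI[of _ w v]) (auto intro: assoc_mod_sym)
  next
    fix r r' assume r: "r \<in> L" and eq: "\<And>j. j \<in> J \<Longrightarrow> r' j = r j"
    then show "r' \<in> L" unfolding L_def by auto
  qed
  have pos: "(\<Sum>j\<in>F. r j) = 0" if r: "r \<in> L" and r0: "\<And>j. j \<in> J \<Longrightarrow> r j \<ge> 0" for r
  proof (rule sum.neutral, rule ballI, rule ccontr)
    fix f assume f: "f \<in> F" and "r f \<noteq> 0"
    then have fJ: "f \<in> J" and rf: "r f > 0" using F r0[of f] by auto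
    let ?v = "\<lambda>j. nat (r j)" and ?d = "\<lambda>j. if j = f then 1 else 0"
    have "assoc_mod P (monomial J ?v) (monomial J (\<lambda>_. 0))"
      by (rule rel[OF r]) (use r0 in auto)
    then have one: "divides_mod P (monomial J ?v) \<one>"
      by (simp add: monomial_zero[OF Jc] assoc_mod_def)
    have "monomial J ?v = monomial J (\<lambda>j. (?v j - ?d j) + ?d j)"
      by (rule monomial_cong[OF Jc]) (use rf in auto)
    also have "\<dots> = monomial J (\<lambda>j. ?v j - ?d j) \<otimes> f"
      using monomial_add[OF Jc] monomial_single[OF J(1) Jc fJ] by simp
    finally have "divides_mod P f (monomial J ?v)"
      using divides_mod_multiple[OF PI _ monomial_closed[OF Jc]] fJ Jc by auto
    then have "divides_mod P f \<one>" using one by (rule divides_mod_trans[OF PI])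
    then show False using nonunit[OF f] by blast
  qed
  define best where "best K \<longleftrightarrow> (\<forall>a m w. m \<ge> 1 \<longrightarrow> (\<lambda>j. int (w j) - int m * a j) \<in> L \<longrightarrow>
      (\<exists>m' w'. m' \<ge> 1 \<and> (\<lambda>j. int (w' j) - int m' * a j) \<in> L \<and>
        (\<Sum>j\<in>F. w j) * m' \<le> (\<Sum>j\<in>F. w' j) * m \<and> m' dvd K * (\<Sum>j\<in>F. w' j)))" for K :: nat
  have "\<exists>K. K \<ge> 1 \<and> best K"
  proof (rule L.bounded_denominator[OF F])
    show "(\<Sum>j\<in>F. r j) = 0" if "r \<in> L" "\<And>j. j \<in> J \<Longrightarrow> r j \<ge> 0" for r using that by (rule pos)
    fix K :: nat
    assume "K \<ge> 1" and slopes: "\<And>a m w. \<lbrakk>m \<ge> 1; (\<lambda>j. int (w j) - int m * a j) \<in> L\<rbrakk> \<Longrightarrow>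
      \<exists>m' w'. m' \<ge> 1 \<and> (\<lambda>j. int (w' j) - int m' * a j) \<in> L \<and>
        (\<Sum>j\<in>F. w j) * m' \<le> (\<Sum>j\<in>F. w' j) * m \<and> m' dvd K * (\<Sum>j\<in>F. w' j)"
    have "best K" unfolding best_def by (intro allI impI, rule slopes)
    with \<open>K \<ge> 1\<close> show "\<exists>K. K \<ge> 1 \<and> best K" by blast
  qed
  then obtain K where K: "K \<ge> 1" and best: "best K" by blast
  have "\<exists>m' w'. m' \<ge> 1 \<and> assoc_mod P (monomial J w') (monomial J a [^] m') \<and>
        (\<Sum>j\<in>F. w j) * m' \<le> (\<Sum>j\<in>F. w' j) * m \<and> m' dvd K * (\<Sum>j\<in>F. w' j)"
    if m: "m \<ge> 1" and as: "assoc_mod P (monomial J w) (monomial J a [^] m)" for a w and m :: nat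
  proof -
    have "(\<lambda>j. int (w j) - int m * int (a j)) \<in> L"
      by (rule LI[of _ w "\<lambda>j. m * a j"]) (use as in \<open>auto simp: monomial_scale[OF Jc]\<close>)
    with best[unfolded best_def, rule_format, of m w "\<lambda>j. int (a j)"] m obtain m' w' where *: "m' \<ge> 1" "(\<lambda>j. int (w' j) - int m' * int (a j)) \<in> L"
        "(\<Sum>j\<in>F. w j) * m' \<le> (\<Sum>j\<in>F. w' j) * m" "m' dvd K * (\<Sum>j\<in>F. w' j)" by blast
    have "assoc_mod P (monomial J w') (monomial J (\<lambda>j. m' * a j))"
      by (rule rel[OF *(2)]) simp
    then show ?thesis using * by (auto simp: monomial_scale[OF Jc])
  qed
  then have "\<forall>a m w. m \<ge> 1 \<longrightarrow> assoc_mod P (monomial J w) (monomial J a [^] m) \<longrightarrow>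
      (\<exists>m' w'. m' \<ge> 1 \<and> assoc_mod P (monomial J w') (monomial J a [^] m') \<and>
        (\<Sum>j\<in>F. w j) * m' \<le> (\<Sum>j\<in>F. w' j) * m \<and> m' dvd K * (\<Sum>j\<in>F. w' j))" by simp
  with K show thesis by (rule that)
qed

end

section \<open>Gaps in the slopes of homogeneous elements\<close>

context cring
begin

lemma ideal_pow_mod_ideal:
  assumes "ideal I R" "ideal P R" shows "ideal (ideal_pow I n <+>\<^bsub>R\<^esub> P) R"
  using assms by (intro add_ideals ideal_pow_ideal)

lemma ideal_pow_mod_mult:
  assumes I: "ideal I R" and P: "ideal P R"
    and a: "a \<in> ideal_pow I m <+>\<^bsub>R\<^esub> P" and b: "b \<in> ideal_pow I n <+>\<^bsub>R\<^esub> P"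
  shows "a \<otimes> b \<in> ideal_pow I (m + n) <+>\<^bsub>R\<^esub> P"
proof -
  note Ic = ideal_carr[OF ideal_pow_ideal[OF I]] and Pc = ideal_carr[OF P]
  obtain a' \<pi> where a': "a' \<in> ideal_pow I m" "\<pi> \<in> P" "a = a' \<oplus> \<pi>"
    using a unfolding mem_set_add_iff by blast
  obtain b' \<rho> where b': "b' \<in> ideal_pow I n" "\<rho> \<in> P" "b = b' \<oplus> \<rho>"
    using b unfolding mem_set_add_iff by blast
  have c: "a' \<in> carrier R" "b' \<in> carrier R" "\<pi> \<in> carrier R" "\<rho> \<in> carrier R"
    using a' b' Ic Pc by auto
  have "a \<otimes> b = a' \<otimes> b' \<oplus> (a' \<otimes> \<rho> \<oplus> \<pi> \<otimes> (b' \<oplus> \<rho>))"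
    unfolding a'(3) b'(3) using c by (simp add: l_distr r_distr a_assoc a_lcomm)
  moreover have "a' \<otimes> b' \<in> ideal_pow I (m + n)" using ideal_pow_mult[OF I a'(1) b'(1)] .
  moreover have "a' \<otimes> \<rho> \<oplus> \<pi> \<otimes> (b' \<oplus> \<rho>) \<in> P"
    using a' b' c by (intro ideal_add[OF P] ideal_lmult[OF P] ideal_rmult[OF P]) auto
  ultimately show ?thesis unfolding mem_set_add_iff by blast
qed

lemma ideal_pow_mod_pow:
  assumes I: "ideal I R" and P: "ideal P R" and a: "a \<in> ideal_pow I m <+>\<^bsub>R\<^esub> P"
  shows "a [^] (n::nat) \<in> ideal_pow I (m * n) <+>\<^bsub>R\<^esub> P"
proof (induction n)
  case 0
  have "\<one> \<in> ideal_pow I 0" by (simp only: ideal_pow_0) simp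
  then show ?case using mem_set_addI(1)[OF ideal_pow_ideal[OF I] P, of \<one> 0] by simp
next
  case (Suc n)
  show ?case using ideal_pow_mod_mult[OF I P Suc a] by (simp add: add.commute)
qed

lemma ideal_pow_mod_antimono:
  assumes "ideal I R" "m \<le> n" shows "ideal_pow I n <+>\<^bsub>R\<^esub> P \<subseteq> ideal_pow I m <+>\<^bsub>R\<^esub> P"
  using ideal_pow_antimono[OF assms] unfolding set_add_def' by blast

text \<open>If \<open>I\<close> generates the unit ideal of \<open>R / P\<close>, so does every power of \<open>I\<close>.\<close>

lemma unit_generator_mod_prime:
  assumes I: "ideal I R" and P: "ideal P R" and f: "f \<in> I" "divides_mod P f \<one>" and z: "z \<in> carrier R"
  shows "z \<in> ideal_pow I n <+>\<^bsub>R\<^esub> P"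
proof -
  have "f \<in> ideal_pow I 1" using f(1) by (simp only: ideal_pow_1[OF I])
  then have fn: "f [^] n \<in> ideal_pow I n" using power_mem_ideal_pow[OF I, of f 1 n] by simp
  have "divides_mod P (f [^] n) \<one>" using divides_mod_pow[OF P f(2), of n] by simp
  then have "\<one> \<in> ideal_pow I n <+>\<^bsub>R\<^esub> P"
    by (rule divides_mod_mem[OF P ideal_pow_ideal[OF I]]) (rule fn)
  from ideal_lmult[OF ideal_pow_mod_ideal[OF I P] z this] show ?thesis using z by simp
qed

text \<open>Write \<open>q = m j + i\<close> with \<open>i < m\<close>. The factor \<open>x\<^sup>m\<^sup>j\<close> supplies the exponent \<open>n j \<ge> s m j\<close>, and the missing part
  \<open>s i \<le> s m\<close> is supplied by a fixed power of \<open>f\<close>.\<close>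

lemma bounded_multiplier:
  fixes s :: real
  assumes I: "ideal I R" and P: "primeideal P R" and f: "f \<in> I" "f \<notin> P" and x: "x \<in> carrier R"
    and m: "m \<ge> 1" and xm: "x [^] m \<in> ideal_pow I n <+>\<^bsub>R\<^esub> P" and nm: "s * real m \<le> real n"
    and s: "s \<ge> 0"
  shows "\<exists>C\<in>carrier R - P. \<forall>q y. y \<in> carrier R \<longrightarrow>
    C \<otimes> (y \<otimes> x [^] q) \<in> ideal_pow I (nat \<lceil>s * real q\<rceil>) <+>\<^bsub>R\<^esub> P"
proof -
  note PI = prime_ideal[OF P]
  have fc: "f \<in> carrier R - P" using f ideal_carr[OF I] by blast
  define N where "N = nat \<lceil>s * real m\<rceil>"
  have "C1 \<otimes> (y \<otimes> x [^] q) \<in> ideal_pow I (nat \<lceil>s * real q\<rceil>) <+>\<^bsub>R\<^esub> P"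
    if C1: "C1 = f [^] N" and y: "y \<in> carrier R" for C1 y and q :: nat
  proof -
    let ?j = "q div m" and ?i = "q mod m"
    have q: "q = m * ?j + ?i" by simp
    have "f \<in> ideal_pow I 1" using f(1) by (simp only: ideal_pow_1[OF I])
    then have "C1 \<in> ideal_pow I N" using power_mem_ideal_pow[OF I, of f 1 N] by (simp add: C1)
    then have C1': "C1 \<in> ideal_pow I N <+>\<^bsub>R\<^esub> P"
      using mem_set_addI(1)[OF ideal_pow_ideal[OF I] PI] by blast
    have "(x [^] m) [^] ?j \<in> ideal_pow I (n * ?j) <+>\<^bsub>R\<^esub> P"
      by (rule ideal_pow_mod_pow[OF I PI xm])
    with C1' have "C1 \<otimes> (x [^] m) [^] ?j \<in> ideal_pow I (N + n * ?j) <+>\<^bsub>R\<^esub> P"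
      by (rule ideal_pow_mod_mult[OF I PI])
    moreover have "y \<otimes> x [^] ?i \<in> carrier R" using x y by simp
    ultimately have "(y \<otimes> x [^] ?i) \<otimes> (C1 \<otimes> (x [^] m) [^] ?j)
        \<in> ideal_pow I (N + n * ?j) <+>\<^bsub>R\<^esub> P"
      using ideal_lmult[OF ideal_pow_mod_ideal[OF I PI]] by blast
    also have "(y \<otimes> x [^] ?i) \<otimes> (C1 \<otimes> (x [^] m) [^] ?j) = C1 \<otimes> (y \<otimes> x [^] q)"
    proof -
      have "x [^] q = x [^] ?i \<otimes> (x [^] m) [^] ?j"
        using x by (simp add: nat_pow_pow nat_pow_mult)
      moreover have "C1 \<in> carrier R" using fc by (simp add: C1)
      ultimately show ?thesis using x y by (simp add: m_assoc m_lcomm)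
    qed
    finally have mem: "C1 \<otimes> (y \<otimes> x [^] q) \<in> ideal_pow I (N + n * ?j) <+>\<^bsub>R\<^esub> P" .
    have "real q \<le> real m * real ?j + real m"
    proof -
      have "q \<le> m * ?j + m" using mod_less_divisor[of m q] m q by linarith
      then have "real q \<le> real (m * ?j + m)" by (simp only: of_nat_le_iff)
      then show ?thesis by simp
    qed
    then have "s * real q \<le> s * (real m * real ?j + real m)" using s by (rule mult_left_mono)
    also have "\<dots> = (s * real m) * real ?j + s * real m" by (simp add: algebra_simps)
    also have "\<dots> \<le> real n * real ?j + real N"
      using nm unfolding N_def by (intro add_mono mult_right_mono) (auto intro: real_nat_ceiling_ge)
    also have "\<dots> = real (N + n * ?j)" by simp
    finally have "nat \<lceil>s * real q\<rceil> \<le> N + n * ?j"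
      by (simp only: nat_le_iff ceiling_le_iff of_int_of_nat_eq)
    then show ?thesis using ideal_pow_mod_antimono[OF I] mem by blast
  qed
  moreover have "f [^] N \<in> carrier R - P" by (rule prime_pow[OF P fc])
  ultimately show ?thesis by blast
qed

end

text \<open>Dickson's lemma provides infinitely many of the given exponents \<open>e\<close> along which the vectors increase.
  Dividing a late relation by the first one cancels \<open>y\<close> and leaves \<open>x\<^sup>m\<close> with \<open>m\<close> the difference of the two
  powers of \<open>p\<close>. The weight on \<open>F\<close> drops by the constant \<open>C0\<close> only, so a slope above \<open>\<kappa>\<close> remains if the
  second exponent is large enough.\<close>

lemma (in prime_char_ring) recurrence_of_exponents:
  fixes t \<kappa> :: real
  assumes P: "primeideal P R" and J: "finite J" "J \<subseteq> carrier R - P" and F: "F \<subseteq> J"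
    and x: "assoc_mod P x (monomial J a)" and y: "y \<in> carrier R"
    and T: "infinite T" and w: "\<And>e. e \<in> T \<Longrightarrow> \<exists>w. assoc_mod P (monomial J w) (y \<otimes> x [^] (p ^ e)) \<and>
      t * real (p ^ e) \<le> real (\<Sum>j\<in>F. w j)"
    and t: "\<kappa> < t"
  shows "\<exists>m w. m \<ge> 1 \<and> assoc_mod P (monomial J w) (monomial J a [^] m) \<and>
    \<kappa> * real m < real (\<Sum>j\<in>F. w j)"
proof -
  note PI = prime_ideal[OF P]
  have Jc: "J \<subseteq> carrier R" using J(2) by blast
  have xc: "x \<in> carrier R" using assoc_mod_carr[OF x] by blast
  have "\<forall>e\<in>T. \<exists>w. assoc_mod P (monomial J w) (y \<otimes> x [^] (p ^ e)) \<and>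
      t * real (p ^ e) \<le> real (\<Sum>j\<in>F. w j)" using w by blast
  then obtain W where "\<forall>e\<in>T. assoc_mod P (monomial J (W e)) (y \<otimes> x [^] (p ^ e)) \<and>
      t * real (p ^ e) \<le> real (\<Sum>j\<in>F. W e j)" by (rule bchoice[THEN exE])
  then have W: "\<And>e. e \<in> T \<Longrightarrow> assoc_mod P (monomial J (W e)) (y \<otimes> x [^] (p ^ e))"
    "\<And>e. e \<in> T \<Longrightarrow> t * real (p ^ e) \<le> real (\<Sum>j\<in>F. W e j)" by blast+
  obtain h :: "nat \<Rightarrow> nat" where h: "strict_mono h" "\<And>n. h n \<in> T"
    using infinite_enumerate[OF T] by blast
  obtain g :: "nat \<Rightarrow> nat" where g: "strict_mono g" "\<forall>j\<in>J. mono (\<lambda>n. W (h (g n)) j)"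
    using dickson_subsequence[OF J(1), of "\<lambda>n. W (h n)"] by blast
  define e where "e n = h (g n)" for n
  have e: "strict_mono e" "e n \<in> T" for n
    using h g(1) by (auto simp: e_def strict_mono_def)
  define q0 where "q0 = p ^ e 0"
  define C0 where "C0 = real (\<Sum>j\<in>F. W (e 0) j)"
  obtain N where N: "\<And>k. k \<ge> N \<Longrightarrow> real (p ^ k) > (C0 - \<kappa> * real q0) / (t - \<kappa>)"
    using eventually_prime_power_gt[of "(C0 - \<kappa> * real q0) / (t - \<kappa>)"]
    unfolding eventually_sequentially by blast
  define i where "i = max N 1"
  have "i \<le> e i" by (rule seq_suble[OF e(1)])
  then have eN: "e i \<ge> N" by (simp add: i_def)
  have e0i: "e 0 < e i" using e(1) by (simp add: strict_mono_def i_def)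
  define q1 where "q1 = p ^ e i"
  have q01: "q0 < q1" unfolding q0_def q1_def using e0i p_gt_1 by (rule power_strict_increasing)
  define m where "m = q1 - q0"
  define d where "d j = W (e i) j - W (e 0) j" for j
  have le: "W (e 0) j \<le> W (e i) j" if "j \<in> J" for j
    using g(2) that unfolding e_def mono_def by blast
  have "assoc_mod P (monomial J d \<otimes> monomial J (W (e 0))) (x [^] m \<otimes> (y \<otimes> x [^] q0))"
  proof -
    have "monomial J d \<otimes> monomial J (W (e 0)) = monomial J (\<lambda>j. d j + W (e 0) j)"
      by (simp add: monomial_add[OF Jc])
    also have "\<dots> = monomial J (W (e i))" using le by (intro monomial_cong[OF Jc]) (simp add: d_def)
    finally have 1: "monomial J d \<otimes> monomial J (W (e 0)) = monomial J (W (e i))" .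
    have "x [^] q1 = x [^] m \<otimes> x [^] q0" using xc q01 by (simp add: nat_pow_mult m_def)
    then have 2: "x [^] m \<otimes> (y \<otimes> x [^] q0) = y \<otimes> x [^] q1" using xc y by (simp add: m_lcomm)
    show ?thesis unfolding 1 2 unfolding q1_def by (rule W(1)[OF e(2)])
  qed
  then have "assoc_mod P (monomial J d) (x [^] m)"
  proof (rule assoc_mod_cancel[OF P])
    show "assoc_mod P (monomial J (W (e 0))) (y \<otimes> x [^] q0)" unfolding q0_def by (rule W(1)[OF e(2)])
    show "monomial J (W (e 0)) \<in> carrier R - P" by (rule monomial_notin_prime[OF P J(2)])
  qed (use xc monomial_closed[OF Jc] in auto)
  then have as: "assoc_mod P (monomial J d) (monomial J a [^] m)"
    using assoc_mod_trans[OF PI] assoc_mod_pow[OF PI x] by blast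
  have "real (\<Sum>j\<in>F. d j) = real (\<Sum>j\<in>F. W (e i) j) - C0"
  proof -
    have "(\<Sum>j\<in>F. d j) + (\<Sum>j\<in>F. W (e 0) j) = (\<Sum>j\<in>F. W (e i) j)"
      unfolding sum.distrib[symmetric] using le F by (intro sum.cong) (auto simp: d_def)
    then show ?thesis unfolding C0_def by (metis add_diff_cancel_right' of_nat_add)
  qed
  moreover have "t * real q1 \<le> real (\<Sum>j\<in>F. W (e i) j)" unfolding q1_def by (rule W(2)[OF e(2)])
  moreover have "C0 - \<kappa> * real q0 < (t - \<kappa>) * real q1"
    using N[OF eN] t unfolding q1_def by (simp add: pos_divide_less_eq mult.commute)
  moreover have "\<kappa> * real m = \<kappa> * real q1 - \<kappa> * real q0"
    using q01 by (simp add: m_def of_nat_diff right_diff_distrib)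
  ultimately have "\<kappa> * real m < real (\<Sum>j\<in>F. d j)" unfolding left_diff_distrib by linarith
  moreover have "m \<ge> 1" using q01 by (simp add: m_def)
  ultimately show ?thesis using as by blast
qed

text \<open>Pieces are allowed to be zero, so that a monoid algebra \<open>k[S]\<close> can be graded by a monoid containing \<open>S\<close>.\<close>

locale thin_graded_ring =
  graded_ring R \<A> + finite_minimal_primes_ring R p
  for R (structure) and \<A> :: "'g :: monoid_add \<Rightarrow> 'a set" and p +
  assumes thin: "\<lbrakk>x \<in> \<A> g; y \<in> \<A> g; y \<noteq> \<zero>\<rbrakk> \<Longrightarrow> \<exists>u\<in>\<A> 0. x = u \<otimes> y"
begin

abbreviation homogeneous :: "'a set" where "homogeneous \<equiv> (\<Union>g. \<A> g)"

lemma homogeneous_carr: "x \<in> homogeneous \<Longrightarrow> x \<in> carrier R"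
  using piece_carr by blast

lemma homogeneous_mult:
  assumes "x \<in> homogeneous" "y \<in> homogeneous" shows "x \<otimes> y \<in> homogeneous"
proof -
  obtain g h where "x \<in> \<A> g" "y \<in> \<A> h" using assms by blast
  then show ?thesis using mult_piece by blast
qed

text \<open>The components of \<open>z\<close> are sums of homogeneous multiples of generators. In a thin piece a sum of two
  elements, the first of them nonzero, is a multiple of the first, so one generator suffices.\<close>

lemma homogeneous_multiple_of_generator:
  assumes G: "G \<subseteq> homogeneous" and z: "z \<in> homogeneous" "z \<noteq> \<zero>" "z \<in> Idl G"
  shows "\<exists>g\<in>G. \<exists>r\<in>homogeneous. z = r \<otimes> g"
proof -
  define W where "W k = {w \<in> \<A> k. w = \<zero> \<or> (\<exists>g\<in>G. \<exists>r\<in>homogeneous. w = r \<otimes> g)}" for k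
  have Gc: "G \<subseteq> carrier R" using G homogeneous_carr by blast
  have I: "ideal {x \<in> carrier R. \<forall>g. component x g \<in> W g} R"
  proof (rule componentwise_ideal)
    show "W g \<subseteq> \<A> g" for g by (auto simp: W_def)
    show "\<zero> \<in> W g" for g using piece_zero by (simp add: W_def)
    show "x \<oplus> y \<in> W k" if x: "x \<in> W k" and y: "y \<in> W k" for x y k
    proof (cases "x = \<zero>")
      case True
      have "y \<in> carrier R" using y piece_carr by (auto simp: W_def)
      then show ?thesis using True y by simp
    next
      case False
      then obtain g r where gr: "g \<in> G" "r \<in> homogeneous" "x = r \<otimes> g" using x by (auto simp: W_def)
      have A: "x \<oplus> y \<in> \<A> k" "x \<in> \<A> k" using x y piece_add by (auto simp: W_def)
      obtain u where u: "u \<in> \<A> 0" "x \<oplus> y = u \<otimes> x" using thin[OF A False] by blast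
      have "u \<otimes> x = (u \<otimes> r) \<otimes> g"
        using gr u piece_carr Gc homogeneous_carr[OF gr(2)] by (auto simp: m_assoc)
      moreover have "u \<otimes> r \<in> homogeneous" using u gr(2) by (intro homogeneous_mult) auto
      ultimately show ?thesis using A(1) u(2) gr(1) by (auto simp: W_def)
    qed
    show "a \<otimes> w \<in> W (h + k)" if a: "a \<in> \<A> h" and w: "w \<in> W k" for a w h k
    proof (cases "w = \<zero>")
      case True
      then show ?thesis using piece_carr[OF a] piece_zero by (simp add: W_def)
    next
      case False
      then obtain g r where gr: "g \<in> G" "r \<in> homogeneous" "w = r \<otimes> g" using w by (auto simp: W_def)
      have "a \<otimes> w = (a \<otimes> r) \<otimes> g"
        using gr piece_carr[OF a] Gc homogeneous_carr[OF gr(2)] by (auto simp: m_assoc)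
      moreover have "a \<otimes> r \<in> homogeneous" using a gr(2) by (intro homogeneous_mult) auto
      moreover have "a \<otimes> w \<in> \<A> (h + k)" using a w by (intro mult_piece) (auto simp: W_def)
      ultimately show ?thesis using gr(1) by (auto simp: W_def)
    qed
  qed
  have "G \<subseteq> {x \<in> carrier R. \<forall>g. component x g \<in> W g}"
  proof
    fix g assume g: "g \<in> G"
    then obtain k where k: "g \<in> \<A> k" using G by blast
    have "g \<in> W k"
      unfolding W_def using k g one_piece piece_carr[OF k]
      by (intro CollectI conjI disjI2 bexI[of _ g] bexI[of _ \<one>]) auto
    then show "g \<in> {x \<in> carrier R. \<forall>g. component x g \<in> W g}"
      using piece_carr[OF k] piece_zero by (auto simp: component_homogeneous[OF k] W_def)
  qed
  then have mem: "z \<in> {x \<in> carrier R. \<forall>g. component x g \<in> W g}" using genideal_mem[OF I _ z(3)] by blast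
  obtain k where k: "z \<in> \<A> k" using z(1) by blast
  have "component z k \<in> W k" using mem by blast
  then have "z \<in> W k" by (simp add: component_homogeneous[OF k])
  then show ?thesis using z(2) by (auto simp: W_def)
qed

text \<open>The exponent \<open>\<kappa>\<close> must not depend on \<open>x\<close> and \<open>y\<close>; it comes from the common denominator \<open>K\<close> of the slopes of
  monomials modulo \<open>P\<close>. The multiplier \<open>C\<close> may depend on \<open>x\<close> and \<open>y\<close>, but not on \<open>e\<close>. If the premise holds for
  finitely many \<open>e\<close> only, there is nothing to prove; otherwise these \<open>e\<close> are used to find a power of
  \<open>x\<close> with slope above \<open>\<kappa>\<close>, hence with one that is at least \<open>s\<close>.\<close>

theorem slope_gap:
  fixes s :: real
  assumes P: "primeideal P R" and F0: "finite F0" "F0 \<subseteq> homogeneous" and nsub: "\<not> Idl F0 \<subseteq> P"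
    and E: "finite E" "E \<subseteq> carrier R - P"
      "\<And>a. a \<in> homogeneous - P \<Longrightarrow> \<exists>w. assoc_mod P a (monomial E w)"
    and s: "s > 0"
  shows "\<exists>\<kappa><s. \<forall>t>\<kappa>. \<forall>x\<in>homogeneous. \<forall>y\<in>homogeneous. \<exists>C\<in>carrier R - P.
    \<forall>\<^sub>F e in sequentially. y \<otimes> x [^] (p ^ e) \<in> ideal_pow (Idl F0) (nat \<lceil>t * real (p ^ e)\<rceil>) \<longrightarrow>
      C \<otimes> (y \<otimes> x [^] (p ^ e)) \<in> ideal_pow (Idl F0) (nat \<lceil>s * real (p ^ e)\<rceil>) <+>\<^bsub>R\<^esub> P"
proof -
  let ?I = "Idl F0"
  note PI = prime_ideal[OF P]
  have F0c: "F0 \<subseteq> carrier R" using F0(2) homogeneous_carr by blast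
  have I: "ideal ?I R" by (rule genideal_ideal[OF F0c])
  have oneP: "\<one> \<in> carrier R - P" using prime_one[OF P] by simp
  define F where "F = F0 - P"
  have FI: "F \<subseteq> ?I" using genideal_self[OF F0c] by (auto simp: F_def)
  show ?thesis
  proof (cases "\<exists>f\<in>F. divides_mod P f \<one>")
    case True
    then obtain f where f: "f \<in> ?I" "divides_mod P f \<one>" using FI by blast
    show ?thesis
    proof (intro exI[of _ 0] conjI allI ballI impI)
      show "0 < s" by (rule s)
      fix t :: real and x y assume xy: "x \<in> homogeneous" "y \<in> homogeneous"
      have "\<one> \<otimes> (y \<otimes> x [^] (p ^ e)) \<in> ideal_pow ?I (nat \<lceil>s * real (p ^ e)\<rceil>) <+>\<^bsub>R\<^esub> P" for e
        using homogeneous_carr[OF xy(1)] homogeneous_carr[OF xy(2)]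
        by (intro unit_generator_mod_prime[OF I PI f]) auto
      then show "\<exists>C\<in>carrier R - P. \<forall>\<^sub>F e in sequentially.
          y \<otimes> x [^] (p ^ e) \<in> ideal_pow ?I (nat \<lceil>t * real (p ^ e)\<rceil>) \<longrightarrow>
          C \<otimes> (y \<otimes> x [^] (p ^ e)) \<in> ideal_pow ?I (nat \<lceil>s * real (p ^ e)\<rceil>) <+>\<^bsub>R\<^esub> P"
        by (intro bexI[OF _ oneP] always_eventually allI impI)
    qed
  next
    case False
    define J where "J = E \<union> F"
    have J: "finite J" "J \<subseteq> carrier R - P" using E F0(1) F0c by (auto simp: J_def F_def)
    have Jc: "J \<subseteq> carrier R" using J(2) by blast
    have FJ: "F \<subseteq> J" by (simp add: J_def)
    have repr: "\<exists>w. assoc_mod P a (monomial J w)" if "a \<in> homogeneous - P" for a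
      using E(3)[OF that] monomial_extend[OF J(1) Jc, of E] by (metis J_def Un_upper1)
    obtain K where K: "(K::nat) \<ge> 1" and slopes:
      "\<forall>a m w. m \<ge> 1 \<longrightarrow> assoc_mod P (monomial J w) (monomial J a [^] m) \<longrightarrow>
        (\<exists>m' w'. m' \<ge> 1 \<and> assoc_mod P (monomial J w') (monomial J a [^] m') \<and>
          (\<Sum>j\<in>F. w j) * m' \<le> (\<Sum>j\<in>F. w' j) * m \<and> m' dvd K * (\<Sum>j\<in>F. w' j))"
      by (rule monomial_slopes[OF P J FJ]) (use False in blast)+
    obtain f where f: "f \<in> F"
    proof -
      have "\<not> F0 \<subseteq> P" using nsub genideal_minimal[OF PI] by blast
      then show thesis using that by (auto simp: F_def)
    qed
    have fI: "f \<in> ?I" "f \<notin> P" using f FI by (auto simp: F_def)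
    \<comment> \<open>The largest multiple of \<open>1 / K\<close> below \<open>s\<close>, so that a multiple of \<open>1 / K\<close> above it is at least \<open>s\<close>.\<close>
    define \<kappa> where "\<kappa> = (of_int \<lceil>real K * s\<rceil> - 1) / real K"
    have "of_int \<lceil>real K * s\<rceil> - 1 < real K * s" by linarith
    then have \<kappa>s: "\<kappa> < s" using K by (simp add: \<kappa>_def pos_divide_less_eq mult.commute)
    have Ks: "real K * s > 0" using K s by simp
    then have "1 \<le> \<lceil>real K * s\<rceil>" by linarith
    then have \<kappa>0: "\<kappa> \<ge> 0" by (simp add: \<kappa>_def)
    show ?thesis
    proof (intro exI[of _ \<kappa>] conjI allI ballI impI \<kappa>s)
      fix t x y assume t: "\<kappa> < t" and x: "x \<in> homogeneous" and y: "y \<in> homogeneous"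
      have xc: "x \<in> carrier R" and yc: "y \<in> carrier R" using x y homogeneous_carr by blast+
      let ?A = "\<lambda>e. y \<otimes> x [^] (p ^ e) \<in> ideal_pow ?I (nat \<lceil>t * real (p ^ e)\<rceil>)"
      let ?B = "\<lambda>C e. C \<otimes> (y \<otimes> x [^] (p ^ e)) \<in> ideal_pow ?I (nat \<lceil>s * real (p ^ e)\<rceil>) <+>\<^bsub>R\<^esub> P"
      consider "x \<in> P \<or> y \<in> P" | "finite {e. ?A e}" | "x \<notin> P" "y \<notin> P" "infinite {e. ?A e}" by blast
      then show "\<exists>C\<in>carrier R - P. \<forall>\<^sub>F e in sequentially. ?A e \<longrightarrow> ?B C e"
      proof cases
        case 1
        have "?B \<one> e" for e
        proof -
          have "y \<otimes> x [^] (p ^ e) \<in> P"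
          proof (rule ccontr)
            assume n: "y \<otimes> x [^] (p ^ e) \<notin> P"
            have "p ^ e = Suc (p ^ e - 1)" using p_gt_1 by simp
            then have "x [^] (p ^ e) = x [^] (p ^ e - 1) \<otimes> x" using nat_pow_Suc by metis
            then have "x [^] (p ^ e) \<in> P" if "x \<in> P" using that xc ideal_lmult[OF PI] by simp
            with 1 show False using n xc yc ideal_lmult[OF PI] ideal_rmult[OF PI] by auto
          qed
          then show ?thesis
            using xc yc mem_set_addI(2)[OF ideal_pow_ideal[OF I] PI] by simp
        qed
        then show ?thesis by (intro bexI[OF _ oneP] always_eventually allI impI)
      next
        case 2
        then obtain n where "\<forall>e\<in>{e. ?A e}. e < n" using finite_nat_set_iff_bounded by blast
        then have "\<not> ?A e" if "e \<ge> n" for e using that by force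
        then have "\<forall>\<^sub>F e in sequentially. ?A e \<longrightarrow> ?B \<one> e"
          by (intro eventually_sequentiallyI[of n]) blast
        then show ?thesis using oneP by (rule bexI)
      next
        case 3
        obtain a where a: "assoc_mod P x (monomial J a)" using repr x 3(1) by blast
        have "\<exists>w. assoc_mod P (monomial J w) (y \<otimes> x [^] (p ^ e)) \<and>
            t * real (p ^ e) \<le> real (\<Sum>j\<in>F. w j)" if "e \<in> {e. ?A e}" for e
        proof -
          define n where "n = nat \<lceil>t * real (p ^ e)\<rceil>"
          have mem: "y \<otimes> x [^] (p ^ e) \<in> Idl (product_set F0 n)"
            using that unfolding n_def by (simp add: ideal_pow_genideal[OF F0c])
          obtain g where "x \<in> \<A> g" using x by blast
          then obtain g' where "x [^] (p ^ e) \<in> \<A> g'" using homogeneous_pow by blast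
          then have hom: "y \<otimes> x [^] (p ^ e) \<in> homogeneous" using y by (intro homogeneous_mult) auto
          have xP: "x \<in> carrier R - P" and yP: "y \<in> carrier R - P" using xc yc 3 by auto
          have nP: "y \<otimes> x [^] (p ^ e) \<in> carrier R - P"
            by (rule prime_mult[OF P yP prime_pow[OF P xP]])
          then have nz: "y \<otimes> x [^] (p ^ e) \<noteq> \<zero>" using ideal_zero[OF PI] by auto
          obtain b r where br: "b \<in> product_set F0 n" "r \<in> homogeneous" "y \<otimes> x [^] (p ^ e) = r \<otimes> b"
            using homogeneous_multiple_of_generator[OF homogeneous_product_set[OF F0(2)] hom nz mem] by blast
          have bc: "b \<in> carrier R" using br(1) product_set_carrier[OF F0c] by blast
          have rc: "r \<in> carrier R" using homogeneous_carr[OF br(2)] .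
          have "r \<otimes> b \<notin> P" using nP br(3) by simp
          then have "b \<notin> P" "r \<notin> P" using ideal_lmult[OF PI rc] ideal_rmult[OF PI bc] by auto
          then obtain w where w: "b = monomial J w" "(\<Sum>j\<in>F0 - P. w j) = n"
            using monomial_of_product_set[OF J(1) Jc PI F0c _ br(1)] FJ by (auto simp: F_def)
          obtain v where v: "assoc_mod P r (monomial J v)" using repr br(2) \<open>r \<notin> P\<close> by blast
          have "assoc_mod P (monomial J (\<lambda>j. v j + w j)) (y \<otimes> x [^] (p ^ e))"
            unfolding br(3) monomial_add[OF Jc] using w(1) v bc
            by (intro assoc_mod_mult[OF PI] assoc_mod_sym[OF v]) (auto intro: assoc_mod_refl[OF PI])
          moreover have "t * real (p ^ e) \<le> real (\<Sum>j\<in>F. v j + w j)"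
          proof -
            have "t * real (p ^ e) \<le> real n" unfolding n_def by (rule real_nat_ceiling_ge)
            also have "n \<le> (\<Sum>j\<in>F. v j + w j)" using w(2) by (simp add: F_def sum.distrib)
            finally show ?thesis by simp
          qed
          ultimately show ?thesis by blast
        qed
        from recurrence_of_exponents[OF P J FJ a yc 3(3) this t]
        obtain m w where mw: "m \<ge> 1" "assoc_mod P (monomial J w) (monomial J a [^] m)"
          "\<kappa> * real m < real (\<Sum>j\<in>F. w j)" by blast
        obtain m' w' where mw': "m' \<ge> 1" "assoc_mod P (monomial J w') (monomial J a [^] m')"
          "(\<Sum>j\<in>F. w j) * m' \<le> (\<Sum>j\<in>F. w' j) * m" "m' dvd K * (\<Sum>j\<in>F. w' j)"
          using slopes mw(1,2) by blast
        define n' where "n' = (\<Sum>j\<in>F. w' j)"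
        have n's: "s * real m' \<le> real n'"
        proof -
          obtain k where k: "K * n' = m' * k" using mw'(4) unfolding n'_def by blast
          have "real m * (\<kappa> * real m') = (\<kappa> * real m) * real m'" by simp
          also have "\<dots> < real (\<Sum>j\<in>F. w j) * real m'" using mw(3) mw'(1) by simp
          also have "\<dots> \<le> real n' * real m"
            using mw'(3) unfolding n'_def by (simp only: of_nat_mult[symmetric] of_nat_le_iff)
          finally have "\<kappa> * real m' < real n'" using mw(1) by (simp add: mult.commute)
          then have "real K * (\<kappa> * real m') < real K * real n'" using K by simp
          also have "real K * real n' = real m' * real k"
            using k by (simp only: of_nat_mult[symmetric])
          finally have "real K * \<kappa> < real k" using mw'(1) by (simp add: mult.commute mult.left_commute)
          then have "of_int \<lceil>real K * s\<rceil> - 1 < real k" using K by (simp add: \<kappa>_def)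
          then have "\<lceil>real K * s\<rceil> \<le> int k" by linarith
          then have "real K * s \<le> real k" by (simp add: ceiling_le_iff)
          then have "real m' * (real K * s) \<le> real m' * real k" by (simp add: mult_left_mono)
          also have "\<dots> = real K * real n'" using k by (simp only: of_nat_mult[symmetric])
          finally have "real K * (s * real m') \<le> real K * real n'" by (simp add: mult_ac)
          then show ?thesis using K by simp
        qed
        have "monomial J w' \<in> ideal_pow ?I n'"
          unfolding n'_def by (rule monomial_mem_ideal_pow[OF I J(1) Jc FJ FI])
        moreover have "divides_mod P (monomial J w') (x [^] m')"
          using assoc_mod_trans[OF PI mw'(2) assoc_mod_sym[OF assoc_mod_pow[OF PI a]]]
          by (simp add: assoc_mod_def)
        ultimately have "x [^] m' \<in> ideal_pow ?I n' <+>\<^bsub>R\<^esub> P"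
          by (intro divides_mod_mem[OF PI ideal_pow_ideal[OF I]])
        from bounded_multiplier[OF I P fI xc mw'(1) this n's less_imp_le[OF s]]
        obtain C where C: "C \<in> carrier R - P" "\<forall>q y. y \<in> carrier R \<longrightarrow>
            C \<otimes> (y \<otimes> x [^] q) \<in> ideal_pow ?I (nat \<lceil>s * real q\<rceil>) <+>\<^bsub>R\<^esub> P" by blast
        show ?thesis
          by (intro bexI[OF _ C(1)] always_eventually allI impI) (rule C(2)[rule_format, OF yc])
      qed
    qed
  qed
qed

text \<open>If the component of the first summand is nonzero, then \<open>z\<close> is a multiple of it.\<close>

lemma homogeneous_mem_sum:
  assumes z: "z \<in> \<A> k" and H: "H \<subseteq> homogeneous" "H' \<subseteq> homogeneous"
    and mem: "z \<in> Idl H <+>\<^bsub>R\<^esub> Idl H'"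
  shows "z \<in> Idl H \<or> z \<in> Idl H'"
proof -
  have c: "H \<subseteq> carrier R" "H' \<subseteq> carrier R" using H homogeneous_carr by blast+
  obtain a b where ab: "a \<in> Idl H" "b \<in> Idl H'" "z = a \<oplus> b" using mem unfolding mem_set_add_iff by blast
  have carr: "a \<in> carrier R" "b \<in> carrier R"
    using ab ideal_carr[OF genideal_ideal[OF c(1)]] ideal_carr[OF genideal_ideal[OF c(2)]] by blast+
  have za: "z = component a k \<oplus> component b k"
    using component_homogeneous[OF z, of k] component_add[OF carr] ab(3) by simp
  have a': "component a k \<in> Idl H" and b': "component b k \<in> Idl H'"
    using component_genideal H ab by blast+
  show ?thesis
  proof (cases "component a k = \<zero>")
    case True
    then show ?thesis using za b' component_carr[OF carr(2)] by simp
  next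
    case False
    obtain u where u: "u \<in> \<A> 0" "z = u \<otimes> component a k"
      using thin[OF z component_mem[OF carr(1)] False] by blast
    then show ?thesis using ideal_lmult[OF genideal_ideal[OF c(1)] piece_carr[OF u(1)] a'] by simp
  qed
qed

text \<open>The \<open>q\<close>-th power of \<open>x\<close> is the sum of the \<open>q\<close>-th powers of its components. Several pairs of degrees may
  contribute to the same degree, as the grading monoid need not be cancellative, and their
  contributions may cancel; but if the component does not vanish, one of the contributions does not
  vanish either, and thinness makes the two multiples of each other.\<close>

lemma product_component_support:
  assumes c: "c \<in> carrier R" and x: "x \<in> carrier R" and nz: "component (c \<otimes> x [^] (p ^ e)) k \<noteq> \<zero>"
  shows "\<exists>h\<in>{h. component c h \<noteq> \<zero>}. \<exists>g\<in>{g. component x g \<noteq> \<zero>}.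
    component c h \<otimes> component x g [^] (p ^ e) \<in> \<A> k \<and> component c h \<otimes> component x g [^] (p ^ e) \<noteq> \<zero>"
proof -
  let ?Sc = "{h. component c h \<noteq> \<zero>}" and ?Sx = "{g. component x g \<noteq> \<zero>}"
  let ?T = "{v \<in> carrier R. \<forall>k. component v k \<noteq> \<zero> \<longrightarrow> (\<exists>h\<in>?Sc. \<exists>g\<in>?Sx.
    component c h \<otimes> component x g [^] (p ^ e) \<in> \<A> k \<and> component c h \<otimes> component x g [^] (p ^ e) \<noteq> \<zero>)}"
  have T1: "?T \<subseteq> carrier R" by blast
  have T2: "\<zero> \<in> ?T" by (simp add: component_zero)
  have T3: "v \<oplus> w \<in> ?T" if v: "v \<in> ?T" and w: "w \<in> ?T" for v w
  proof -
    have vw: "v \<in> carrier R" "w \<in> carrier R" using v w by auto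
    have "component v k \<noteq> \<zero> \<or> component w k \<noteq> \<zero>" if "component (v \<oplus> w) k \<noteq> \<zero>" for k
      using that component_add[OF vw] by auto
    then show ?thesis using v w vw by blast
  qed
  have cc: "component c h \<in> carrier R" for h using component_carr[OF c] .
  have xc: "component x g \<in> carrier R" for g using component_carr[OF x] .
  have base: "component c h \<otimes> component x g [^] (p ^ e) \<in> ?T" if h: "h \<in> ?Sc" and g: "g \<in> ?Sx" for h g
  proof -
    obtain g' where "component x g [^] (p ^ e) \<in> \<A> g'"
      using homogeneous_pow[OF component_mem[OF x]] by blast
    then have A: "component c h \<otimes> component x g [^] (p ^ e) \<in> \<A> (h + g')"
      using component_mem[OF c] by (intro mult_piece)
    then show ?thesis
      using h g piece_carr[OF A] by (auto simp: component_homogeneous[OF A])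
  qed
  have "x [^] (p ^ e) = (\<Oplus>g\<in>?Sx. component x g [^] (p ^ e))"
    using frobenius_finsum[of "component x" ?Sx e] component_sum[OF x] xc by auto
  then have "c \<otimes> x [^] (p ^ e) = (\<Oplus>g\<in>?Sx. c \<otimes> component x g [^] (p ^ e))"
    using c xc finite_support[OF x] by (simp add: finsum_rdistr)
  also have "\<dots> \<in> ?T"
  proof (rule finsum_in_closed_set[OF T1 T2 T3])
    fix g assume g: "g \<in> ?Sx"
    have "(\<Oplus>h\<in>?Sc. component c h) \<otimes> component x g [^] (p ^ e)
        = (\<Oplus>h\<in>?Sc. component c h \<otimes> component x g [^] (p ^ e))"
      using cc xc finite_support[OF c] by (intro finsum_ldistr) auto
    also have "\<dots> \<in> ?T" by (rule finsum_in_closed_set[OF T1 T2 T3 base[OF _ g]])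
    finally show "c \<otimes> component x g [^] (p ^ e) \<in> ?T" using component_sum[OF c] by simp
  qed
  finally show ?thesis using nz by blast
qed

text \<open>The closures need not be homogeneous, so the argument is applied to the components of \<open>c x\<^sup>q\<close> and not to
  those of \<open>x\<close>. Such a component lies in \<open>I\<^sup>[\<^sup>q\<^sup>]\<close>, which is fine for every exponent, or in \<open>I\<^sup>\<lceil>\<^sup>t\<^sup>q\<^sup>\<rceil>\<close>, and
  then so does the product of components of \<open>c\<close> and \<open>x\<^sup>q\<close> that it is a multiple of. The gap lemma
  applies to these products. They belong to finitely many pairs of degrees, so the product of their
  multipliers serves all of them.\<close>

theorem left_stable_homogeneous:
  assumes F0: "finite F0" "F0 \<subseteq> homogeneous"
    and nsub: "\<And>P. P \<in> minimal_primes R \<Longrightarrow> \<not> Idl F0 \<subseteq> P"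
    and E: "\<And>P. P \<in> minimal_primes R \<Longrightarrow> \<exists>E. finite E \<and> E \<subseteq> carrier R - P \<and>
      (\<forall>a\<in>homogeneous - P. \<exists>w. assoc_mod P a (monomial E w))"
    and s: "s > 1"
  shows "left_stable R p (Idl F0) s"
proof -
  let ?I = "Idl F0"
  have F0c: "F0 \<subseteq> carrier R" using F0(2) homogeneous_carr by blast
  have I: "ideal ?I R" by (rule genideal_ideal[OF F0c])
  have Ic: "?I \<subseteq> carrier R" using ideal_carr[OF I] by blast
  define gap where "gap P \<kappa> \<longleftrightarrow> (\<forall>t>\<kappa>. \<forall>x\<in>homogeneous. \<forall>y\<in>homogeneous. \<exists>C\<in>carrier R - P.
    \<forall>\<^sub>F e in sequentially. y \<otimes> x [^] (p ^ e) \<in> ideal_pow ?I (nat \<lceil>t * real (p ^ e)\<rceil>) \<longrightarrow>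
      C \<otimes> (y \<otimes> x [^] (p ^ e)) \<in> ideal_pow ?I (nat \<lceil>s * real (p ^ e)\<rceil>) <+>\<^bsub>R\<^esub> P)" for P \<kappa>
  have "\<forall>P\<in>minimal_primes R. \<exists>\<kappa>. \<kappa> < s \<and> gap P \<kappa>"
  proof
    fix P assume P: "P \<in> minimal_primes R"
    obtain E where E': "finite E" "E \<subseteq> carrier R - P"
      "\<forall>a\<in>homogeneous - P. \<exists>w. assoc_mod P a (monomial E w)" using E[OF P] by blast
    have "\<exists>\<kappa><s. gap P \<kappa>" unfolding gap_def
      by (rule slope_gap[OF minimal_prime[OF P] F0 nsub[OF P] E'(1,2)]) (use E'(3) s in auto)
    then show "\<exists>\<kappa>. \<kappa> < s \<and> gap P \<kappa>" by blast
  qed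
  then obtain k where k: "\<forall>P\<in>minimal_primes R. k P < s \<and> gap P (k P)" by (rule bchoice[THEN exE])
  define \<kappa> where "\<kappa> = Max (insert 0 (k ` minimal_primes R))"
  have fin: "finite (insert 0 (k ` minimal_primes R))" using finite_minimal by simp
  have \<kappa>s: "\<kappa> < s" unfolding \<kappa>_def using fin k s by (subst Max_less_iff) auto
  have k\<kappa>: "k P \<le> \<kappa>" if "P \<in> minimal_primes R" for P
    unfolding \<kappa>_def using fin that by (intro Max_ge) auto
  show ?thesis
  proof (rule left_stableI[OF I])
    show "s - \<kappa> > 0" using \<kappa>s by simp
    fix t assume t: "1 \<le> t" "s - (s - \<kappa>) < t" "t < s"
    show "weak_closure R p t ?I \<subseteq> weak_closure R p s ?I"
    proof
      fix x assume x: "x \<in> weak_closure R p t ?I"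
      have xc: "x \<in> carrier R" using weak_closure_carr[OF x] .
      obtain c where c: "c \<in> carrier R" "\<forall>P\<in>minimal_primes R. c \<notin> P"
        and ev: "\<forall>\<^sub>F e in sequentially. c \<otimes> x [^] (p ^ e) \<in> mixed_power R t (p ^ e) ?I"
        using weak_closureD[OF x] .
      let ?S = "{h. component c h \<noteq> \<zero>} \<times> {g. component x g \<noteq> \<zero>}"
      define b where "b i e = component c (fst i) \<otimes> component x (snd i) [^] (p ^ e)" for i e
      have bc: "b i e \<in> carrier R" for i e
        using component_carr[OF c(1)] component_carr[OF xc] by (simp add: b_def)
      have finS: "finite ?S" using finite_support c(1) xc by simp
      show "x \<in> weak_closure R p s ?I"
      proof (rule weak_closure_modulo_minimal_primes[OF I xc])
        show "s \<ge> 0" using s by simp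
        fix P assume P: "P \<in> minimal_primes R"
        note PP = minimal_prime[OF P] and PI = prime_ideal[OF minimal_prime[OF P]]
        define good where "good i C e \<longleftrightarrow> (b i e \<in> ideal_pow ?I (nat \<lceil>t * real (p ^ e)\<rceil>) \<longrightarrow>
          C \<otimes> b i e \<in> ideal_pow ?I (nat \<lceil>s * real (p ^ e)\<rceil>) <+>\<^bsub>R\<^esub> P)" for i C e
        have tk: "t > k P" using k\<kappa>[OF P] t(2) by linarith
        have "\<forall>i\<in>?S. \<exists>C. C \<in> carrier R - P \<and> (\<forall>\<^sub>F e in sequentially. good i C e)"
        proof
          fix i
          have hc: "component c (fst i) \<in> homogeneous" "component x (snd i) \<in> homogeneous"
            using component_mem[OF c(1)] component_mem[OF xc] by blast+
          have "gap P (k P)" using k P by blast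
          then have "\<exists>C\<in>carrier R - P. \<forall>\<^sub>F e in sequentially. good i C e"
            unfolding gap_def good_def b_def using tk hc by blast
          then show "\<exists>C. C \<in> carrier R - P \<and> (\<forall>\<^sub>F e in sequentially. good i C e)" by blast
        qed
        then obtain C where C: "\<forall>i\<in>?S. C i \<in> carrier R - P \<and> (\<forall>\<^sub>F e in sequentially. good i (C i) e)"
          by (rule bchoice[THEN exE])
        define D where "D = finprod R C ?S"
        have D: "D \<in> carrier R - P" unfolding D_def using C by (intro prime_finprod[OF PP]) blast
        have "\<forall>\<^sub>F e in sequentially. \<forall>i\<in>?S. good i (C i) e"
          using C by (intro eventually_ball_finite finS) blast
        then have "\<forall>\<^sub>F e in sequentially. \<forall>i\<in>?S. good i D e"
        proof eventually_elim
          case (elim e)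
          show ?case
          proof (intro ballI)
            fix i assume i: "i \<in> ?S"
            let ?Q = "ideal_pow ?I (nat \<lceil>s * real (p ^ e)\<rceil>) <+>\<^bsub>R\<^esub> P"
            note Q = ideal_pow_mod_ideal[OF I PI]
            let ?r = "finprod R C (?S - {i})"
            have rc: "?r \<in> carrier R" using C by (intro finprod_closed) auto
            have Ci: "C i \<in> carrier R" using C i by blast
            have "D = finprod R C (insert i (?S - {i}))" unfolding D_def using i by (simp only: insert_Diff)
            also have "\<dots> = C i \<otimes> ?r" using finS C Ci by (intro finprod_insert) auto
            finally have "D \<otimes> b i e = ?r \<otimes> (C i \<otimes> b i e)"
              using rc Ci bc by (simp add: m_assoc m_lcomm)
            then show "good i D e"
              using elim i ideal_lmult[OF Q rc] unfolding good_def by auto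
          qed
        qed
        with ev have "\<forall>\<^sub>F e in sequentially. (D \<otimes> c) \<otimes> x [^] (p ^ e) \<in> mixed_power R s (p ^ e) ?I <+>\<^bsub>R\<^esub> P"
        proof eventually_elim
          case (elim e)
          let ?q = "p ^ e" and ?U = "c \<otimes> x [^] (p ^ e)"
          let ?M = "mixed_power R s (p ^ e) ?I <+>\<^bsub>R\<^esub> P"
          note MI = mixed_power_ideal[OF I, of s "p ^ e"]
          have M: "ideal ?M R" by (rule add_ideals[OF MI PI])
          have Uc: "?U \<in> carrier R" using c xc by simp
          have pw: "ideal_pow ?I (nat \<lceil>t * real ?q\<rceil>) = Idl (product_set F0 (nat \<lceil>t * real ?q\<rceil>))"
            by (rule ideal_pow_genideal[OF F0c])
          have fr: "frobenius_power R ?I ?q = Idl ((\<lambda>h. h [^] ?q) ` F0)"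
            by (rule frobenius_power_genideal[OF F0c])
          have hfr: "(\<lambda>h. h [^] ?q) ` F0 \<subseteq> homogeneous"
          proof
            fix v assume "v \<in> (\<lambda>h. h [^] ?q) ` F0"
            then obtain h where h: "h \<in> F0" "v = h [^] ?q" by blast
            then obtain g where "h \<in> \<A> g" using F0(2) by blast
            then show "v \<in> homogeneous" using homogeneous_pow h(2) by blast
          qed
          have comp: "D \<otimes> component ?U k \<in> ?M" for k
          proof (cases "component ?U k = \<zero>")
            case True
            then show ?thesis using D ideal_zero[OF M] by simp
          next
            case False
            obtain h g where hg: "(h, g) \<in> ?S" "b (h, g) e \<in> \<A> k" "b (h, g) e \<noteq> \<zero>"
              using product_component_support[OF c(1) xc False] unfolding b_def by auto
            have "component ?U k \<in> ideal_pow ?I (nat \<lceil>t * real ?q\<rceil>) <+>\<^bsub>R\<^esub> frobenius_power R ?I ?q"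
            proof -
              obtain v w where vw: "?U = v \<oplus> w" "v \<in> ideal_pow ?I (nat \<lceil>t * real ?q\<rceil>)"
                "w \<in> frobenius_power R ?I ?q"
                using elim(1) unfolding mixed_power_def mem_set_add_iff by blast
              have vc: "v \<in> carrier R" "w \<in> carrier R"
                using vw ideal_carr[OF ideal_pow_ideal[OF I]] ideal_carr[OF frobenius_power_ideal[OF Ic]]
                by blast+
              have "component ?U k = component v k \<oplus> component w k"
                unfolding vw(1) by (rule component_add[OF vc])
              moreover have "component v k \<in> ideal_pow ?I (nat \<lceil>t * real ?q\<rceil>)"
                using vw(2) unfolding pw by (rule component_genideal[OF homogeneous_product_set[OF F0(2)]])
              moreover have "component w k \<in> frobenius_power R ?I ?q"
                using vw(3) unfolding fr by (rule component_genideal[OF hfr])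
              ultimately show ?thesis unfolding mem_set_add_iff by blast
            qed
            then have "component ?U k \<in> ideal_pow ?I (nat \<lceil>t * real ?q\<rceil>) \<or>
                component ?U k \<in> frobenius_power R ?I ?q"
              unfolding pw fr
              by (rule homogeneous_mem_sum[OF component_mem[OF Uc] homogeneous_product_set[OF F0(2)] hfr])
            then show ?thesis
            proof
              assume "component ?U k \<in> frobenius_power R ?I ?q"
              then have "component ?U k \<in> mixed_power R s ?q ?I" by (rule mem_mixed_powerI(2)[OF I])
              then have "D \<otimes> component ?U k \<in> mixed_power R s ?q ?I"
                using D ideal_lmult[OF MI] by blast
              then show ?thesis using mem_set_addI(1)[OF MI PI] by blast
            next
              assume mem: "component ?U k \<in> ideal_pow ?I (nat \<lceil>t * real ?q\<rceil>)"
              obtain u where u: "u \<in> \<A> 0" "b (h, g) e = u \<otimes> component ?U k"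
                using thin[OF hg(2) component_mem[OF Uc] False] by blast
              have "b (h, g) e \<in> ideal_pow ?I (nat \<lceil>t * real ?q\<rceil>)"
                unfolding u(2) by (rule ideal_lmult[OF ideal_pow_ideal[OF I] piece_carr[OF u(1)] mem])
              then have "D \<otimes> b (h, g) e \<in> ideal_pow ?I (nat \<lceil>s * real ?q\<rceil>) <+>\<^bsub>R\<^esub> P"
                using elim(2) hg(1) unfolding good_def by blast
              moreover have "\<dots> \<subseteq> ?M"
                using mem_mixed_powerI(1)[OF I] unfolding set_add_def' by blast
              ultimately have DM: "D \<otimes> b (h, g) e \<in> ?M" by blast
              obtain u' where u': "u' \<in> \<A> 0" "component ?U k = u' \<otimes> b (h, g) e"
                using thin[OF component_mem[OF Uc] hg(2,3)] by blast
              have "u' \<otimes> (D \<otimes> b (h, g) e) \<in> ?M" by (rule ideal_lmult[OF M piece_carr[OF u'(1)] DM])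
              moreover have "u' \<otimes> (D \<otimes> b (h, g) e) = D \<otimes> component ?U k"
                unfolding u'(2) using D bc piece_carr[OF u'(1)] by (simp add: m_lcomm)
              ultimately show ?thesis by simp
            qed
          qed
          have K: "ideal {v \<in> carrier R. v \<otimes> D \<in> ?M} R" using D by (intro colon_ideal[OF M]) blast
          have "?U \<in> {v \<in> carrier R. v \<otimes> D \<in> ?M}"
          proof (rule sum_of_homogeneous_in_closed_set[OF _ _ _ Uc])
            show "component ?U k \<in> {v \<in> carrier R. v \<otimes> D \<in> ?M}" for k
              using comp[of k] component_carr[OF Uc] D by (simp add: m_comm)
          qed (use ideal_carr[OF K] ideal_zero[OF K] ideal_add[OF K] in blast)+
          then have "?U \<otimes> D \<in> ?M" by blast
          also have "?U \<otimes> D = (D \<otimes> c) \<otimes> x [^] (p ^ e)" using D c xc by (simp add: m_assoc m_comm[of _ D])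
          finally show ?case .
        qed
        moreover have "D \<otimes> c \<in> carrier R - P" using c P by (intro prime_mult[OF PP D]) blast
        ultimately show "\<exists>c\<in>carrier R - P. \<forall>\<^sub>F e in sequentially.
            c \<otimes> x [^] (p ^ e) \<in> mixed_power R s (p ^ e) ?I <+>\<^bsub>R\<^esub> P" by blast
      qed
    qed
  qed
qed

end

section \<open>Noetherian graded rings with pieces of length one\<close>

context graded_ring
begin

lemma piece_submodule:
  assumes N: "additive_subgroup N R" and sub: "N \<subseteq> \<A> g"
    and smult: "\<And>u x. \<lbrakk>u \<in> \<A> 0; x \<in> N\<rbrakk> \<Longrightarrow> u \<otimes> x \<in> N"
  shows "submodule N (zeroth_ring R \<A>) (piece_module R \<A> g)"
proof -
  have "subgroup N ((add_monoid R)\<lparr>carrier := \<A> g\<rparr>)"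
    by (rule group.subgroup_incl[OF a_group additive_subgroup.a_subgroup[OF N]
        additive_subgroup.a_subgroup[OF piece_subgroup] sub])
  then have "subgroup N (add_monoid (piece_module R \<A> g))"
    by (simp add: subgroup_def m_inv_def piece_module_def)
  then show ?thesis
  proof (rule submodule.intro)
    show "submodule_axioms N (zeroth_ring R \<A>) (piece_module R \<A> g)"
      by (rule submodule_axioms.intro) (use smult in \<open>simp add: piece_module_def zeroth_ring_def\<close>)
  qed
qed

text \<open>Otherwise \<open>0\<close>, the submodule generated by \<open>y\<close>, and the whole piece form a chain of length two.\<close>

lemma thin_of_length_one:
  assumes len: "module_length (zeroth_ring R \<A>) (piece_module R \<A> g) = 1"
    and x: "x \<in> \<A> g" and y: "y \<in> \<A> g" "y \<noteq> \<zero>"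
  shows "\<exists>u\<in>\<A> 0. x = u \<otimes> y"
proof (rule ccontr)
  assume no: "\<not> (\<exists>u\<in>\<A> 0. x = u \<otimes> y)"
  let ?N1 = "(\<lambda>u. u \<otimes> y) ` \<A> 0"
  let ?N = "\<lambda>i::nat. if i = 0 then {\<zero>} else if i = 1 then ?N1 else \<A> g"
  note yc = piece_carr[OF y(1)]
  have N1g: "?N1 \<subseteq> \<A> g"
  proof
    fix z assume "z \<in> ?N1"
    then obtain u where "u \<in> \<A> 0" "z = u \<otimes> y" by blast
    then show "z \<in> \<A> g" using mult_piece[OF _ y(1), of u 0] by simp
  qed
  have N1: "additive_subgroup ?N1 R"
  proof (rule additive_subgroupI, rule add.subgroupI)
    show "?N1 \<subseteq> carrier R" using N1g piece_carr by blast
    show "?N1 \<noteq> {}" using piece_zero by blast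
    fix a assume "a \<in> ?N1"
    then obtain u where u: "u \<in> \<A> 0" "a = u \<otimes> y" by blast
    then have "\<ominus> a = (\<ominus> u) \<otimes> y" using yc piece_carr[OF u(1)] by (simp add: l_minus)
    then show "\<ominus> a \<in> ?N1" using piece_neg[OF u(1)] by blast
    fix b assume "b \<in> ?N1"
    then obtain v where v: "v \<in> \<A> 0" "b = v \<otimes> y" by blast
    have "a \<oplus> b = (u \<oplus> v) \<otimes> y"
      using u v yc piece_carr[OF u(1)] piece_carr[OF v(1)] by (simp add: l_distr)
    then show "a \<oplus> b \<in> ?N1" using piece_add[OF u(1) v(1)] by blast
  qed
  have s0: "submodule {\<zero>} (zeroth_ring R \<A>) (piece_module R \<A> g)"
    using ideal.axioms(1)[OF zeroideal] piece_zero piece_carr by (intro piece_submodule) auto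
  have s1: "submodule ?N1 (zeroth_ring R \<A>) (piece_module R \<A> g)"
  proof (rule piece_submodule[OF N1 N1g])
    fix u z assume u: "u \<in> \<A> 0" and "z \<in> ?N1"
    then obtain v where v: "v \<in> \<A> 0" "z = v \<otimes> y" by blast
    have "u \<otimes> z = (u \<otimes> v) \<otimes> y" unfolding v(2) using piece_carr u v(1) yc by (simp add: m_assoc)
    moreover have "u \<otimes> v \<in> \<A> 0" using mult_piece[OF u v(1)] by simp
    ultimately show "u \<otimes> z \<in> ?N1" by blast
  qed
  have s2: "submodule (\<A> g) (zeroth_ring R \<A>) (piece_module R \<A> g)"
    using piece_subgroup mult_piece[of _ 0 _ g] by (intro piece_submodule) auto
  have "y \<in> ?N1" using one_piece yc by (intro image_eqI[of _ _ \<one>]) auto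
  moreover have "\<zero> \<in> ?N1" using additive_subgroup.zero_closed[OF N1] .
  ultimately have "{\<zero>} \<subset> ?N1" using y(2) by blast
  moreover have "?N1 \<subset> \<A> g" using N1g x no by blast
  ultimately have strict: "\<forall>i<2. ?N i \<subset> ?N (Suc i)" by (auto simp: less_2_cases_iff)
  have submodules: "\<forall>i\<le>2. submodule (?N i) (zeroth_ring R \<A>) (piece_module R \<A> g)"
    using s0 s1 s2 by simp
  have "enat 2 \<le> module_length (zeroth_ring R \<A>) (piece_module R \<A> g)"
    unfolding module_length_def
    by (rule Sup_upper, rule CollectI, rule exI[of _ 2], rule exI[of _ ?N])
      (intro conjI refl, rule submodules, rule strict)
  then show False using len by (simp add: one_enat_def)
qed

end

lemma (in cring) positive_height_not_in_minimal_prime: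
  assumes "0 < ideal_height R I" and P: "P \<in> minimal_primes R"
  shows "\<not> I \<subseteq> P"
proof
  assume "I \<subseteq> P"
  then have "ideal_height R I \<le> prime_height R P"
    unfolding ideal_height_def using minimal_prime[OF P] by (intro Inf_lower) blast
  also have "prime_height R P \<le> 0"
    unfolding prime_height_def
  proof (rule Sup_least)
    fix h assume "h \<in> {enat n | n Q. (\<forall>i\<le>n. primeideal (Q i) R) \<and> (\<forall>i<n. Q i \<subset> Q (Suc i)) \<and> Q n = P}"
    then obtain n Q where nQ: "h = enat n" "\<forall>i\<le>n. primeideal (Q i) R" "\<forall>i<n. Q i \<subset> Q (Suc i)" "Q n = P"
      by blast
    have "n = 0"
    proof (rule ccontr)
      assume "n \<noteq> 0"
      then obtain m where m: "n = Suc m" using not0_implies_Suc by blast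
      then have "Q m \<subset> P" "primeideal (Q m) R" using nQ by auto
      then show False using minimal_prime_minimal[OF P] by blast
    qed
    then show "h \<le> 0" using nQ(1) by (simp add: zero_enat_def)
  qed
  finally show False using assms(1) by simp
qed

text \<open>Let \<open>E\<close> be a finite set of homogeneous nonunits modulo \<open>P\<close> that generates the ideal of all of them. A
  homogeneous nonunit \<open>a\<close> outside \<open>P\<close> is \<open>r e\<close> with \<open>e \<in> E\<close> and \<open>r\<close> homogeneous. As \<open>e\<close> is not a unit in the domain
  \<open>R / P\<close>, the ideal \<open>(r) + P\<close> is strictly larger than \<open>(a) + P\<close>, so splitting off factors terminates.\<close>

lemma (in thin_graded_ring) homogeneous_elements_modulo_units:
  assumes noeth: "noetherian_ring R" and P: "primeideal P R"
  shows "\<exists>E. finite E \<and> E \<subseteq> carrier R - P \<and> (\<forall>a\<in>homogeneous - P. \<exists>w. assoc_mod P a (monomial E w))"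
proof -
  interpret N: noetherian_ring R by (rule noeth)
  interpret noetherian_cring R by unfold_locales
  note PI = prime_ideal[OF P]
  define M where "M = {a \<in> homogeneous - P. \<not> divides_mod P a \<one>}"
  have Mc: "M \<subseteq> carrier R" using homogeneous_carr by (auto simp: M_def)
  obtain E where E: "finite E" "E \<subseteq> M" "Idl E = Idl M" using finite_generating_subset[OF Mc] .
  have Ec: "E \<subseteq> carrier R" using E(2) Mc by blast
  have Eh: "E \<subseteq> homogeneous" using E(2) by (auto simp: M_def)
  have claim: "\<forall>a\<in>homogeneous - P. Idl {a} <+>\<^bsub>R\<^esub> P = K \<longrightarrow> (\<exists>w. assoc_mod P a (monomial E w))"
    if "ideal K R" for K
    using that
  proof (induction rule: noetherian_induct)
    case (ideal K)
    show ?case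
    proof (intro ballI impI)
      fix a assume a: "a \<in> homogeneous - P" and K: "Idl {a} <+>\<^bsub>R\<^esub> P = K"
      have ac: "a \<in> carrier R" using a homogeneous_carr by blast
      show "\<exists>w. assoc_mod P a (monomial E w)"
      proof (cases "divides_mod P a \<one>")
        case True
        have "divides_mod P \<one> a" using divides_mod_multiple[OF PI one_closed ac] ac by simp
        then have "assoc_mod P a (monomial E (\<lambda>_. 0))"
          using True by (simp add: monomial_zero[OF Ec] assoc_mod_def)
        then show ?thesis by blast
      next
        case False
        then have "a \<in> M" using a by (simp add: M_def)
        then have aE: "a \<in> Idl E" using E(3) genideal_mem_self[OF Mc] by blast
        have "a \<noteq> \<zero>" using a ideal_zero[OF PI] by blast
        then obtain e r where er: "e \<in> E" "r \<in> homogeneous" "a = r \<otimes> e"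
          using homogeneous_multiple_of_generator[OF Eh _ _ aE] a by blast
        have ec: "e \<in> carrier R" and rc: "r \<in> carrier R" using er Ec homogeneous_carr by blast+
        have rP: "r \<in> homogeneous - P" using er a ideal_rmult[OF PI ec] by blast
        have Ia: "ideal (Idl {a}) R" and Ir: "ideal (Idl {r}) R" using ac rc by (auto intro: genideal_ideal)
        have Lr: "ideal (Idl {r} <+>\<^bsub>R\<^esub> P) R" by (rule add_ideals[OF Ir PI])
        have "a \<in> Idl {r}" using principal_genideal[OF rc] er(3) ec m_comm[OF rc ec] by blast
        then have "Idl {a} \<subseteq> Idl {r}" using Idl_subset_ideal'[OF ac rc] by blast
        then have sub: "K \<subseteq> Idl {r} <+>\<^bsub>R\<^esub> P" unfolding K[symmetric] set_add_def' by blast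
        have "r \<in> Idl {r} <+>\<^bsub>R\<^esub> P" using mem_set_addI(1)[OF Ir PI] genideal_self'[OF rc] by blast
        moreover have "r \<notin> K"
        proof
          assume "r \<in> K"
          then obtain z \<pi> where z: "z \<in> Idl {a}" "\<pi> \<in> P" "r = z \<oplus> \<pi>"
            unfolding K[symmetric] mem_set_add_iff by blast
          then obtain u where u: "u \<in> carrier R" "z = u \<otimes> a" using principal_genideal[OF ac] by blast
          have "divides_mod P a r" unfolding divides_mod_def using ac rc u z by blast
          moreover have "a = e \<otimes> r" using er(3) m_comm[OF rc ec] by simp
          ultimately have "divides_mod P (e \<otimes> r) (\<one> \<otimes> r)" using rc by simp
          then have "divides_mod P e \<one>"
            by (rule divides_mod_cancel[OF P]) (use rP rc ec in auto)
          then show False using er(1) E(2) by (auto simp: M_def)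
        qed
        ultimately have "K \<subset> Idl {r} <+>\<^bsub>R\<^esub> P" using sub by blast
        then obtain w where w: "assoc_mod P r (monomial E w)" using ideal(2)[OF Lr] rP by blast
        have "monomial E (\<lambda>j. w j + (if j = e then 1 else 0)) = monomial E w \<otimes> e"
          using monomial_add[OF Ec, of w "\<lambda>j. if j = e then 1 else 0"] monomial_single[OF E(1) Ec er(1)]
          by simp
        then have "assoc_mod P a (monomial E (\<lambda>j. w j + (if j = e then 1 else 0)))"
          unfolding er(3) using assoc_mod_mult[OF PI w assoc_mod_refl[OF PI ec]] by simp
        then show ?thesis by blast
      qed
    qed
  qed
  have "\<exists>w. assoc_mod P a (monomial E w)" if a: "a \<in> homogeneous - P" for a
  proof -
    have "a \<in> carrier R" using a homogeneous_carr by blast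
    then have "ideal (Idl {a} <+>\<^bsub>R\<^esub> P) R" using PI by (intro add_ideals genideal_ideal) auto
    from claim[OF this] show ?thesis using a by blast
  qed
  moreover have "E \<subseteq> carrier R - P" using E(2) Mc by (auto simp: M_def)
  ultimately show ?thesis using E(1) by blast
qed

lemma finite_minimal_primes_ring_noetherian:
  assumes "cring R" "noetherian_ring R" "normalization_semidom_class.prime p" "ring_char R = p"
  shows "finite_minimal_primes_ring R p"
proof -
  interpret cring R by fact
  interpret noetherian_ring R by fact
  interpret N: noetherian_cring R by unfold_locales
  show ?thesis
    by unfold_locales
      (use assms(3,4) N.finite_minimal_primes N.nilpotent_radical in auto)
qed

theorem left_stable_length_one_pieces:
  assumes graded: "graded_ring R \<A>" and noeth: "noetherian_ring R"
    and p: "normalization_semidom_class.prime p" "ring_char R = p"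
    and len: "\<And>g. module_length (zeroth_ring R \<A>) (piece_module R \<A> g) = 1"
    and I: "homogeneous_ideal R \<A> I" and ht: "0 < ideal_height R I" and s: "s > 1"
  shows "left_stable R p I s"
proof -
  interpret G: graded_ring R \<A> by (rule graded)
  interpret N: noetherian_ring R by (rule noeth)
  interpret N: noetherian_cring R by unfold_locales
  interpret F: finite_minimal_primes_ring R p
    by (rule finite_minimal_primes_ring_noetherian[OF G.is_cring noeth p])
  interpret T: thin_graded_ring R \<A> p
    by unfold_locales (rule G.thin_of_length_one[OF len])
  obtain H where H: "H \<subseteq> (\<Union>g. \<A> g)" "I = Idl\<^bsub>R\<^esub> H" using I unfolding homogeneous_ideal_def by blast
  have Hc: "H \<subseteq> carrier R" using H(1) T.homogeneous_carr by blast
  obtain F0 where F0: "finite F0" "F0 \<subseteq> H" "Idl\<^bsub>R\<^esub> F0 = Idl\<^bsub>R\<^esub> H"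
    using N.finite_generating_subset[OF Hc] .
  have "left_stable R p (Idl\<^bsub>R\<^esub> F0) s"
  proof (rule T.left_stable_homogeneous[OF F0(1) _ _ _ s])
    show "F0 \<subseteq> (\<Union>g. \<A> g)" using F0(2) H(1) by blast
    fix P assume P: "P \<in> minimal_primes R"
    show "\<not> Idl\<^bsub>R\<^esub> F0 \<subseteq> P"
      using G.positive_height_not_in_minimal_prime[OF ht P] F0(3) H(2) by simp
    show "\<exists>E. finite E \<and> E \<subseteq> carrier R - P \<and>
        (\<forall>a\<in>(\<Union>g. \<A> g) - P. \<exists>w. G.assoc_mod P a (G.monomial E w))"
      by (rule T.homogeneous_elements_modulo_units[OF noeth G.minimal_prime[OF P]])
  qed
  then show ?thesis using F0(3) H(2) by simp
qed

theorem left_stable_powers_of_irrelevant_ideal: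
  assumes graded: "graded_ring R \<A>" and noeth: "noetherian_ring R"
    and p: "normalization_semidom_class.prime p" "ring_char R = p"
    and gen: "generated_in_degree_one R \<A>" and s: "s > 1"
  shows "left_stable R p (irrelevant_ideal R \<A> [^]\<^bsub>ideals_set R\<^esub> (n :: nat)) s"
proof -
  interpret G: graded_ring R \<A> by (rule graded)
  interpret F: finite_minimal_primes_ring R p
    by (rule finite_minimal_primes_ring_noetherian[OF G.is_cring noeth p])
  interpret S: standard_graded_ring R \<A> p by unfold_locales (rule gen)
  show ?thesis using s by (rule S.left_stable_irrelevant_pow)
qed

section \<open>Monomial ideals in algebras of finitely generated monoids\<close>

lemma add_submonoid_hull: "add_submonoid (add_submonoid hull F)"
  by (rule hull_in) (auto simp: add_submonoid_def)

lemma add_submonoid_zero: "add_submonoid S \<Longrightarrow> 0 \<in> S"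
  and add_submonoid_add: "\<lbrakk>add_submonoid S; x \<in> S; y \<in> S\<rbrakk> \<Longrightarrow> x + y \<in> S"
  by (simp_all add: add_submonoid_def)

lemma add_submonoid_sum:
  fixes f :: "'i \<Rightarrow> 'm :: comm_monoid_add"
  assumes "add_submonoid S" "\<And>i. i \<in> A \<Longrightarrow> f i \<in> S" shows "(\<Sum>i\<in>A. f i) \<in> S"
  using assms(2)
proof (induction A rule: infinite_finite_induct)
  case (insert i A)
  then show ?case using assms(1) by (simp add: add_submonoid_def)
qed (use assms(1) in \<open>simp_all add: add_submonoid_def\<close>)

lemma monoid_algebra_simps [simp]:
  "carrier (monoid_algebra S) = {f. Poly_Mapping.keys f \<subseteq> S}"
  "f \<otimes>\<^bsub>monoid_algebra S\<^esub> g = f * g" "f \<oplus>\<^bsub>monoid_algebra S\<^esub> g = f + g"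
  "\<one>\<^bsub>monoid_algebra S\<^esub> = 1" "\<zero>\<^bsub>monoid_algebra S\<^esub> = 0"
  by (simp_all add: monoid_algebra_def ring_of_type_algebra_def)

lemma ring_char_monoid_algebra:
  "ring_char (monoid_algebra S :: ('m :: comm_monoid_add \<Rightarrow>\<^sub>0 'k :: field) ring) = CHAR('k)"
proof -
  let ?R = "monoid_algebra S :: ('m \<Rightarrow>\<^sub>0 'k) ring"
  have pow: "add_pow ?R n \<one>\<^bsub>?R\<^esub> = of_nat n" for n :: nat
    by (induction n) (simp_all add: add_pow_def nat_pow_def add.commute)
  have "of_nat n = (0 :: 'm \<Rightarrow>\<^sub>0 'k) \<longleftrightarrow> CHAR('k) dvd n" for n
  proof -
    have "of_nat n = (0 :: 'm \<Rightarrow>\<^sub>0 'k) \<longleftrightarrow> Poly_Mapping.single (0 :: 'm) (of_nat n :: 'k) = 0" by simp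
    also have "\<dots> \<longleftrightarrow> (of_nat n :: 'k) = 0" by (metis lookup_single_eq lookup_zero single_zero)
    finally show ?thesis by (simp add: of_nat_eq_0_iff_char_dvd)
  qed
  then have "ring_char ?R = Gcd {n. CHAR('k) dvd n}"
    unfolding ring_char_def pow by simp
  also have "\<dots> = CHAR('k)"
    by (intro dvd_antisym Gcd_dvd Gcd_greatest) auto
  finally show ?thesis .
qed

text \<open>The minimal elements of \<open>V\<close> form a finite set, since an infinite sequence of them would contain two
  comparable ones, and every element of \<open>V\<close> dominates a minimal one.\<close>

lemma finite_minimal_vectors:
  fixes V :: "('j \<Rightarrow> nat) set"
  assumes fin: "finite J" and zero: "\<And>v j. \<lbrakk>v \<in> V; j \<notin> J\<rbrakk> \<Longrightarrow> v j = 0"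
  shows "\<exists>B\<subseteq>V. finite B \<and> (\<forall>v\<in>V. \<exists>b\<in>B. \<forall>j. b j \<le> v j)"
proof -
  define B where "B = {b \<in> V. \<forall>v\<in>V. (\<forall>j. v j \<le> b j) \<longrightarrow> v = b}"
  have "finite B"
  proof (rule ccontr)
    assume "infinite B"
    then obtain f :: "nat \<Rightarrow> 'j \<Rightarrow> nat" where f: "inj f" "range f \<subseteq> B"
      using infinite_countable_subset by blast
    obtain g :: "nat \<Rightarrow> nat" where g: "strict_mono g" "\<forall>j\<in>J. mono (\<lambda>n. f (g n) j)"
      using dickson_subsequence[OF fin, of f] by blast
    have fB: "f n \<in> B" for n using f(2) by blast
    then have fV: "f n \<in> V" for n unfolding B_def by blast
    have "f (g 0) j \<le> f (g 1) j" for j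
      using g(2) zero[OF fV] by (cases "j \<in> J") (auto simp: mono_def)
    then have "f (g 0) = f (g 1)" using fB[of "g 1"] fV[of "g 0"] unfolding B_def by simp
    then have "g 0 = g 1" using f(1) by (simp add: inj_eq)
    then show False using g(1) by (simp add: strict_mono_eq)
  qed
  moreover have "\<exists>b\<in>B. \<forall>j. b j \<le> v j" if "v \<in> V" for v
    using that
  proof (induction "\<Sum>j\<in>J. v j" arbitrary: v rule: less_induct)
    case less
    show ?case
    proof (cases "v \<in> B")
      case True
      then show ?thesis by blast
    next
      case False
      then obtain u where u: "u \<in> V" "\<forall>j. u j \<le> v j" "u \<noteq> v" using less.prems unfolding B_def by blast
      then obtain j where j: "u j \<noteq> v j" by blast
      then have "j \<in> J" using zero[OF u(1)] zero[OF less.prems] by metis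
      moreover have "u j < v j" using j u(2) by (metis le_neq_implies_less)
      ultimately have "(\<Sum>j\<in>J. u j) < (\<Sum>j\<in>J. v j)"
        using fin u(2) by (intro sum_strict_mono_ex1) auto
      then obtain b where "b \<in> B" "\<forall>j. b j \<le> u j" using less.hyps u(1) by blast
      then show ?thesis using u(2) order_trans by blast
    qed
  qed
  moreover have "B \<subseteq> V" unfolding B_def by blast
  ultimately show ?thesis by blast
qed

text \<open>The order on the monoid makes the monoid algebra a domain.\<close>

locale finitely_generated_monoid_algebra =
  fixes F :: "'m :: {ordered_cancel_comm_monoid_add, linorder} set"
    and k :: "'k :: field itself" and p :: nat
  assumes finite_F: "finite F" and prime_p: "normalization_semidom_class.prime p"
    and char_p: "CHAR('k) = p"
begin

abbreviation S :: "'m set" where "S \<equiv> add_submonoid hull F"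

abbreviation kS :: "('m \<Rightarrow>\<^sub>0 'k) ring" where "kS \<equiv> monoid_algebra S"

lemma zero_S: "0 \<in> S" and add_S: "\<lbrakk>x \<in> S; y \<in> S\<rbrakk> \<Longrightarrow> x + y \<in> S"
  by (rule add_submonoid_zero[OF add_submonoid_hull], rule add_submonoid_add[OF add_submonoid_hull])

sublocale kS: cring kS by (rule cring_monoid_algebra[OF add_submonoid_hull])

sublocale kS: "domain" kS
proof
  show "\<one>\<^bsub>kS\<^esub> \<noteq> \<zero>\<^bsub>kS\<^esub>" by simp
  show "a = \<zero>\<^bsub>kS\<^esub> \<or> b = \<zero>\<^bsub>kS\<^esub>" if "a \<otimes>\<^bsub>kS\<^esub> b = \<zero>\<^bsub>kS\<^esub>" for a b using that by simp
qed

lemma minimal_primes_kS: "minimal_primes kS = {{0}}"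
proof -
  have zero: "primeideal {0} kS" using kS.zeroprimeideal by simp
  have "{0} \<subseteq> P" if "primeideal P kS" for P
    using kS.ideal_zero[OF kS.prime_ideal[OF that]] by simp
  then show ?thesis using zero unfolding minimal_primes_def by blast
qed

sublocale kS: finite_minimal_primes_ring kS p
proof
  show "normalization_semidom_class.prime p" by (rule prime_p)
  show "ring_char kS = p" by (simp add: ring_char_monoid_algebra char_p)
  show "finite (minimal_primes kS)" by (simp add: minimal_primes_kS)
  show "\<exists>r. \<forall>xs. length xs = r \<longrightarrow> set xs \<subseteq> {x \<in> carrier kS. \<forall>P\<in>minimal_primes kS. x \<in> P} \<longrightarrow>
      kS.list_product xs = \<zero>\<^bsub>kS\<^esub>"
  proof (intro exI[of _ 1] allI impI)
    fix xs assume "length xs = 1" and xs: "set xs \<subseteq> {x \<in> carrier kS. \<forall>P\<in>minimal_primes kS. x \<in> P}"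
    then obtain x where "xs = [x]" by (auto simp: length_Suc_conv)
    then show "kS.list_product xs = \<zero>\<^bsub>kS\<^esub>" using xs by (simp add: minimal_primes_kS)
  qed
qed

lemma single_one_nonzero: "Poly_Mapping.single (a :: 'm) (1 :: 'k) \<noteq> 0"
proof
  assume "Poly_Mapping.single a (1 :: 'k) = 0"
  then have "Poly_Mapping.lookup (Poly_Mapping.single a (1 :: 'k)) a = 0" by simp
  then show False by simp
qed

text \<open>All multiples of the monomial of degree \<open>g\<close> if \<open>g\<close> belongs to \<open>S\<close>, and zero otherwise.\<close>

definition piece :: "'m \<Rightarrow> ('m \<Rightarrow>\<^sub>0 'k) set" where
  "piece g = {f. Poly_Mapping.keys f \<subseteq> S \<inter> {g}}"

lemma piece_iff: "f \<in> piece g \<longleftrightarrow> f = 0 \<or> (g \<in> S \<and> (\<exists>c. f = Poly_Mapping.single g c))"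
proof
  assume f: "f \<in> piece g"
  show "f = 0 \<or> (g \<in> S \<and> (\<exists>c. f = Poly_Mapping.single g c))"
  proof (cases "f = 0")
    case False
    then have "Poly_Mapping.keys f \<noteq> {}" by simp
    then have "g \<in> S" using f unfolding piece_def by blast
    moreover have "f = Poly_Mapping.single g (Poly_Mapping.lookup f g)"
    proof (rule poly_mapping_eqI)
      fix h
      show "Poly_Mapping.lookup f h = Poly_Mapping.lookup (Poly_Mapping.single g (Poly_Mapping.lookup f g)) h"
      proof (cases "h = g")
        case False
        then have "h \<notin> Poly_Mapping.keys f" using f unfolding piece_def by blast
        then show ?thesis using False by (simp add: in_keys_iff lookup_single_not_eq)
      qed simp
    qed
    ultimately show ?thesis by blast
  qed simp
next
  assume "f = 0 \<or> (g \<in> S \<and> (\<exists>c. f = Poly_Mapping.single g c))"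
  then show "f \<in> piece g" unfolding piece_def by (auto split: if_splits)
qed

lemma finsum_kS:
  assumes "\<And>i. i \<in> A \<Longrightarrow> f i \<in> carrier kS" shows "finsum kS f A = sum f A"
  using assms
proof (induction A rule: infinite_finite_induct)
  case (infinite A)
  then show ?case using kS.finsum_infinite by simp
next
  case empty
  then show ?case by simp
next
  case (insert i A)
  then have "f \<in> A \<rightarrow> carrier kS" "f i \<in> carrier kS" by auto
  then have "finsum kS f (insert i A) = f i \<oplus>\<^bsub>kS\<^esub> finsum kS f A"
    using insert.hyps by (intro kS.finsum_insert)
  then show ?case using insert by simp
qed

lemma piece_carrier: "f \<in> piece g \<Longrightarrow> f \<in> carrier kS"
  by (auto simp: piece_def)

lemma lookup_sum_of_pieces:
  assumes "finite A" and f: "\<And>g. f g \<in> piece g" and "\<And>g. g \<notin> A \<Longrightarrow> f g = 0"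
  shows "Poly_Mapping.lookup (sum f A) h = Poly_Mapping.lookup (f h) h"
proof -
  have other: "Poly_Mapping.lookup (f g) h = 0" if "g \<noteq> h" for g
    using f[of g] that by (auto simp: piece_iff lookup_single_not_eq)
  have "Poly_Mapping.lookup (sum f A) h = (\<Sum>g\<in>A. Poly_Mapping.lookup (f g) h)" by (rule lookup_sum)
  also have "\<dots> = (\<Sum>g\<in>A. if g = h then Poly_Mapping.lookup (f h) h else 0)"
    using other by (intro sum.cong) auto
  also have "\<dots> = Poly_Mapping.lookup (f h) h" using assms(1,3) by (simp add: sum.delta)
  finally show ?thesis .
qed

lemma graded_kS: "graded_ring kS piece"
proof (intro graded_ring.intro graded_ring_axioms.intro)
  show "cring kS" by (rule kS.is_cring)
  show "additive_subgroup (piece g) kS" for g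
  proof (rule additive_subgroupI, rule kS.add.subgroupI)
    show "piece g \<subseteq> carrier kS" using piece_carrier by blast
    show "piece g \<noteq> {}" using piece_iff by blast
    fix a assume a: "a \<in> piece g"
    have "\<ominus>\<^bsub>kS\<^esub> a = - a"
    proof (rule kS.minus_equality)
      have "Poly_Mapping.keys (- a) = Poly_Mapping.keys a"
        by (simp add: set_eq_iff flip: lookup_not_eq_zero_eq_in_keys)
      then show "- a \<in> carrier kS" using piece_carrier[OF a] by simp
    qed (use piece_carrier[OF a] in simp_all)
    moreover have "- a \<in> piece g" using a unfolding piece_iff by (auto simp: single_uminus[symmetric])
    ultimately show "\<ominus>\<^bsub>kS\<^esub> a \<in> piece g" by simp
    fix b assume "b \<in> piece g"
    with a show "a \<oplus>\<^bsub>kS\<^esub> b \<in> piece g" unfolding piece_iff by (auto simp: single_add[symmetric])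
  qed
  show "\<one>\<^bsub>kS\<^esub> \<in> piece 0" unfolding piece_def using zero_S by simp
  show "x \<otimes>\<^bsub>kS\<^esub> y \<in> piece (g + h)" if "x \<in> piece g" "y \<in> piece h" for x y g h
    using that add_S unfolding piece_iff by (auto simp: mult_single)
  fix x assume x: "x \<in> carrier kS"
  let ?f = "\<lambda>g. Poly_Mapping.single g (Poly_Mapping.lookup x g)"
  have fP: "?f g \<in> piece g" for g
  proof (cases "g \<in> S")
    case True
    then show ?thesis unfolding piece_iff by blast
  next
    case False
    then have "Poly_Mapping.lookup x g = 0" using x by (auto simp: in_keys_iff)
    then show ?thesis unfolding piece_iff by simp
  qed
  have supp: "{g. ?f g \<noteq> 0} = Poly_Mapping.keys x"
    by (auto simp: in_keys_iff) (metis lookup_single_eq lookup_zero)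
  show "\<exists>!f. (\<forall>g. f g \<in> piece g) \<and> finite {g. f g \<noteq> \<zero>\<^bsub>kS\<^esub>} \<and>
      x = finsum kS f {g. f g \<noteq> \<zero>\<^bsub>kS\<^esub>}"
  proof (rule ex1I[of _ ?f])
    have "x = sum ?f {g. ?f g \<noteq> 0}"
    proof (rule poly_mapping_eqI)
      fix h
      have "Poly_Mapping.lookup (sum ?f {g. ?f g \<noteq> 0}) h = Poly_Mapping.lookup (?f h) h"
        by (rule lookup_sum_of_pieces) (use fP in \<open>auto simp: supp in_keys_iff\<close>)
      then show "Poly_Mapping.lookup x h = Poly_Mapping.lookup (sum ?f {g. ?f g \<noteq> 0}) h" by simp
    qed
    then show "(\<forall>g. ?f g \<in> piece g) \<and> finite {g. ?f g \<noteq> \<zero>\<^bsub>kS\<^esub>} \<and>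
        x = finsum kS ?f {g. ?f g \<noteq> \<zero>\<^bsub>kS\<^esub>}"
      using fP piece_carrier[OF fP] by (simp add: finsum_kS supp)
  next
    fix f assume "(\<forall>g. f g \<in> piece g) \<and> finite {g. f g \<noteq> \<zero>\<^bsub>kS\<^esub>} \<and>
        x = finsum kS f {g. f g \<noteq> \<zero>\<^bsub>kS\<^esub>}"
    then have f: "\<And>g. f g \<in> piece g" "finite {g. f g \<noteq> 0}" and "x = finsum kS f {g. f g \<noteq> 0}" by auto
    then have xs: "x = sum f {g. f g \<noteq> 0}" using piece_carrier[OF f(1)] by (simp add: finsum_kS)
    have look: "Poly_Mapping.lookup x h = Poly_Mapping.lookup (f h) h" for h
      unfolding xs by (rule lookup_sum_of_pieces[OF f(2) f(1)]) simp
    show "f = ?f"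
    proof
      fix h
      show "f h = ?f h" unfolding look using f(1)[of h] unfolding piece_iff by auto
    qed
  qed
qed

sublocale kS: graded_ring kS piece by (rule graded_kS)

sublocale kS: thin_graded_ring kS piece p
proof
  fix x y g assume x: "x \<in> piece g" and y: "y \<in> piece g" "y \<noteq> \<zero>\<^bsub>kS\<^esub>"
  obtain b where b: "g \<in> S" "y = Poly_Mapping.single g b" using y by (auto simp: piece_iff)
  have b0: "b \<noteq> 0" using y(2) b(2) by auto
  obtain a where a: "x = Poly_Mapping.single g a" using x single_zero by (metis piece_iff)
  have "x = Poly_Mapping.single 0 (a / b) \<otimes>\<^bsub>kS\<^esub> y" using b0 by (simp add: a b(2) mult_single)
  moreover have "Poly_Mapping.single 0 (a / b) \<in> piece 0" unfolding piece_iff using zero_S by blast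
  ultimately show "\<exists>u\<in>piece 0. x = u \<otimes>\<^bsub>kS\<^esub> y" by blast
qed

definition gens :: "('m \<Rightarrow>\<^sub>0 'k) set" where "gens = (\<lambda>f. Poly_Mapping.single f 1) ` F"

lemma finite_gens: "finite gens" using finite_F by (simp add: gens_def)

lemma gens_carrier: "gens \<subseteq> carrier kS"
  using hull_subset[of F add_submonoid] by (auto simp: gens_def)

text \<open>Exponent vectors are normalized to vanish outside the generators, so that they can be compared
  pointwise.\<close>

lemma monomial_of_exponent:
  assumes "s \<in> S"
  shows "\<exists>w. (\<forall>e. e \<notin> gens \<longrightarrow> w e = 0) \<and> kS.monomial gens w = Poly_Mapping.single s 1"
proof -
  define good where "good s w \<longleftrightarrow> (\<forall>e. e \<notin> gens \<longrightarrow> w e = 0) \<and>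
    kS.monomial gens w = Poly_Mapping.single s (1::'k)" for s and w :: "('m \<Rightarrow>\<^sub>0 'k) \<Rightarrow> nat"
  have "S \<subseteq> {s. \<exists>w. good s w}"
  proof (rule hull_minimal)
    show "F \<subseteq> {s. \<exists>w. good s w}"
    proof
      fix f assume f: "f \<in> F"
      let ?e = "Poly_Mapping.single f (1::'k)"
      have e: "?e \<in> gens" using f by (simp add: gens_def)
      have "good f (\<lambda>e. if e = ?e then 1 else 0)"
        unfolding good_def using e kS.monomial_single[OF finite_gens gens_carrier e] by auto
      then show "f \<in> {s. \<exists>w. good s w}" by blast
    qed
    show "add_submonoid {s. \<exists>w. good s w}"
      unfolding add_submonoid_def
    proof (intro conjI ballI)
      have "good 0 (\<lambda>_. 0)" unfolding good_def using kS.monomial_zero[OF gens_carrier] by simp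
      then show "0 \<in> {s. \<exists>w. good s w}" by blast
      fix s t assume "s \<in> {s. \<exists>w. good s w}" "t \<in> {s. \<exists>w. good s w}"
      then obtain v w where vw: "good s v" "good t w" by blast
      then have "good (s + t) (\<lambda>e. v e + w e)"
        unfolding good_def using kS.monomial_add[OF gens_carrier, of v w] by (simp add: mult_single)
      then show "s + t \<in> {s. \<exists>w. good s w}" by blast
    qed
  qed
  then show ?thesis using assms unfolding good_def by blast
qed

text \<open>Dickson's lemma, applied to the exponent vectors over the generators of \<open>S\<close> of all monomials that
  generate \<open>I\<close>.\<close>

lemma monomial_ideal_finitely_generated:
  assumes I: "monomial_ideal S (I :: ('m \<Rightarrow>\<^sub>0 'k) set)"
  obtains F0 where "finite F0" "F0 \<subseteq> (\<lambda>a. Poly_Mapping.single a (1::'k)) ` S" "I = Idl\<^bsub>kS\<^esub> F0"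
proof -
  obtain A where A: "A \<subseteq> S" "I = Idl\<^bsub>kS\<^esub> ((\<lambda>a. Poly_Mapping.single a 1) ` A)"
    using I unfolding monomial_ideal_def by blast
  let ?A = "(\<lambda>a. Poly_Mapping.single a (1::'k)) ` A"
  have Ac: "?A \<subseteq> carrier kS" using A(1) by auto
  define V where "V = {w. (\<forall>e. e \<notin> gens \<longrightarrow> w e = 0) \<and> kS.monomial gens w \<in> ?A}"
  have "\<exists>B\<subseteq>V. finite B \<and> (\<forall>v\<in>V. \<exists>b\<in>B. \<forall>j. b j \<le> v j)"
    by (rule finite_minimal_vectors[OF finite_gens]) (simp add: V_def)
  then obtain B where B: "B \<subseteq> V" "finite B" "\<forall>v\<in>V. \<exists>b\<in>B. \<forall>j. b j \<le> v j" by blast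
  let ?F0 = "kS.monomial gens ` B"
  have F0A: "?F0 \<subseteq> ?A" using B(1) by (auto simp: V_def)
  have F0c: "?F0 \<subseteq> carrier kS" using F0A Ac by blast
  note K = kS.genideal_ideal[OF F0c]
  have "?A \<subseteq> Idl\<^bsub>kS\<^esub> ?F0"
  proof
    fix x assume x: "x \<in> ?A"
    then obtain a where a: "a \<in> A" "x = Poly_Mapping.single a 1" by blast
    obtain v where v: "\<forall>e. e \<notin> gens \<longrightarrow> v e = 0" "kS.monomial gens v = x"
      using monomial_of_exponent[of a] a A(1) by blast
    then have "v \<in> V" using x by (simp add: V_def)
    then obtain b where b: "b \<in> B" "\<forall>j. b j \<le> v j" using B(3) by blast
    have "kS.monomial gens v = kS.monomial gens (\<lambda>j. (v j - b j) + b j)"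
      by (rule kS.monomial_cong[OF gens_carrier]) (use b(2) in simp)
    also have "\<dots> = kS.monomial gens (\<lambda>j. v j - b j) \<otimes>\<^bsub>kS\<^esub> kS.monomial gens b"
      by (rule kS.monomial_add[OF gens_carrier])
    finally show "x \<in> Idl\<^bsub>kS\<^esub> ?F0"
      using kS.ideal_lmult[OF K kS.monomial_closed[OF gens_carrier] kS.genideal_mem_self[OF F0c, of "kS.monomial gens b"]]
        b(1) v(2) by simp
  qed
  then have "Idl\<^bsub>kS\<^esub> ?A \<subseteq> Idl\<^bsub>kS\<^esub> ?F0" by (rule kS.genideal_minimal[OF K])
  moreover have "Idl\<^bsub>kS\<^esub> ?F0 \<subseteq> Idl\<^bsub>kS\<^esub> ?A" using Ac F0A by (rule kS.subset_Idl_subset)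
  ultimately have "I = Idl\<^bsub>kS\<^esub> ?F0" using A(2) by blast
  moreover have "finite ?F0" using B(2) by simp
  moreover have "?F0 \<subseteq> (\<lambda>a. Poly_Mapping.single a 1) ` S" using F0A A(1) by blast
  ultimately show thesis using that by blast
qed

theorem left_stable_monomial_ideal:
  assumes I: "monomial_ideal S (I :: ('m \<Rightarrow>\<^sub>0 'k) set)" and s: "s > 1"
  shows "left_stable kS p I s"
proof -
  obtain F0 where F0: "finite F0" "F0 \<subseteq> (\<lambda>a. Poly_Mapping.single a (1::'k)) ` S" "I = Idl\<^bsub>kS\<^esub> F0"
    using monomial_ideal_finitely_generated[OF I] .
  show ?thesis
  proof (cases "F0 = {}")
    case True
    have "I = {0}"
    proof -
      have "Idl\<^bsub>kS\<^esub> {} \<subseteq> {\<zero>\<^bsub>kS\<^esub>}" by (rule kS.genideal_minimal[OF kS.zeroideal]) simp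
      moreover have "\<zero>\<^bsub>kS\<^esub> \<in> Idl\<^bsub>kS\<^esub> {}" by (rule kS.ideal_zero[OF kS.genideal_ideal]) simp
      ultimately show ?thesis using True F0(3) by auto
    qed
    then have "principalideal I kS"
      using kS.zeroideal kS.genideal_zero
      by (intro principalidealI bexI[of _ "\<zero>\<^bsub>kS\<^esub>"]) auto
    then show ?thesis using s prime_gt_0_nat[OF prime_p] by (intro kS.left_stable_principal) auto
  next
    case False
    have hom: "F0 \<subseteq> (\<Union>g. piece g)"
    proof
      fix x assume "x \<in> F0"
      then obtain a where "a \<in> S" "x = Poly_Mapping.single a 1" using F0(2) by blast
      then have "x \<in> piece a" unfolding piece_iff by blast
      then show "x \<in> (\<Union>g. piece g)" by blast
    qed
    have F0c: "F0 \<subseteq> carrier kS" using F0(2) by auto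
    show ?thesis unfolding F0(3)
    proof (rule kS.left_stable_homogeneous[OF F0(1) hom _ _ s])
      fix P assume "P \<in> minimal_primes kS"
      then have P: "P = {0}" by (simp add: minimal_primes_kS)
      obtain x where x: "x \<in> F0" using False by blast
      then obtain a where "x = Poly_Mapping.single a 1" using F0(2) by blast
      then have "x \<noteq> 0" using single_one_nonzero by simp
      then show "\<not> Idl\<^bsub>kS\<^esub> F0 \<subseteq> P" using P kS.genideal_mem_self[OF F0c x] by blast
      have P0: "ideal P kS" using kS.zeroideal P by simp
      show "\<exists>E. finite E \<and> E \<subseteq> carrier kS - P \<and>
          (\<forall>a\<in>(\<Union>g. piece g) - P. \<exists>w. kS.assoc_mod P a (kS.monomial E w))"
      proof (intro exI[of _ gens] conjI ballI)
        show "finite gens" by (rule finite_gens)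
        have "e \<noteq> 0" if e: "e \<in> gens" for e
        proof -
          obtain f where "e = Poly_Mapping.single f 1" using e unfolding gens_def by (rule imageE)
          then show ?thesis using single_one_nonzero by simp
        qed
        then show "gens \<subseteq> carrier kS - P" using gens_carrier P by blast
        fix a assume a: "a \<in> (\<Union>g. piece g) - P"
        then have a0: "a \<noteq> 0" using P by blast
        with a obtain g c where gc: "g \<in> S" "a = Poly_Mapping.single g c" by (auto simp: piece_iff)
        have "c \<noteq> 0" using a0 gc(2) by auto
        note g = gc this
        let ?m = "Poly_Mapping.single g (1::'k)"
        obtain w where w: "kS.monomial gens w = ?m" using monomial_of_exponent[OF g(1)] by blast
        have carr: "?m \<in> carrier kS" "a \<in> carrier kS" "Poly_Mapping.single 0 d \<in> carrier kS" for d
          using g zero_S by auto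
        have "a = Poly_Mapping.single 0 c \<otimes>\<^bsub>kS\<^esub> ?m" using g by (simp add: mult_single)
        then have 1: "kS.divides_mod P ?m a"
          using kS.divides_mod_multiple[OF P0 carr(1) carr(3)] by simp
        have "?m = Poly_Mapping.single 0 (1 / c) \<otimes>\<^bsub>kS\<^esub> a" using g by (simp add: mult_single)
        then have 2: "kS.divides_mod P a ?m"
          using kS.divides_mod_multiple[OF P0 carr(2) carr(3)] by metis
        show "\<exists>w. kS.assoc_mod P a (kS.monomial gens w)"
          using 1 2 w unfolding kS.assoc_mod_def by metis
      qed
    qed
  qed
qed

end

lemma nat_vectors_hull: "nat_vectors n = add_submonoid hull ((\<lambda>i. Poly_Mapping.single i 1) ` {..<n})"
proof
  let ?H = "add_submonoid hull ((\<lambda>i. Poly_Mapping.single i (1::nat)) ` {..<n})"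
  note H = add_submonoid_hull[of "(\<lambda>i. Poly_Mapping.single i (1::nat)) ` {..<n}"]
  show "nat_vectors n \<subseteq> ?H"
  proof
    fix v assume v: "v \<in> nat_vectors n"
    have "Poly_Mapping.single i m \<in> ?H" if "i < n" for i m
    proof (induction m)
      case 0 then show ?case using add_submonoid_zero[OF H] by simp
    next
      case (Suc m)
      have "Poly_Mapping.single i (1::nat) \<in> ?H" using that by (intro hull_inc) simp
      then have "Poly_Mapping.single i m + Poly_Mapping.single i 1 \<in> ?H"
        by (intro add_submonoid_add[OF H Suc])
      then show ?case by (simp flip: single_add)
    qed
    then have "(\<Sum>i\<in>Poly_Mapping.keys v. Poly_Mapping.single i (Poly_Mapping.lookup v i)) \<in> ?H"
      using v by (intro add_submonoid_sum[OF H]) (auto simp: nat_vectors_def)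
    also have "(\<Sum>i\<in>Poly_Mapping.keys v. Poly_Mapping.single i (Poly_Mapping.lookup v i)) = v"
    proof (rule poly_mapping_eqI)
      fix j
      have "Poly_Mapping.lookup (\<Sum>i\<in>Poly_Mapping.keys v. Poly_Mapping.single i (Poly_Mapping.lookup v i)) j
         = (\<Sum>i\<in>Poly_Mapping.keys v. if i = j then Poly_Mapping.lookup v j else 0)"
        unfolding lookup_sum by (intro sum.cong) (auto simp: lookup_single)
      also have "\<dots> = Poly_Mapping.lookup v j" by (simp add: in_keys_iff)
      finally show "Poly_Mapping.lookup (\<Sum>i\<in>Poly_Mapping.keys v.
        Poly_Mapping.single i (Poly_Mapping.lookup v i)) j = Poly_Mapping.lookup v j" .
    qed
    finally show "v \<in> ?H" .
  qed
  show "?H \<subseteq> nat_vectors n"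
  proof (rule hull_minimal)
    show "(\<lambda>i. Poly_Mapping.single i 1) ` {..<n} \<subseteq> nat_vectors n" by (auto simp: nat_vectors_def)
    show "add_submonoid (nat_vectors n)"
      unfolding add_submonoid_def nat_vectors_def using keys_add by (fastforce dest: subsetD)
  qed
qed

section \<open>Left stability of the five classes of ideals\<close>

theorem corollary4p16:
  fixes p :: nat
  assumes "normalization_semidom_class.prime p"
  shows
    "(CHAR('k :: field) = p \<longrightarrow>
        (\<forall>n (I :: ((nat \<Rightarrow>\<^sub>0 nat) \<Rightarrow>\<^sub>0 'k) set).
           monomial_ideal (nat_vectors n) I \<longrightarrow>
           (\<forall>s>1. left_stable (monoid_algebra (nat_vectors n)) p I s)))
     \<and>
     (CHAR('k) = p \<longrightarrow>
        (\<forall>n S (I :: ((nat \<Rightarrow>\<^sub>0 int) \<Rightarrow>\<^sub>0 'k) set).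
           affine_semigroup n S \<and> monomial_ideal S I \<longrightarrow>
           (\<forall>s>1. left_stable (monoid_algebra S) p I s)))
     \<and>
     (\<forall>(R :: ('a, 'b) ring_scheme) (\<A> :: 'g :: monoid_add \<Rightarrow> 'a set) I.
        graded_ring R \<A> \<and> noetherian_ring R \<and> ring_char R = p \<and>
        (\<forall>g. module_length (zeroth_ring R \<A>) (piece_module R \<A> g) = 1) \<and>
        homogeneous_ideal R \<A> I \<and> 0 < ideal_height R I \<longrightarrow>
        (\<forall>s>1. left_stable R p I s))
     \<and>
     (\<forall>(R :: ('a, 'b) ring_scheme) (\<A> :: nat \<Rightarrow> 'a set) (n :: nat).
        graded_ring R \<A> \<and> noetherian_ring R \<and> ring_char R = p \<and>
        generated_in_degree_one R \<A> \<longrightarrow>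
        (\<forall>s>1. left_stable R p (irrelevant_ideal R \<A> [^]\<^bsub>ideals_set R\<^esub> n) s))
     \<and>
     (\<forall>(R :: ('a, 'b) ring_scheme) I.
        cring R \<and> noetherian_ring R \<and> ring_char R = p \<and> principalideal I R \<longrightarrow>
        (\<forall>s>1. left_stable R p I s))"
proof (intro conjI impI allI)
  fix n and I :: "((nat \<Rightarrow>\<^sub>0 nat) \<Rightarrow>\<^sub>0 'k) set" and s :: real
  assume "CHAR('k) = p" and I: "monomial_ideal (nat_vectors n) I" and s: "1 < s"
  interpret A: finitely_generated_monoid_algebra
    "(\<lambda>i. Poly_Mapping.single i 1) ` {..<n} :: (nat \<Rightarrow>\<^sub>0 nat) set" "TYPE('k)" p
    by unfold_locales (use assms \<open>CHAR('k) = p\<close> in auto)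
  show "left_stable (monoid_algebra (nat_vectors n)) p I s"
    using A.left_stable_monomial_ideal[of I s] I s by (simp add: nat_vectors_hull)
next
  fix n S and I :: "((nat \<Rightarrow>\<^sub>0 int) \<Rightarrow>\<^sub>0 'k) set" and s :: real
  assume "CHAR('k) = p" and SI: "affine_semigroup n S \<and> monomial_ideal S I" and s: "1 < s"
  then obtain F where F: "finite F" "S = add_submonoid hull F" unfolding affine_semigroup_def by blast
  interpret A: finitely_generated_monoid_algebra F "TYPE('k)" p
    by unfold_locales (use assms F \<open>CHAR('k) = p\<close> in auto)
  show "left_stable (monoid_algebra S) p I s"
    using A.left_stable_monomial_ideal[of I s] SI s by (simp add: F(2))
next
  fix R :: "('a, 'b) ring_scheme" and \<A> :: "'g \<Rightarrow> 'a set" and I and s :: real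
  assume "graded_ring R \<A> \<and> noetherian_ring R \<and> ring_char R = p \<and>
        (\<forall>g. module_length (zeroth_ring R \<A>) (piece_module R \<A> g) = 1) \<and>
        homogeneous_ideal R \<A> I \<and> 0 < ideal_height R I" and "1 < s"
  then show "left_stable R p I s"
    by (intro left_stable_length_one_pieces[of R \<A>] assms) auto
next
  fix R :: "('a, 'b) ring_scheme" and \<A> :: "nat \<Rightarrow> 'a set" and n :: nat and s :: real
  assume "graded_ring R \<A> \<and> noetherian_ring R \<and> ring_char R = p \<and> generated_in_degree_one R \<A>"
    and "1 < s"
  then show "left_stable R p (irrelevant_ideal R \<A> [^]\<^bsub>ideals_set R\<^esub> n) s"
    by (intro left_stable_powers_of_irrelevant_ideal assms) auto
next
  fix R :: "('a, 'b) ring_scheme" and I and s :: real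
  assume "cring R \<and> noetherian_ring R \<and> ring_char R = p \<and> principalideal I R" and "1 < s"
  then show "left_stable R p I s"
    using prime_gt_0_nat[OF assms] by (intro cring.left_stable_principal) auto
qed

end
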